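(* Let $1\le k\le d$ and assume that $f,g\in L^2(\mathbb{R}^d)$ satisfy $$|V^k_gf(\lambda)|\le c(1+\|\lambda\|)^N e^{-\pi\alpha\|\lambda\|^2/2}\quad\text{for a.a. }\lambda\in\mathbb{R}^{2d}$$ for some $\alpha,c>0$ and $N\ge0$. (i) If $\alpha>1$, then $f\equiv0$ or $g\equiv0$. (ii) If $\alpha=1$, then one of the following occurs. Either $f\equiv0$ or $g\equiv0$, or neither $f$ nor $g$ is the zero function and both can be written as $$f(x_1,x_2)=p(x_1,x_2)e^{2\pi i\omega_0\cdot x_1}e^{-\pi(x_1-x_0)\cdot A(x_1-x_0)}\quad\text{for a.a. }(x_1,x_2)\in\mathbb{R}^d,$$ $$g(x_1,x_2)=q(x_1,x_2)e^{2\pi i\omega_0\cdot x_1}e^{-\pi(x_1-x_0)\cdot A(x_1-x_0)}\quad\text{for a.a. }(x_1,x_2)\in\mathbb{R}^d,$$ with polynomials $p(\cdot,x_2)$, $q(\cdot,\omega_2)$ whose degrees satisfy $\deg(p_{x_2})+\deg(q_{-\omega_2})\le N$ for almost all $(x_2,\omega_2)\in\mathbb{R}^{2(d-k)}$, $x_0,\omega_0\in\mathbb{C}^k$, and $A\in\mathbb{R}^{k\times k}$ a real positive definite matrix. (iii) If, in addition, $k=d$ and $\alpha=1$, then $p$ and $q$ are polynomials, i.e., $f$ and $g$ are finite linear combinations of Hermite functions.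
   Context: $\|\cdot\|$ is the Euclidean norm; $f\equiv0$ means that $f$ is zero almost everywhere. Points of $\mathbb{R}^d$ are written $x=(x_1,x_2)\in\mathbb{R}^k\times\mathbb{R}^{d-k}$. For a function $h$ on $\mathbb{R}^d$, $h_{x_2}=h(\cdot,x_2)$ denotes its restriction to a function of the first $k$ variables; thus $p_{x_2}=p(\cdot,x_2)$ and $q_{-\omega_2}=q(\cdot,-\omega_2)$, which are polynomials in the variable $x_1\in\mathbb{R}^k$. Partial short-time Fourier transform: for $1\le k\le d$ and $f,g\in L^2(\mathbb{R}^d)$, $$V^k_gf(x_1,x_2,\omega_1,\omega_2)=\int_{\mathbb{R}^k}f(t,x_2)\overline{g(t-x_1,-\omega_2)}e^{-2\pi i t\cdot\omega_1}\,dt,$$ for $(x_1,x_2,\omega_1,\omega_2)\in\mathbb{R}^k\times\mathbb{R}^{d-k}\times\mathbb{R}^k\times\mathbb{R}^{d-k}$ (defined for almost all $(x_2,\omega_2)$); for $k=d$ the variables $x_2,\omega_2$ are absent and this is the usual short-time Fourier transform. In part (iii), $p$ and $q$ are the functions appearing in the representation of $f$ and $g$ in part (ii).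
   Formalization: In (iii), for f, g both nonzero, the Hermite functions are allowed one common translation and modulation; for centred Hermite functions the claim fails, e.g. for f=g=exp(-π‖x-u‖²) with u≠0, α=1, N=0. *)

theory Defs
  imports "HOL-Analysis.Analysis" "HOL-Computational_Algebra.Polynomial"
begin

section \<open>The spaces \<open>\<real>\<^sup>n\<close> and \<open>\<real>\<^sup>k \<times> \<real>\<^sup>d\<^sup>-\<^sup>k\<close>\<close>

text \<open>
  The first factor of \<open>\<real>\<^sup>d = \<real>\<^sup>k \<times> \<real>\<^sup>d\<^sup>-\<^sup>k\<close> is the type \<open>real ^ 'k\<close> with \<open>k = CARD('k) \<ge> 1\<close>.
  The second factor may have dimension \<open>0\<close> (when \<open>k = d\<close>), which no type \<open>real ^ 'n\<close> has. It is
  therefore modelled by the extensional functions on \<open>{..<d - k}\<close>; for \<open>k = d\<close> it is a single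
  point, of mass \<open>1\<close>. Outside the space of the measure, functions on it have no meaning.
\<close>

definition Rn :: "nat \<Rightarrow> (nat \<Rightarrow> real) measure" where
  "Rn n = PiM {..<n} (\<lambda>_. lborel)"

definition uminus_Rn :: "nat \<Rightarrow> (nat \<Rightarrow> real) \<Rightarrow> nat \<Rightarrow> real" where
  "uminus_Rn n y = (\<lambda>i\<in>{..<n}. - y i)"

definition Rd :: "nat \<Rightarrow> ((real ^ 'k) \<times> (nat \<Rightarrow> real)) measure" where
  "Rd d = lborel \<Otimes>\<^sub>M Rn (d - CARD('k))"

definition norm_Rd :: "nat \<Rightarrow> (real ^ 'k) \<times> (nat \<Rightarrow> real) \<Rightarrow> real" where
  "norm_Rd d x = sqrt ((norm (fst x))\<^sup>2 + (\<Sum>i<d - CARD('k). (snd x i)\<^sup>2))"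

definition norm_R2d :: "nat \<Rightarrow>
    ((real ^ 'k) \<times> (nat \<Rightarrow> real)) \<times> ((real ^ 'k) \<times> (nat \<Rightarrow> real)) \<Rightarrow> real" where
  "norm_R2d d l = sqrt ((norm_Rd d (fst l))\<^sup>2 + (norm_Rd d (snd l))\<^sup>2)"

definition L2 :: "'a measure \<Rightarrow> ('a \<Rightarrow> complex) \<Rightarrow> bool" where
  "L2 M f \<longleftrightarrow> f \<in> borel_measurable M \<and> integrable M (\<lambda>x. (cmod (f x))\<^sup>2)"

definition ae_zero :: "'a measure \<Rightarrow> ('a \<Rightarrow> complex) \<Rightarrow> bool" where
  "ae_zero M f \<longleftrightarrow> (AE x in M. f x = 0)"

section \<open>The partial short-time Fourier transform\<close>

definition partial_stft :: "nat \<Rightarrow>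
    ((real ^ 'k) \<times> (nat \<Rightarrow> real) \<Rightarrow> complex) \<Rightarrow> ((real ^ 'k) \<times> (nat \<Rightarrow> real) \<Rightarrow> complex) \<Rightarrow>
    ((real ^ 'k) \<times> (nat \<Rightarrow> real)) \<times> ((real ^ 'k) \<times> (nat \<Rightarrow> real)) \<Rightarrow> complex" where
  "partial_stft d g f = (\<lambda>((x1, x2), (w1, w2)).
     (\<integral>t. f (t, x2) * cnj (g (t - x1, uminus_Rn (d - CARD('k)) w2))
          * exp (- 2 * pi * \<i> * complex_of_real (t \<bullet> w1)) \<partial>lborel))"

section \<open>Polynomials\<close>

definition monomial_fun :: "('k \<Rightarrow> nat) \<Rightarrow> real ^ 'k \<Rightarrow> complex" where
  "monomial_fun m x = (\<Prod>i\<in>UNIV. complex_of_real (x $ i) ^ m i)"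

text \<open>
  Total degree of a polynomial function; unspecified if \<open>P\<close> is not polynomial. The zero
  polynomial gets degree \<open>0\<close>, which makes an upper bound on a sum of degrees at least as strong
  as under the convention \<open>-\<infinity>\<close>.
\<close>

definition total_deg :: "(real ^ 'k \<Rightarrow> complex) \<Rightarrow> nat" where
  "total_deg P = (LEAST n. \<exists>a :: ('k \<Rightarrow> nat) \<Rightarrow> complex.
     \<forall>x. P x = (\<Sum>m\<in>{m. (\<Sum>i\<in>UNIV. m i) \<le> n}. a m * monomial_fun m x))"

text \<open>Polynomials in all \<open>d\<close> variables.\<close>

definition polynomial_Rd :: "nat \<Rightarrow> ((real ^ 'k) \<times> (nat \<Rightarrow> real) \<Rightarrow> complex) \<Rightarrow> bool" where
  "polynomial_Rd d p \<longleftrightarrow> (\<exists>M :: (('k \<Rightarrow> nat) \<times> (nat \<Rightarrow> nat)) set. finite M \<and>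
     (\<exists>a. \<forall>x\<in>space (Rd d :: ((real ^ 'k) \<times> (nat \<Rightarrow> real)) measure).
        p x = (\<Sum>(m, l)\<in>M. a (m, l) * monomial_fun m (fst x)
                 * (\<Prod>j<d - CARD('k). complex_of_real (snd x j) ^ l j))))"

section \<open>Gaussians and Hermite functions\<close>

definition pos_def :: "real ^ 'k ^ 'k \<Rightarrow> bool" where
  "pos_def A \<longleftrightarrow> transpose A = A \<and> (\<forall>x. x \<noteq> 0 \<longrightarrow> 0 < x \<bullet> (A *v x))"

definition cvec :: "real ^ 'k \<Rightarrow> complex ^ 'k" where
  "cvec x = (\<chi> i. complex_of_real (x $ i))"

text \<open>The dot product on \<open>\<complex>\<^sup>k\<close> is bilinear; there is no conjugation.\<close>

definition cdot :: "complex ^ 'k \<Rightarrow> complex ^ 'k \<Rightarrow> complex" where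
  "cdot u v = (\<Sum>i\<in>UNIV. u $ i * v $ i)"

definition gaussian :: "complex ^ 'k \<Rightarrow> complex ^ 'k \<Rightarrow> real ^ 'k ^ 'k \<Rightarrow> real ^ 'k \<Rightarrow> complex" where
  "gaussian x0 w0 A x =
     exp (2 * pi * \<i> * cdot w0 (cvec x))
     * exp (- pi * cdot (cvec x - x0) (map_matrix complex_of_real A *v (cvec x - x0)))"

definition gaussian_form :: "nat \<Rightarrow> real \<Rightarrow>
    ((real ^ 'k) \<times> (nat \<Rightarrow> real) \<Rightarrow> complex) \<Rightarrow> ((real ^ 'k) \<times> (nat \<Rightarrow> real) \<Rightarrow> complex) \<Rightarrow>
    ((real ^ 'k) \<times> (nat \<Rightarrow> real) \<Rightarrow> complex) \<Rightarrow> ((real ^ 'k) \<times> (nat \<Rightarrow> real) \<Rightarrow> complex) \<Rightarrow>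
    complex ^ 'k \<Rightarrow> complex ^ 'k \<Rightarrow> real ^ 'k ^ 'k \<Rightarrow> bool" where
  "gaussian_form d N f g p q x0 w0 A \<longleftrightarrow>
     pos_def A \<and>
     (AE x in Rd d. f x = p x * gaussian x0 w0 A (fst x)) \<and>
     (AE x in Rd d. g x = q x * gaussian x0 w0 A (fst x)) \<and>
     (AE (x2, w2) in Rn (d - CARD('k)) \<Otimes>\<^sub>M Rn (d - CARD('k)).
        let p_x2 = (\<lambda>x1. p (x1, x2)); q_w2 = (\<lambda>x1. q (x1, uminus_Rn (d - CARD('k)) w2))
        in polynomial_function p_x2 \<and> polynomial_function q_w2 \<and>
           real (total_deg p_x2 + total_deg q_w2) \<le> N)"

text \<open>Physicists' Hermite polynomials: \<open>H\<^sub>0 = 1\<close>, \<open>H\<^sub>n\<^sub>+\<^sub>1 = 2 X H\<^sub>n - H\<^sub>n'\<close>.\<close>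

primrec hermite_poly :: "nat \<Rightarrow> real poly" where
  "hermite_poly 0 = 1"
| "hermite_poly (Suc n) = [:0, 2:] * hermite_poly n - pderiv (hermite_poly n)"

text \<open>
  Hermite functions on \<open>\<real>\<^sup>k\<close>, without the \<open>L\<^sup>2\<close>-normalising constants, in the normalisation of the
  Fourier transform with kernel \<open>exp (- 2 \<pi> i x \<cdot> \<omega>)\<close>, i.e. with Gaussian \<open>exp (- \<pi> \<parallel>x\<parallel>\<^sup>2)\<close>.
\<close>

definition hermite_fun :: "('k \<Rightarrow> nat) \<Rightarrow> real ^ 'k \<Rightarrow> real" where
  "hermite_fun m x = (\<Prod>i\<in>UNIV. poly (hermite_poly (m i)) (sqrt (2 * pi) * x $ i) * exp (- pi * (x $ i)\<^sup>2))"

text \<open>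
  \<open>h\<close> is a finite linear combination of Hermite functions translated by \<open>u\<close> and modulated by \<open>v\<close>;
  meant for \<open>d = CARD('k)\<close>, where \<open>\<real>\<^sup>d\<close> is the first factor. The time-frequency shift cannot be
  dispensed with: for \<open>f = g = exp (- \<pi> \<parallel>x - u\<parallel>\<^sup>2)\<close>, \<open>\<bar>V\<^sub>g f(\<lambda>)\<bar>\<close> is a multiple of
  \<open>exp (- \<pi> \<parallel>\<lambda>\<parallel>\<^sup>2 / 2)\<close>, but \<open>f\<close> is not a finite combination of centred Hermite functions if \<open>u \<noteq> 0\<close>.
  No dilation is needed, since decay at the critical rate \<open>\<alpha> = 1\<close> forces the matrix \<open>A\<close> to be the identity.
\<close>

definition hermite_combination :: "nat \<Rightarrow> real ^ 'k \<Rightarrow> real ^ 'k \<Rightarrow>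
    ((real ^ 'k) \<times> (nat \<Rightarrow> real) \<Rightarrow> complex) \<Rightarrow> bool" where
  "hermite_combination d u v h \<longleftrightarrow> (\<exists>M :: ('k \<Rightarrow> nat) set. finite M \<and> (\<exists>c :: ('k \<Rightarrow> nat) \<Rightarrow> complex.
     AE x in Rd d. h x =
       (\<Sum>m\<in>M. c m * (exp (2 * pi * \<i> * complex_of_real (v \<bullet> fst x))
                      * complex_of_real (hermite_fun m (fst x - u))))))"

end

theory Submission
  imports Defs "HOL-Computational_Algebra.Fundamental_Theorem_Algebra"
    "HOL-Probability.Probability" "HOL-Complex_Analysis.Complex_Analysis"
begin

text \<open>
  Let \<open>B F (z) = exp (- \<pi> z\<^sup>2 / 2) \<integral> F (t) exp (- \<pi> t\<^sup>2 + 2 \<pi> t z) dt\<close> be the Bargmann transform. The product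
  \<open>B F (z) \<cdot> cnj (B G (y))\<close> is the integral of the short-time Fourier transform \<open>V\<^sub>G F\<close> against an explicit
  Gaussian centred at \<open>z - y\<close>. If \<open>V\<^sub>G F (\<lambda>) = O((1 + \<parallel>\<lambda>\<parallel>)\<^sup>N exp (- \<pi> \<parallel>\<lambda>\<parallel>\<^sup>2 / 2))\<close>, this yields
  \<open>\<bar>B F (z) B G (y)\<bar> \<le> C (1 + \<parallel>z - y\<parallel>)\<^sup>N exp (\<pi> \<parallel>z + y\<parallel>\<^sup>2 / 4)\<close>. On \<open>y = \<tau> - z\<close> the exponential is constant,
  so by Liouville's theorem \<open>z \<mapsto> B F (z) B G (\<tau> - z)\<close> is a polynomial of degree at most \<open>N\<close> for every \<open>\<tau>\<close>.
  For \<open>N < 0\<close> it vanishes. For \<open>N \<ge> 0\<close> the factors have, along each complex line, the form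
  \<open>p \<cdot> exp h\<close> and \<open>q \<cdot> exp (- h)\<close> with polynomials \<open>p, q\<close>, and varying \<open>\<tau>\<close> forces \<open>h\<close> to be affine. Hence \<open>B F\<close> and \<open>B G\<close>
  are polynomials times a common exponential, and inverting the transform gives polynomials times a
  common Gaussian. The partial transform is an ordinary one on almost every pair of slices; the centre of
  the Gaussian cannot depend on the slices, since each slice of \<open>f\<close> is paired with almost all slices of \<open>g\<close>.
\<close>

section \<open>Entire functions of one variable\<close>

text \<open>Functions of several complex variables are avoided. The transform is studied only on
  complex lines \<open>cvec s + \<zeta> *s cvec v\<close> with real s and v, where it is an
  exponential integral in one variable; the lines are glued by uniqueness of exponents and by
  interpolation, which works because N bounds all degrees uniformly. A bound on a product of two
  functions is weaker than it looks: f = exp h and g = exp (- h) have product 1 for every entire h.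
  Translating one factor against the other excludes this, since h(z) - h(z - \<tau>) must then be
  constant for every \<tau>. The rate pi / 2 is critical because the kernel of the product formula
  decays at the same rate. The two rates add up to pi, and the only exponential that survives is exp
  (pi |z + y|^2 / 4). A surplus \<alpha> > 1 is spent on lowering the exponent N to -1, so parts (i)
  and (ii) come from one statement about all real N. The polynomials belonging to the slices come
  from almost-everywhere arguments, so they have to be selected measurably before they can be joined
  into functions on R^d.\<close>

lemma powr_one_plus_over_power_tendsto_0:
  fixes N :: real
  assumes "real k > N"
  shows "((\<lambda>r. (1 + r) powr N / r ^ k) \<longlongrightarrow> 0) at_top"
proof (rule Lim_null_comparison)
  have "\<forall>\<^sub>F r::real in at_top. r \<ge> 1" by (rule eventually_ge_at_top)
  then show "\<forall>\<^sub>F r in at_top. norm ((1 + r) powr N / r ^ k) \<le> 2 powr \<bar>N\<bar> * r powr (N - real k)"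
  proof eventually_elim
    case (elim r)
    have "(1 + r) powr N \<le> 2 powr \<bar>N\<bar> * r powr N"
    proof (cases "N \<ge> 0")
      case True
      then have "(1 + r) powr N \<le> (2 * r) powr N" using elim by (intro powr_mono2) auto
      then show ?thesis using True elim by (simp add: powr_mult)
    next
      case False
      have "(1 + r) powr N \<le> 1 * r powr N" using elim False by (simp add: powr_mono2')
      also have "\<dots> \<le> 2 powr \<bar>N\<bar> * r powr N" by (intro mult_right_mono) (auto simp: ge_one_powr_ge_zero)
      finally show ?thesis .
    qed
    then have "(1 + r) powr N / r ^ k \<le> 2 powr \<bar>N\<bar> * r powr N / r ^ k"
      using elim by (intro divide_right_mono) auto
    also have "\<dots> = 2 powr \<bar>N\<bar> * r powr (N - real k)"
      using elim by (simp add: powr_diff powr_realpow)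
    finally show ?case using elim by simp
  qed
  have "((\<lambda>r. r powr (N - real k)) \<longlongrightarrow> 0) at_top"
    using assms by (intro tendsto_neg_powr filterlim_ident) auto
  then show "((\<lambda>r. 2 powr \<bar>N\<bar> * r powr (N - real k)) \<longlongrightarrow> 0) at_top"
    using tendsto_mult_right_zero by blast
qed

text \<open>Letting r tend to infinity in Cauchy's inequality kills every Taylor coefficient of
  order above N, for real N of either sign. The guard \<open>p \<noteq> 0\<close> matters for N < 0:
  then f vanishes, but the zero polynomial has degree 0, which exceeds N.\<close>

lemma entire_growth_imp_poly:
  fixes f :: "complex \<Rightarrow> complex"
  assumes hol: "f holomorphic_on UNIV"
    and growth: "\<And>z. cmod (f z) \<le> C * (1 + cmod z) powr N"
  obtains p where "f = poly p" "p \<noteq> 0 \<Longrightarrow> real (degree p) \<le> N"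
proof -
  define a where "a k = (deriv ^^ k) f 0 / fact k" for k
  have a0: "a k = 0" if "real k > N" for k
  proof -
    have "norm ((deriv ^^ k) f 0) \<le> fact k * C * ((1 + r) powr N / r ^ k)" if "r > 0" for r
      using Cauchy_inequality[of f 0 r "C * (1 + r) powr N" k] hol growth that
      by (metis (no_types, lifting) UNIV_I diff_0 holomorphic_on_imp_continuous_on holomorphic_on_subset
          mult.assoc norm_minus_cancel subsetI times_divide_eq_right)
    then have "\<forall>\<^sub>F r in at_top. norm ((deriv ^^ k) f 0) \<le> fact k * C * ((1 + r) powr N / r ^ k)"
      using eventually_gt_at_top[of 0] by (rule eventually_mono[rotated])
    moreover have "((\<lambda>r. fact k * C * ((1 + r) powr N / r ^ k)) \<longlongrightarrow> 0) at_top"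
      using powr_one_plus_over_power_tendsto_0[OF that] tendsto_mult_right_zero by blast
    ultimately have "norm ((deriv ^^ k) f 0) \<le> 0"
      by (intro tendsto_lowerbound[of _ 0]) auto
    then show ?thesis by (simp add: a_def)
  qed
  have C: "C \<ge> 0" using growth[of 0] norm_ge_zero[of "f 0"] by (simp del: norm_ge_zero)
  \<comment> \<open>Liouville's theorem asks for an integer power. This rounded exponent only yields
    a finite expansion; the sharp degree comes from \<open>a0\<close>.\<close>
  define n where "n = nat \<lceil>N\<rceil>"
  have "cmod (f z) \<le> (C * 2 ^ n) * cmod z ^ n" if "1 \<le> cmod z" for z
  proof -
    have "(1 + cmod z) powr N \<le> (1 + cmod z) powr real n"
      using that real_nat_ceiling_ge[of N] by (intro powr_mono) (auto simp: n_def)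
    also have "\<dots> = (1 + cmod z) ^ n" using that by (intro powr_realpow) auto
    also have "\<dots> \<le> (2 * cmod z) ^ n" using that by (intro power_mono) auto
    finally have "C * (1 + cmod z) powr N \<le> C * (2 * cmod z) ^ n"
      using C by (intro mult_left_mono) auto
    then show ?thesis using growth[of z] by (simp add: power_mult_distrib mult_ac)
  qed
  from Liouville_polynomial[OF hol this] have f: "f z = (\<Sum>k\<le>n. a k * z ^ k)" for z
    unfolding a_def .
  define p where "p = (\<Sum>k\<le>n. monom (a k) k)"
  have cp: "coeff p k = (if k \<le> n then a k else 0)" for k
    by (auto simp: p_def coeff_sum)
  show thesis
  proof
    show "f = poly p" by (auto simp: f p_def poly_sum poly_monom)
    assume "p \<noteq> 0"
    then have "a (degree p) \<noteq> 0" using cp[of "degree p"] by (metis leading_coeff_0_iff)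
    then show "real (degree p) \<le> N" using a0 by force
  qed
qed

lemma poly_root_exists:
  fixes p :: "complex poly"
  assumes "degree p \<noteq> 0"
  obtains z where "poly p z = 0"
  using Fundamental_Theorem_Algebra.fundamental_theorem_of_algebra[of p] assms by (auto simp: constant_degree)

text \<open>Every root of Q is a root of R, so common linear factors can be cancelled until Q is
  constant. A remaining root of R would then be a zero of u; so R is constant as well.\<close>

lemma entire_nonvanishing_times_poly:
  fixes u :: "complex \<Rightarrow> complex"
  assumes "u holomorphic_on UNIV" "\<And>z. u z \<noteq> 0" "Q \<noteq> 0"
    and "\<And>z. u z * poly Q z = poly R z"
  shows "\<exists>k. u = (\<lambda>_. k)"
  using assms(3,4)
proof (induction "degree Q" arbitrary: Q R)
  case 0
  obtain b where Q: "Q = [:b:]" using degree_eq_zeroE[of Q] 0(1) by metis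
  with 0(2) have b: "b \<noteq> 0" by auto
  have "degree R = 0"
  proof (rule ccontr)
    assume "degree R \<noteq> 0"
    then obtain z where "poly R z = 0" by (rule poly_root_exists)
    then show False using 0(3)[of z] Q b assms(2)[of z] by simp
  qed
  then obtain r where "R = [:r:]" using degree_eq_zeroE[of R] by metis
  then have "u z = r / b" for z using 0(3)[of z] Q b by (simp add: field_simps)
  then show ?case by blast
next
  case (Suc n)
  have "degree Q \<noteq> 0" using Suc(2) by simp
  then obtain z where z: "poly Q z = 0" by (rule poly_root_exists)
  then have "poly R z = 0" using Suc(4)[of z] by simp
  with z have "[:-z, 1:] dvd Q" "[:-z, 1:] dvd R" by (simp_all add: poly_eq_0_iff_dvd)
  then obtain Q' R' where QR: "Q = [:-z, 1:] * Q'" "R = [:-z, 1:] * R'" by (auto elim!: dvdE)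
  have Q': "Q' \<noteq> 0" using Suc(3) QR by auto
  have deg: "n = degree Q'" using Suc(2) Q' degree_mult_eq[of "[:-z, 1:]" Q'] unfolding QR by simp
  have eq: "u w * poly Q' w = poly R' w" if "w \<noteq> z" for w
  proof -
    have "(w - z) * (u w * poly Q' w) = (w - z) * poly R' w"
      using Suc(4)[of w] unfolding QR by (simp add: algebra_simps)
    then show ?thesis using that by simp
  qed
  \<comment> \<open>Cancelling w - z says nothing at z itself; continuity supplies the missing
    value.\<close>
  have "continuous_on UNIV (\<lambda>w. u w * poly Q' w - poly R' w)"
    using assms(1) by (intro continuous_intros holomorphic_on_imp_continuous_on) auto
  then have "isCont (\<lambda>w. u w * poly Q' w - poly R' w) z" by (simp add: continuous_on_eq_continuous_at)
  then have "((\<lambda>w. u w * poly Q' w - poly R' w) \<longlongrightarrow> u z * poly Q' z - poly R' z) (at z)"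
    by (simp add: isCont_def)
  moreover have "((\<lambda>w. u w * poly Q' w - poly R' w) \<longlongrightarrow> 0) (at z)"
    by (rule tendsto_eventually) (auto simp: eventually_at eq intro!: exI[of _ 1])
  ultimately have "u z * poly Q' z - poly R' z = 0"
    using LIM_unique by blast
  then have "u w * poly Q' w = poly R' w" for w using eq by (cases "w = z") auto
  then show ?case by (rule Suc(1)[OF deg Q'])
qed

lemma entire_zero_on_reals:
  fixes f :: "complex \<Rightarrow> complex"
  assumes hol: "f holomorphic_on UNIV" and zero: "\<And>r. f (of_real r) = 0"
  shows "f z = 0"
proof (rule analytic_continuation[OF hol, where U = "range complex_of_real" and \<xi> = 0])
  show "0 islimpt range complex_of_real"
    unfolding islimpt_approachable
  proof (intro allI impI)
    fix e :: real assume "e > 0"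
    then show "\<exists>x'\<in>range complex_of_real. x' \<noteq> 0 \<and> dist x' 0 < e"
      by (intro bexI[of _ "complex_of_real (e/2)"] rangeI) (auto simp: dist_norm)
  qed
qed (use zero in auto)

text \<open>The identity theorem extends the equation from the reals to the plane, where exp ((c -
  d) z) times p is q, so that this zero-free factor is constant. Later this makes the exponents
  found on different pairs of lines comparable.\<close>

lemma exp_poly_unique:
  fixes c d :: complex and p q :: "complex poly"
  assumes "p \<noteq> 0" and eq: "\<And>r::real. poly p r * exp (c * r) = poly q r * exp (d * r)"
  shows "c = d \<and> p = q"
proof -
  have "poly p z * exp (c * z) - poly q z * exp (d * z) = 0" for z
    by (rule entire_zero_on_reals[where f = "\<lambda>z. poly p z * exp (c * z) - poly q z * exp (d * z)"])
      (use eq in \<open>auto intro!: holomorphic_intros\<close>)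
  then have eq': "poly p z * exp (c * z) = poly q z * exp (d * z)" for z by simp
  have "exp ((c - d) * z) * poly p z = poly q z" for z
    using eq'[of z] by (simp add: ring_distribs exp_diff field_simps)
  then obtain k where k: "(\<lambda>z. exp ((c - d) * z)) = (\<lambda>_. k)"
    using entire_nonvanishing_times_poly[of "\<lambda>z. exp ((c - d) * z)" p q] \<open>p \<noteq> 0\<close>
    by (auto intro!: holomorphic_intros)
  have "((\<lambda>z. exp ((c - d) * z)) has_field_derivative (c - d)) (at 0)"
    by (auto intro!: derivative_eq_intros)
  moreover have "((\<lambda>z. exp ((c - d) * z)) has_field_derivative 0) (at 0)"
    unfolding k by simp
  ultimately have "c = d" using DERIV_unique by force
  with eq' have "poly p = poly q" by (intro ext) simp
  then show ?thesis using \<open>c = d\<close> poly_eq_poly_eq_iff by blast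
qed

text \<open>The finitely many zeros of P are split off from f or from g one at a time. What remains
  of f has no zeros and therefore a logarithm h on the plane; what remains of g is a constant times
  exp (- h).\<close>

lemma entire_factors_of_poly:
  fixes f g :: "complex \<Rightarrow> complex"
  assumes "f holomorphic_on UNIV" "g holomorphic_on UNIV" "P \<noteq> 0"
    and "\<And>z. f z * g z = poly P z"
  shows "\<exists>p q h. h holomorphic_on UNIV \<and> p \<noteq> 0 \<and> q \<noteq> 0 \<and>
           (\<forall>z. f z = poly p z * exp (h z)) \<and> (\<forall>z. g z = poly q z * exp (- h z))"
  using assms
proof (induction "degree P" arbitrary: f g P)
  case 0
  obtain b where P: "P = [:b:]" using degree_eq_zeroE[of P] 0(1) by metis
  with 0(4) have b: "b \<noteq> 0" by auto
  have fg: "f z * g z = b" for z using 0(5)[of z] P by simp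
  have nz: "f z \<noteq> 0" for z using fg[of z] b by auto
  obtain h where h: "h holomorphic_on UNIV" "\<And>z. f z = exp (h z)"
    using holomorphic_logarithm_exists[of UNIV f 0] 0(2) nz
    by (metis UNIV_I convex_UNIV open_UNIV)
  have "g z = poly [:b:] z * exp (- h z)" for z
  proof -
    have "g z = (f z * g z) * exp (- h z)" by (simp add: h(2) exp_minus)
    then show ?thesis by (simp add: fg)
  qed
  then show ?case using h b by (intro exI[of _ 1] exI[of _ "[:b:]"] exI[of _ h]) auto
next
  case (Suc n)
  have divide: "\<exists>f'. f' holomorphic_on UNIV \<and> (\<forall>z. f z = (z - a) * f' z)"
    if "f holomorphic_on UNIV" "f a = 0" for f a
  proof -
    \<comment> \<open>The singularity of the quotient at a is removable, with the derivative as its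
      value.\<close>
    define f' where "f' = (\<lambda>z. if z = a then deriv f a else f z / (z - a))"
    have "f' holomorphic_on UNIV"
      using pole_lemma[OF that(1), of a] by (rule holomorphic_transform) (auto simp: f'_def that(2))
    moreover have "f z = (z - a) * f' z" for z using that by (auto simp: f'_def)
    ultimately show ?thesis by blast
  qed
  have "degree P \<noteq> 0" using Suc(2) by simp
  then obtain a where a: "poly P a = 0" by (rule poly_root_exists)
  then obtain P' where P': "P = [:-a, 1:] * P'" unfolding poly_eq_0_iff_dvd by (auto elim!: dvdE)
  have P'0: "P' \<noteq> 0" using Suc(5) P' by auto
  have deg: "n = degree P'" using Suc(2) P'0 degree_mult_eq[of "[:-a, 1:]" P'] unfolding P' by simp
  have cancel: "F z = poly P' z" if "F holomorphic_on UNIV" "\<And>z. (z - a) * F z = poly P z" for F z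
  proof -
    have eq: "F w = poly P' w" if "w \<noteq> a" for w
    proof -
      have "(w - a) * F w = (w - a) * poly P' w"
        using \<open>\<And>z. (z - a) * F z = poly P z\<close>[of w] unfolding P' by (simp add: algebra_simps)
      then show ?thesis using that by simp
    qed
    have "isCont (\<lambda>w. F w - poly P' w) a"
      using that(1) by (intro continuous_intros) (auto dest!: holomorphic_on_imp_continuous_on simp: continuous_on_eq_continuous_at)
    then have "((\<lambda>w. F w - poly P' w) \<longlongrightarrow> F a - poly P' a) (at a)" by (simp add: isCont_def)
    moreover have "((\<lambda>w. F w - poly P' w) \<longlongrightarrow> 0) (at a)"
      by (rule tendsto_eventually) (auto simp: eventually_at eq intro!: exI[of _ 1])
    ultimately have "F a - poly P' a = 0" using LIM_unique by blast
    then show ?thesis using eq by (cases "z = a") auto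
  qed
  have "f a = 0 \<or> g a = 0" using Suc(6)[of a] a by auto
  then show ?case
  proof
    assume "f a = 0"
    then obtain f' where f': "f' holomorphic_on UNIV" "\<And>z. f z = (z - a) * f' z"
      using divide Suc(3) by blast
    have "f' z * g z = poly P' z" for z
      by (rule cancel[of "\<lambda>z. f' z * g z"]) (use f' Suc(4,6) in \<open>auto intro!: holomorphic_intros simp: mult.assoc\<close>)
    from Suc(1)[OF deg f'(1) Suc(4) P'0 this]
    obtain p q h where "h holomorphic_on UNIV" "p \<noteq> 0" "q \<noteq> 0"
      "\<And>z. f' z = poly p z * exp (h z)" "\<And>z. g z = poly q z * exp (- h z)" by blast
    moreover from this have "[:-a, 1:] * p \<noteq> 0" by (simp only: mult_eq_0_iff) auto
    ultimately show ?thesis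
      by (intro exI[of _ "[:-a, 1:] * p"] exI[of _ q] exI[of _ h] conjI allI) (simp_all add: f'(2) algebra_simps)
  next
    assume "g a = 0"
    then obtain g' where g': "g' holomorphic_on UNIV" "\<And>z. g z = (z - a) * g' z"
      using divide Suc(4) by blast
    have "f z * g' z = poly P' z" for z
      by (rule cancel[of "\<lambda>z. f z * g' z"]) (use g' Suc(3,6) in \<open>auto intro!: holomorphic_intros simp: mult.left_commute\<close>)
    from Suc(1)[OF deg Suc(3) g'(1) P'0 this]
    obtain p q h where "h holomorphic_on UNIV" "p \<noteq> 0" "q \<noteq> 0"
      "\<And>z. f z = poly p z * exp (h z)" "\<And>z. g' z = poly q z * exp (- h z)" by blast
    moreover from this have "[:-a, 1:] * q \<noteq> 0" by (simp only: mult_eq_0_iff) auto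
    ultimately show ?thesis
      by (intro exI[of _ p] exI[of _ "[:-a, 1:] * q"] exI[of _ h] conjI allI) (simp_all add: g'(2) algebra_simps)
  qed
qed

text \<open>The case \<tau> = 0 alone leaves h an arbitrary entire function. Comparing with the
  translate by \<tau> shows that exp (h(z) - h(z - \<tau>)) times a nonzero polynomial is a
  polynomial, hence this exponential is constant. So the derivative of h has every period \<tau>,
  and h is affine.\<close>

lemma entire_pair_growth:
  fixes f g :: "complex \<Rightarrow> complex"
  assumes hol: "f holomorphic_on UNIV" "g holomorphic_on UNIV"
    and nz: "f a \<noteq> 0" "g b \<noteq> 0"
    and growth: "\<And>\<tau>. \<exists>C. \<forall>z. cmod (f z * g (z - \<tau>)) \<le> C * (1 + cmod z) powr N"
  obtains c p q where "p \<noteq> 0" "q \<noteq> 0" "real (degree p + degree q) \<le> N"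
    "\<And>z. f z = poly p z * exp (c * z)" "\<And>z. g z = poly q z * exp (- c * z)"
proof -
  have hol': "(\<lambda>z. g (z - \<tau>)) holomorphic_on UNIV" for \<tau>
    using holomorphic_on_compose_gen[OF _ hol(2), of "\<lambda>z. z - \<tau>" UNIV] holomorphic_on_diff[of "\<lambda>z. z" UNIV "\<lambda>_. \<tau>"]
    by (auto simp: o_def)
  have ex: "\<exists>P. (\<lambda>z. f z * g (z - \<tau>)) = poly P \<and> (P \<noteq> 0 \<longrightarrow> real (degree P) \<le> N)" for \<tau>
  proof -
    from growth[of \<tau>] obtain C where C: "\<And>z. cmod (f z * g (z - \<tau>)) \<le> C * (1 + cmod z) powr N" by blast
    have "(\<lambda>z. f z * g (z - \<tau>)) holomorphic_on UNIV" using hol hol' by (intro holomorphic_intros)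
    from entire_growth_imp_poly[OF this C] show ?thesis by metis
  qed
  then obtain P where P: "\<And>\<tau> z. f z * g (z - \<tau>) = poly (P \<tau>) z"
      "\<And>\<tau>. P \<tau> \<noteq> 0 \<Longrightarrow> real (degree (P \<tau>)) \<le> N"
    by metis
  \<comment> \<open>Entire functions have no zero divisors: where f is nonzero it is so on a disk,
    and g would vanish on that disk.\<close>
  have P0: "P 0 \<noteq> 0"
  proof
    assume "P 0 = 0"
    then have z: "f z * g z = 0" for z using P(1)[of z 0] by simp
    have "f z = 0" for z
    proof (rule ccontr)
      assume "f z \<noteq> 0"
      have "isCont f z"
        using holomorphic_on_imp_continuous_on[OF hol(1)] by (simp add: continuous_on_eq_continuous_at)
      then obtain e where e: "e > 0" "\<And>w. dist z w < e \<Longrightarrow> f w \<noteq> 0"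
        using continuous_at_avoid[of z f 0] \<open>f z \<noteq> 0\<close> by blast
      have "g w = 0" if "w \<in> ball z e" for w using z[of w] e(2)[of w] that by auto
      moreover have "z islimpt ball z e"
        using e(1) by (simp add: islimpt_ball)
      ultimately have "g b = 0"
        using analytic_continuation[OF hol(2), of "ball z e" z b] by auto
      then show False using nz by simp
    qed
    then show False using nz by simp
  qed
  obtain p q h where h: "h holomorphic_on UNIV" and pq: "p \<noteq> 0" "q \<noteq> 0"
    and f: "\<And>z. f z = poly p z * exp (h z)" and g: "\<And>z. g z = poly q z * exp (- h z)"
    using entire_factors_of_poly[OF hol P0] P(1)[of _ 0] by auto
  have h': "deriv h z = deriv h (z - \<tau>)" for z \<tau>
  proof -
    define u where "u = (\<lambda>z. exp (h z - h (z - \<tau>)))"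
    have hs: "(\<lambda>z. h (z - \<tau>)) holomorphic_on UNIV"
      using holomorphic_on_compose_gen[OF _ h, of "\<lambda>z. z - \<tau>" UNIV] holomorphic_on_diff[of "\<lambda>z. z" UNIV "\<lambda>_. \<tau>"]
      by (auto simp: o_def)
    have uh: "u holomorphic_on UNIV" unfolding u_def by (intro holomorphic_intros h hs)
    have "u z * poly (p * pcompose q [:-\<tau>, 1:]) z = poly (P \<tau>) z" for z
      using P(1)[of z \<tau>] by (simp add: f g u_def poly_pcompose exp_diff exp_minus field_simps)
    moreover have "p * pcompose q [:-\<tau>, 1:] \<noteq> 0"
      using pq by (simp add: pcompose_eq_0_iff)
    ultimately obtain k where k: "u = (\<lambda>_. k)"
      using entire_nonvanishing_times_poly[OF uh, of "p * pcompose q [:-\<tau>, 1:]" "P \<tau>"]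
      by (metis exp_not_eq_zero u_def)
    have dh: "(h has_field_derivative deriv h w) (at w)" for w
      using h holomorphic_derivI by blast
    have "(u has_field_derivative (deriv h z - deriv h (z - \<tau>)) * u z) (at z)"
    proof -
      have "((\<lambda>w. h (w - \<tau>)) has_field_derivative deriv h (z - \<tau>) * 1) (at z)"
        by (rule DERIV_chain2[OF dh]) (auto intro!: derivative_eq_intros)
      then show ?thesis
        unfolding u_def by (auto intro!: derivative_eq_intros dh)
    qed
    moreover have "(u has_field_derivative 0) (at z)" unfolding k by simp
    ultimately have "(deriv h z - deriv h (z - \<tau>)) * u z = 0" using DERIV_unique by blast
    then show ?thesis by (simp add: u_def)
  qed
  define c where "c = deriv h 0"
  \<comment> \<open>Choosing \<tau> = z compares the derivative at z with the one at 0.\<close>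
  have dh: "(h has_field_derivative c) (at z)" for z
    using h'[of z z] h holomorphic_derivI[of h UNIV z] by (simp add: c_def)
  have "((\<lambda>z. h z - c * z) has_field_derivative 0) (at z)" for z
    by (auto intro!: derivative_eq_intros dh)
  then obtain e where e: "\<And>z. h z - c * z = e"
    using has_field_derivative_zero_constant[of UNIV "\<lambda>z. h z - c * z"] by auto
  have he: "h z = e + c * z" for z using e[of z] by (simp add: algebra_simps)
  show thesis
  proof
    \<comment> \<open>At \<tau> = 0 the exponentials cancel, so \<open>P 0\<close> is p q and its
      degree is the sum of the two degrees.\<close>
    have "f z * g (z - 0) = poly (p * q) z" for z by (simp add: f g exp_minus field_simps)
    then have "poly (P 0) = poly (p * q)" using P(1)[of _ 0] by (intro ext) simp
    then have "P 0 = p * q" using poly_eq_poly_eq_iff by blast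
    then show "real (degree (smult (exp e) p) + degree (smult (exp (- e)) q)) \<le> N" using P(2)[OF P0] pq by (simp add: degree_mult_eq)
    show "f z = poly (smult (exp e) p) z * exp (c * z)" for z by (simp add: f he exp_add)
    show "g z = poly (smult (exp (-e)) q) z * exp (- c * z)" for z by (simp add: g he exp_add exp_diff exp_minus field_simps)
  qed (use pq in auto)
qed

section \<open>Gaussian integrals and exponential integrals\<close>

lemma lborel_distr_translation_reflection:
  fixes t :: "'a :: euclidean_space"
  assumes "\<bar>c\<bar> = 1"
  shows "distr lborel borel (\<lambda>x. t + c *\<^sub>R x) = lborel"
proof -
  have "c \<noteq> 0" using assms by auto
  then show ?thesis using lborel_affine[of c t] assms by (simp add: density_1)
qed

lemma
  fixes f :: "'a :: euclidean_space \<Rightarrow> 'b :: {banach, second_countable_topology}"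
  shows integral_lborel_shift: "(\<integral>x. f (x + t) \<partial>lborel) = (\<integral>x. f x \<partial>lborel)"
    and integral_lborel_reflect: "(\<integral>x. f (t - x) \<partial>lborel) = (\<integral>x. f x \<partial>lborel)"
    and integrable_lborel_shift: "integrable lborel f \<Longrightarrow> integrable lborel (\<lambda>x. f (x + t))"
    and integrable_lborel_reflect: "integrable lborel f \<Longrightarrow> integrable lborel (\<lambda>x. f (t - x))"
proof -
  have A: "(\<integral>x. f (t + c *\<^sub>R x) \<partial>lborel) = (\<integral>x. f x \<partial>lborel)" (is ?A)
    and B: "integrable lborel f \<Longrightarrow> integrable lborel (\<lambda>x. f (t + c *\<^sub>R x))" if c: "\<bar>c\<bar> = 1" for c
  proof -
    note D = lborel_distr_translation_reflection[OF c, of t]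
    have inv: "(t + c *\<^sub>R (- (c *\<^sub>R t) + c *\<^sub>R x)) = x" for x
      using c by (auto simp: abs_if algebra_simps split: if_splits)
    show B': "integrable lborel (\<lambda>x. f (t + c *\<^sub>R x))" if "integrable lborel f" for f :: "'a \<Rightarrow> 'b"
      using integrable_distr[of "\<lambda>x. t + c *\<^sub>R x" lborel borel f] that
      unfolding D by simp
    show ?A
    proof (cases "integrable lborel f")
      case True
      then have "f \<in> borel_measurable borel" by auto
      then show ?thesis
        using integral_distr[of "\<lambda>x. t + c *\<^sub>R x" lborel borel f] unfolding D by simp
    next
      \<comment> \<open>Both integrals take the default value 0 here, once the substituted function
        is known to be non-integrable too; the inverse map would otherwise make f
        integrable.\<close>
      case False
      have "\<not> integrable lborel (\<lambda>x. f (t + c *\<^sub>R x))"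
      proof
        assume "integrable lborel (\<lambda>x. f (t + c *\<^sub>R x))"
        then have "integrable lborel (\<lambda>x. f (t + c *\<^sub>R (- (c *\<^sub>R t) + c *\<^sub>R x)))"
          using integrable_distr[of "\<lambda>x. - (c *\<^sub>R t) + c *\<^sub>R x" lborel borel "\<lambda>x. f (t + c *\<^sub>R x)"]
          unfolding lborel_distr_translation_reflection[OF c] by simp
        then show False using False unfolding inv by simp
      qed
      then show ?thesis using False by (simp add: not_integrable_integral_eq)
    qed
  qed
  show "(\<integral>x. f (x + t) \<partial>lborel) = (\<integral>x. f x \<partial>lborel)" using A[of 1] by (simp add: add.commute)
  show "(\<integral>x. f (t - x) \<partial>lborel) = (\<integral>x. f x \<partial>lborel)" using A[of "-1"] by simp
  show "integrable lborel f \<Longrightarrow> integrable lborel (\<lambda>x. f (x + t))" using B[of 1] by (simp add: add.commute)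
  show "integrable lborel f \<Longrightarrow> integrable lborel (\<lambda>x. f (t - x))" using B[of "-1"] by simp
qed

lemma (in pair_sigma_finite) integrable_pair_mult:
  fixes f :: "'a \<Rightarrow> 'c :: {banach, second_countable_topology}"
    and g :: "'b \<Rightarrow> 'd :: {banach, second_countable_topology}"
    and h :: "_ \<Rightarrow> 'e :: {banach, second_countable_topology}"
  assumes f: "integrable M1 f" and g: "integrable M2 g"
    and [measurable]: "h \<in> borel_measurable (M1 \<Otimes>\<^sub>M M2)"
    and h: "\<And>x y. norm (h (x, y)) \<le> norm (f x) * norm (g y)"
  shows "integrable (M1 \<Otimes>\<^sub>M M2) h"
proof (rule Fubini_integrable)
  have [measurable]: "f \<in> borel_measurable M1" "g \<in> borel_measurable M2" using f g by auto
  show "AE x in M1. integrable M2 (\<lambda>y. h (x, y))"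
  proof (rule AE_I2)
    fix x assume [measurable]: "x \<in> space M1"
    have "integrable M2 (\<lambda>y. norm (f x) * norm (g y))" using g by auto
    then show "integrable M2 (\<lambda>y. h (x, y))"
      by (rule Bochner_Integration.integrable_bound) (use h in auto)
  qed
  then have "AE x in M1. norm (\<integral>y. norm (h (x, y)) \<partial>M2) \<le> norm (norm (f x) * (\<integral>y. norm (g y) \<partial>M2))"
  proof eventually_elim
    case (elim x)
    have "(\<integral>y. norm (h (x, y)) \<partial>M2) \<le> (\<integral>y. norm (f x) * norm (g y) \<partial>M2)"
      using elim g h by (intro integral_mono) auto
    then show ?case by (simp add: integral_nonneg)
  qed
  moreover have "integrable M1 (\<lambda>x. norm (f x) * (\<integral>y. norm (g y) \<partial>M2))" using f by auto
  ultimately show "integrable M1 (\<lambda>x. \<integral>y. norm (h (x, y)) \<partial>M2)"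
    by (rule Bochner_Integration.integrable_bound[rotated 2]) measurable
qed measurable

lemma has_bochner_integral_lborel_vec_prod:
  fixes f :: "'k::finite \<Rightarrow> real \<Rightarrow> complex"
  assumes "\<And>i. has_bochner_integral lborel (f i) (I i)"
  shows "has_bochner_integral lborel (\<lambda>x :: real ^ 'k. \<Prod>i\<in>UNIV. f i (x $ i)) (\<Prod>i\<in>UNIV. I i)"
proof -
  let ?e = "\<lambda>i :: 'k. axis i (1 :: real)"
  have inj: "inj ?e" by (auto simp: inj_def axis_eq_axis)
  have B: "Basis = range ?e" by (auto simp: Basis_vec_def)
  \<comment> \<open>The product measure behind \<open>lborel\<close> is indexed by
    \<open>Basis\<close>, so the factors are reindexed along \<open>axis\<close>. Off
    \<open>Basis\<close>, g still returns one of the f i, which keeps it integrable at every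
    index.\<close>
  define g where "g = f \<circ> inv ?e"
  interpret product_sigma_finite "\<lambda>_ :: real ^ 'k. lborel :: real measure" ..
  have g: "integrable lborel (g b)" for b using assms by (auto simp: g_def has_bochner_integral_iff)
  have fg: "(\<Prod>i\<in>UNIV. f i (x $ i)) = (\<Prod>b\<in>Basis. g b (x \<bullet> b))" for x :: "real ^ 'k"
    unfolding B by (subst prod.reindex[OF inj]) (simp add: g_def inv_f_f[OF inj] cart_eq_inner_axis)
  have Ig: "(\<Prod>i\<in>UNIV. I i) = (\<Prod>b\<in>Basis. integral\<^sup>L lborel (g b))"
    unfolding B using assms
    by (subst prod.reindex[OF inj]) (simp add: g_def inv_f_f[OF inj] has_bochner_integral_iff)
  have m: "(\<lambda>x. \<Sum>b\<in>Basis. x b *\<^sub>R b) \<in> (\<Pi>\<^sub>M b\<in>(Basis :: (real ^ 'k) set). lborel) \<rightarrow>\<^sub>M borel"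
    by measurable
  have gm [measurable]: "g b \<in> borel_measurable borel" for b using g[of b] by auto
  have inner: "(\<Sum>b\<in>Basis. x b *\<^sub>R b) \<bullet> c = x c" if "c \<in> Basis" for x and c :: "real ^ 'k"
    using that by (simp add: inner_sum_left inner_Basis sum.delta if_distrib cong: if_cong)
  have eq: "(\<lambda>x. \<Prod>b\<in>Basis. g b ((\<Sum>b\<in>Basis. x b *\<^sub>R b) \<bullet> b)) = (\<lambda>x. \<Prod>b\<in>Basis. g b (x b))"
    by (intro ext prod.cong) (simp_all add: inner)
  show ?thesis
    unfolding fg Ig
  proof (subst lborel_eq, rule has_bochner_integral_distr[OF _ m])
    show "(\<lambda>x. \<Prod>b\<in>Basis. g b (x \<bullet> b)) \<in> borel_measurable borel" by measurable
    show "has_bochner_integral (Pi\<^sub>M Basis (\<lambda>b. lborel)) (\<lambda>x. \<Prod>b\<in>Basis. g b ((\<Sum>b\<in>Basis. x b *\<^sub>R b) \<bullet> b))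
      (\<Prod>b\<in>Basis. integral\<^sup>L lborel (g b))"
      unfolding eq has_bochner_integral_iff
      using product_integrable_prod[OF finite_Basis, of g] product_integral_prod[OF finite_Basis, of g] g
      by blast
  qed
qed

text \<open>This is the characteristic function of the standard normal distribution after rescaling
  by r = sqrt (2 a), which turns exp (- (r x)^2 / 2) into exp (- a x^2).\<close>

lemma has_bochner_integral_gaussian_imaginary:
  fixes a u :: real
  assumes a: "a > 0"
  shows "has_bochner_integral lborel (\<lambda>t::real. exp (of_real (- a * t\<^sup>2) + \<i> * of_real (u * t)))
     (of_real (sqrt (pi / a) * exp (- u\<^sup>2 / (4 * a))))"
proof -
  have "(\<integral>x. std_normal_density x *\<^sub>R iexp (v * x) \<partial>lborel) = exp (- of_real (v\<^sup>2) / 2)" for v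
    using char_std_normal_distribution unfolding char_def
    by (subst (asm) integral_density) (auto dest!: fun_cong[of _ _ v] simp: exp_of_real[symmetric])
  moreover have "integrable lborel (\<lambda>x. std_normal_density x *\<^sub>R iexp (v * x))" for v
    by (rule Bochner_Integration.integrable_bound[OF integrable_std_normal_moment[of 0]]) (auto simp: norm_mult)
  ultimately have std: "has_bochner_integral lborel (\<lambda>x. std_normal_density x *\<^sub>R iexp (v * x)) (exp (- of_real (v\<^sup>2) / 2))" for v
    by (simp add: has_bochner_integral_iff)
  define r where "r = sqrt (2 * a)"
  have r: "r > 0" "r\<^sup>2 = 2 * a" using a by (auto simp: r_def)
  from lborel_has_bochner_integral_real_affine_iff[THEN iffD1, OF _ std[of "u / r"], of r 0] r
  have "has_bochner_integral lborel (\<lambda>x. std_normal_density (r * x) *\<^sub>R iexp (u / r * (r * x)))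
     (exp (- of_real ((u / r)\<^sup>2) / 2) /\<^sub>R \<bar>r\<bar>)" by simp
  then have "has_bochner_integral lborel (\<lambda>x. of_real (sqrt (2 * pi)) * (std_normal_density (r * x) *\<^sub>R iexp (u / r * (r * x))))
     (of_real (sqrt (2 * pi)) * (exp (- of_real ((u / r)\<^sup>2) / 2) /\<^sub>R \<bar>r\<bar>))"
    by (rule has_bochner_integral_mult_right)
  moreover have "of_real (sqrt (2 * pi)) * (std_normal_density (r * x) *\<^sub>R iexp (u / r * (r * x)))
     = exp (of_real (- a * x\<^sup>2) + \<i> * of_real (u * x))" for x
  proof -
    have "std_normal_density (r * x) = exp (- a * x\<^sup>2) / sqrt (2 * pi)"
      using r by (simp add: std_normal_density_def power_mult_distrib)
    then have "of_real (sqrt (2 * pi)) * (std_normal_density (r * x) *\<^sub>R iexp (u / r * (r * x)))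
        = of_real (exp (- a * x\<^sup>2)) * iexp (u * x)"
      using r by (simp add: scaleR_conv_of_real)
    then show ?thesis by (simp only: exp_add exp_of_real)
  qed
  moreover have "of_real (sqrt (2 * pi)) * (exp (- of_real ((u / r)\<^sup>2) / 2) /\<^sub>R \<bar>r\<bar>)
     = (of_real (sqrt (pi / a) * exp (- u\<^sup>2 / (4 * a))) :: complex)"
  proof -
    have "(u / r)\<^sup>2 / 2 = u\<^sup>2 / (4 * a)" using r by (simp add: power_divide)
    moreover have "sqrt (2 * pi) / r = sqrt (pi / a)"
      unfolding r_def by (simp flip: real_sqrt_divide)
    moreover have "sqrt (2 * pi) * (exp (- ((u / r)\<^sup>2 / 2)) / r) = sqrt (2 * pi) / r * exp (- ((u / r)\<^sup>2 / 2))"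
      by simp
    ultimately have "sqrt (2 * pi) * (exp (- ((u / r)\<^sup>2 / 2)) / r) = sqrt (pi / a) * exp (- u\<^sup>2 / (4 * a))"
      by (simp only: minus_divide_left)
    moreover have "exp (- of_real ((u / r)\<^sup>2) / 2) /\<^sub>R \<bar>r\<bar> = (of_real (exp (- ((u / r)\<^sup>2 / 2)) / r) :: complex)"
    proof -
      have "exp (- of_real ((u / r)\<^sup>2) / 2) = (of_real (exp (- ((u / r)\<^sup>2 / 2))) :: complex)"
        unfolding exp_of_real[symmetric] by simp
      note eq = this
      show ?thesis unfolding eq using r by (simp add: scaleR_conv_of_real field_simps)
    qed
    ultimately show ?thesis by (simp only: of_real_mult[symmetric])
  qed
  ultimately show ?thesis by simp
qed

lemma has_bochner_integral_gaussian:
  fixes a :: real and s :: complex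
  assumes a: "a > 0"
  shows "has_bochner_integral lborel (\<lambda>t::real. exp (- of_real (a * t\<^sup>2) + of_real t * s))
     (of_real (sqrt (pi / a)) * exp (s\<^sup>2 / of_real (4 * a)))"
proof -
  define p u where "p = Re s" and "u = Im s"
  have s: "s = of_real p + \<i> * of_real u" by (simp add: p_def u_def complex_eq)
  \<comment> \<open>The centre at which completing the square absorbs the real part of s; the
    imaginary part is covered by the preceding lemma.\<close>
  define w where "w = p / (2 * a)"
  from lborel_has_bochner_integral_real_affine_iff[THEN iffD1, OF _ has_bochner_integral_gaussian_imaginary[OF a, of u], of 1 "- w"]
  have "has_bochner_integral lborel (\<lambda>t. exp (of_real (- a * (t - w)\<^sup>2) + \<i> * of_real (u * (t - w))))
     (of_real (sqrt (pi / a) * exp (- u\<^sup>2 / (4 * a))))" by (simp add: algebra_simps)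
  then have "has_bochner_integral lborel (\<lambda>t. exp (of_real (a * w\<^sup>2) + \<i> * of_real (u * w)) * exp (of_real (- a * (t - w)\<^sup>2) + \<i> * of_real (u * (t - w))))
     (exp (of_real (a * w\<^sup>2) + \<i> * of_real (u * w)) * of_real (sqrt (pi / a) * exp (- u\<^sup>2 / (4 * a))))"
    by (rule has_bochner_integral_mult_right)
  moreover have "exp (of_real (a * w\<^sup>2) + \<i> * of_real (u * w)) * exp (of_real (- a * (t - w)\<^sup>2) + \<i> * of_real (u * (t - w)))
     = exp (- of_real (a * t\<^sup>2) + of_real t * s)" for t
  proof -
    have "p = 2 * a * w" using a by (simp add: w_def)
    then have "a * w\<^sup>2 - a * (t - w)\<^sup>2 = - a * t\<^sup>2 + p * t" by (simp add: power2_eq_square algebra_simps)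
    then have "of_real (a * w\<^sup>2) + complex_of_real (- a * (t - w)\<^sup>2) = of_real (- a * t\<^sup>2 + p * t)"
      by (metis (no_types) add_uminus_conv_diff minus_mult_left of_real_add)
    then show ?thesis unfolding exp_add[symmetric] s
      by (intro arg_cong[where f = exp]) (simp add: algebra_simps)
  qed
  moreover have "exp (of_real (a * w\<^sup>2) + \<i> * of_real (u * w)) * of_real (sqrt (pi / a) * exp (- u\<^sup>2 / (4 * a)))
     = of_real (sqrt (pi / a)) * exp (s\<^sup>2 / of_real (4 * a))"
  proof -
    have "s\<^sup>2 / of_real (4 * a) = of_real (a * w\<^sup>2) + \<i> * of_real (u * w) + of_real (- u\<^sup>2 / (4 * a))"
      using a by (simp add: s w_def power2_eq_square field_simps)
    then show ?thesis by (simp only: exp_add of_real_mult exp_of_real mult_ac)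
  qed
  ultimately show ?thesis by (simp only:)
qed

lemma has_bochner_integral_gaussian_vec:
  fixes a :: real and s :: "complex ^ 'k"
  assumes a: "a > 0"
  shows "has_bochner_integral lborel (\<lambda>t. exp (- of_real (a * (t \<bullet> t)) + cdot (cvec t) s))
     (of_real (sqrt (pi / a) ^ CARD('k)) * exp (cdot s s / of_real (4 * a)))"
proof -
  from has_bochner_integral_lborel_vec_prod[OF has_bochner_integral_gaussian[OF a], of "\<lambda>i. s $ i"]
  have "has_bochner_integral lborel (\<lambda>x. \<Prod>i\<in>UNIV. exp (- of_real (a * (x $ i)\<^sup>2) + of_real (x $ i) * s $ i))
    (\<Prod>i\<in>UNIV. of_real (sqrt (pi / a)) * exp ((s $ i)\<^sup>2 / of_real (4 * a)))" .
  also have "(\<lambda>x. \<Prod>i\<in>UNIV. exp (- of_real (a * (x $ i)\<^sup>2) + of_real (x $ i) * s $ i))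
     = (\<lambda>t. exp (- of_real (a * (t \<bullet> t)) + cdot (cvec t) s))"
    by (simp add: exp_sum[symmetric] sum.distrib sum_negf sum_subtractf inner_vec_def cdot_def cvec_def sum_distrib_left power2_eq_square)
  also have "(\<Prod>i\<in>UNIV. of_real (sqrt (pi / a)) * exp ((s $ i)\<^sup>2 / of_real (4 * a)))
    = of_real (sqrt (pi / a) ^ CARD('k)) * exp (cdot s s / of_real (4 * a))"
    by (simp add: prod.distrib exp_sum[symmetric] cdot_def power2_eq_square sum_divide_distrib)
  finally show ?thesis .
qed

text \<open>The exponential series may be integrated termwise, because its partial sums are
  dominated by |h| exp (r |q|). A power series that converges for every z makes differentiation
  under the integral a matter of coefficients.\<close>

lemma exp_integral_power_series:
  fixes h :: "'a \<Rightarrow> complex" and q :: "'a \<Rightarrow> real"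
  assumes [measurable]: "h \<in> borel_measurable M" "q \<in> borel_measurable M"
    and int: "\<And>r. r > 0 \<Longrightarrow> integrable M (\<lambda>x. cmod (h x) * exp (r * \<bar>q x\<bar>))"
  shows "(\<lambda>n. (\<integral>x. h x * (of_real (q x) ^ n / fact n) \<partial>M) * z ^ n) sums (\<integral>x. h x * exp (z * of_real (q x)) \<partial>M)"
proof -
  define a where "a n = (\<integral>x. h x * (of_real (q x) ^ n / fact n) \<partial>M)" for n
    \<comment> \<open>The summand 1 keeps r positive when z = 0.\<close>
    define r where "r = cmod z + 1"
    have r: "r > 0" "cmod z \<le> r" by (auto simp: r_def add_nonneg_pos)
    define T where "T n x = h x * (z * of_real (q x)) ^ n / fact n" for n x
    have T_bound: "(\<Sum>n<m. cmod (T n x)) \<le> cmod (h x) * exp (r * \<bar>q x\<bar>)" for m x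
    proof -
      have "(\<Sum>n<m. cmod (T n x)) \<le> (\<Sum>n<m. cmod (h x) * ((r * \<bar>q x\<bar>) ^ n / fact n))"
        using r by (intro sum_mono)
          (auto simp: T_def norm_mult norm_divide norm_power intro!: mult_left_mono divide_right_mono power_mono mult_right_mono)
      also have "\<dots> = cmod (h x) * (\<Sum>n<m. (r * \<bar>q x\<bar>) ^ n / fact n)" by (simp add: sum_distrib_left)
      also have "(\<Sum>n<m. (r * \<bar>q x\<bar>) ^ n / fact n) \<le> exp (r * \<bar>q x\<bar>)"
        unfolding exp_def using r summable_exp[of "r * \<bar>q x\<bar>"]
        by (intro order_trans[OF sum_le_suminf]) (auto simp: divide_inverse mult.commute)
      finally show ?thesis by (simp add: mult_left_mono)
    qed
    have T_bound1: "cmod (T n x) \<le> cmod (h x) * exp (r * \<bar>q x\<bar>)" for n x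
      using T_bound[of x "Suc n"] by (simp add: add_increasing sum_nonneg) (smt (verit) norm_ge_zero sum_nonneg)
    have [measurable]: "T n \<in> borel_measurable M" for n unfolding T_def by measurable
    have intT: "integrable M (T n)" for n
      by (rule Bochner_Integration.integrable_bound[OF int[OF r(1)]]) (use T_bound1 in auto)
    have "summable (\<lambda>n. \<integral>x. cmod (T n x) \<partial>M)"
    proof (rule summableI_nonneg_bounded)
      fix m
      have "(\<Sum>n<m. \<integral>x. cmod (T n x) \<partial>M) = (\<integral>x. (\<Sum>n<m. cmod (T n x)) \<partial>M)"
        using intT by (intro Bochner_Integration.integral_sum[symmetric]) auto
      also have "\<dots> \<le> (\<integral>x. cmod (h x) * exp (r * \<bar>q x\<bar>) \<partial>M)"
        using intT int[OF r(1)] T_bound by (intro integral_mono) auto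
      finally show "(\<Sum>n<m. \<integral>x. cmod (T n x) \<partial>M) \<le> (\<integral>x. cmod (h x) * exp (r * \<bar>q x\<bar>) \<partial>M)" .
    qed auto
    moreover have "summable (\<lambda>n. cmod (T n x))" for x
      using T_bound by (intro summableI_nonneg_bounded) auto
    ultimately have "(\<lambda>n. integral\<^sup>L M (T n)) sums (\<integral>x. (\<Sum>n. T n x) \<partial>M)"
      using intT by (intro sums_integral) auto
    moreover have "integral\<^sup>L M (T n) = a n * z ^ n" for n
    proof -
      have "T n x = h x * (of_real (q x) ^ n / fact n) * z ^ n" for x
        by (simp add: T_def power_mult_distrib)
      then have "T n = (\<lambda>x. h x * (of_real (q x) ^ n / fact n) * z ^ n)" by (intro ext)
      then show ?thesis unfolding a_def by (simp only: integral_mult_left_zero)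
    qed
    moreover have "(\<Sum>n. T n x) = h x * exp (z * of_real (q x))" for x
    proof -
      have "(\<lambda>n. h x * ((z * of_real (q x)) ^ n /\<^sub>R fact n)) sums (h x * exp (z * of_real (q x)))"
        by (intro sums_mult exp_converges)
      then show ?thesis by (simp add: T_def sums_iff scaleR_conv_of_real divide_inverse mult_ac)
    qed
    ultimately show ?thesis by (simp add: a_def)
qed

text \<open>Replacing h by h q shifts the coefficients exactly as termwise differentiation does, so
  both sides are the same power series.\<close>

lemma exp_integral_has_derivative:
  fixes h :: "'a \<Rightarrow> complex" and q :: "'a \<Rightarrow> real"
  assumes [measurable]: "h \<in> borel_measurable M" "q \<in> borel_measurable M"
    and int: "\<And>r. r > 0 \<Longrightarrow> integrable M (\<lambda>x. cmod (h x) * exp (r * \<bar>q x\<bar>))"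
  shows "((\<lambda>z. \<integral>x. h x * exp (z * of_real (q x)) \<partial>M) has_field_derivative
     (\<integral>x. (h x * of_real (q x)) * exp (z * of_real (q x)) \<partial>M)) (at z)"
proof -
  define a where "a n = (\<integral>x. h x * (of_real (q x) ^ n / fact n) \<partial>M)" for n
  have sums: "(\<lambda>n. a n * z ^ n) sums (\<integral>x. h x * exp (z * of_real (q x)) \<partial>M)" for z
    unfolding a_def by (rule exp_integral_power_series[OF assms])
  have der: "(\<lambda>n. (\<integral>x. (h x * of_real (q x)) * (of_real (q x) ^ n / fact n) \<partial>M) * z ^ n) sums
     (\<integral>x. (h x * of_real (q x)) * exp (z * of_real (q x)) \<partial>M)"
  proof (rule exp_integral_power_series)
    fix r :: real assume "r > 0"
    show "integrable M (\<lambda>x. cmod (h x * of_real (q x)) * exp (r * \<bar>q x\<bar>))"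
    \<comment> \<open>The additional factor |q| is at most exp |q|, which costs one unit of
      r.\<close>
    proof (rule Bochner_Integration.integrable_bound[OF int[of "r + 1"]])
      show "AE x in M. norm (cmod (h x * of_real (q x)) * exp (r * \<bar>q x\<bar>)) \<le> norm (cmod (h x) * exp ((r + 1) * \<bar>q x\<bar>))"
      proof (rule AE_I2)
        fix x
        have "\<bar>q x\<bar> * exp (r * \<bar>q x\<bar>) \<le> exp \<bar>q x\<bar> * exp (r * \<bar>q x\<bar>)"
        proof (rule mult_right_mono)
          show "\<bar>q x\<bar> \<le> exp \<bar>q x\<bar>" using exp_ge_add_one_self[of "\<bar>q x\<bar>"] by linarith
        qed simp
        also have "\<dots> = exp ((r + 1) * \<bar>q x\<bar>)" by (simp add: mult_exp_exp algebra_simps)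
        finally have "cmod (h x) * (\<bar>q x\<bar> * exp (r * \<bar>q x\<bar>)) \<le> cmod (h x) * exp ((r + 1) * \<bar>q x\<bar>)"
          by (intro mult_left_mono) auto
        then show "norm (cmod (h x * of_real (q x)) * exp (r * \<bar>q x\<bar>)) \<le> norm (cmod (h x) * exp ((r + 1) * \<bar>q x\<bar>))"
          by (simp add: norm_mult mult.assoc)
      qed
    qed (use \<open>r > 0\<close> in auto)
  qed measurable
  have diffs: "(\<integral>x. (h x * of_real (q x)) * (of_real (q x) ^ n / fact n) \<partial>M) = diffs a n" for n
  proof -
    have "diffs a n = (\<integral>x. of_nat (Suc n) * (h x * (of_real (q x) ^ Suc n / fact (Suc n))) \<partial>M)"
      unfolding diffs_def a_def by simp
    moreover have "of_nat (Suc n) * (h x * (of_real (q x) ^ Suc n / fact (Suc n))) = (h x * of_real (q x)) * (of_real (q x) ^ n / fact n)" for x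
      by (simp del: of_nat_Suc)
    ultimately show ?thesis by simp
  qed
  have "(\<Sum>n. diffs a n * z ^ n) = (\<integral>x. (h x * of_real (q x)) * exp (z * of_real (q x)) \<partial>M)"
    using der unfolding diffs by (simp only: sums_iff)
  moreover have "((\<lambda>z. \<Sum>n. a n * z ^ n) has_field_derivative (\<Sum>n. diffs a n * z ^ n)) (at z)"
    using sums by (intro termdiffs_strong_converges_everywhere) (auto simp: sums_iff)
  moreover have "(\<lambda>z. \<Sum>n. a n * z ^ n) = (\<lambda>z. \<integral>x. h x * exp (z * of_real (q x)) \<partial>M)"
    using sums by (auto simp: sums_iff)
  ultimately show ?thesis by simp
qed

section \<open>Uniqueness of the Fourier transform\<close>

text \<open>Boxes form an intersection-stable generator of the Borel sets, so all set integrals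
  vanish by a Dynkin argument. The hypothesis \<open>H0\<close> serves the complements, since the
  whole space is not a box.\<close>

lemma AE_zero_if_box_integrals_zero:
  fixes H :: "'a::euclidean_space \<Rightarrow> complex"
  assumes H: "integrable lborel H" and H0: "(\<integral>t. H t \<partial>lborel) = 0"
    and box0: "\<And>a b. (\<integral>t. indicator (box a b) t *\<^sub>R H t \<partial>lborel) = 0"
  shows "AE t in lborel. H t = 0"
proof -
  have setint: "set_integrable lborel A H" if "A \<in> sets borel" for A
    unfolding set_integrable_def using that H by (intro integrable_mult_indicator) auto
  have stable: "Int_stable (range (\<lambda>(a, b). box a b :: 'a set))" by (auto simp: Int_stable_def box_Int_box)
  have "set_lebesgue_integral lborel A H = 0" if "A \<in> sigma_sets UNIV (range (\<lambda>(a, b). box a b))" for A :: "'a set"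
    using stable subset_UNIV[of "range (\<lambda>(a, b). box a b)", folded Pow_UNIV] that
  proof (induction rule: sigma_sets_induct_disjoint)
    case (basic A)
    then show ?case by (auto simp: set_lebesgue_integral_def box0)
  next
    case (compl A)
    then have "A \<in> sets borel" by (simp add: borel_eq_box)
    then have "integrable lborel (\<lambda>t. indicator A t *\<^sub>R H t)"
      using setint by (simp add: set_integrable_def)
    moreover have "(\<lambda>t. indicator (UNIV - A) t *\<^sub>R H t) = (\<lambda>t. H t - indicator A t *\<^sub>R H t)"
      by (auto simp: fun_eq_iff split: split_indicator)
    ultimately show ?case using compl H H0 by (simp add: set_lebesgue_integral_def)
  next
    case (union A)
    have m: "A i \<in> sets borel" for i using union(2) by (auto simp: borel_eq_box)
    then have "set_lebesgue_integral lborel (\<Union>i. A i) H = (\<Sum>i. set_lebesgue_integral lborel (A i) H)"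
      using union(1) setint by (intro lebesgue_integral_countable_add) (auto simp: disjoint_family_on_def)
    then show ?case using union(3) by simp
  qed (auto simp: set_lebesgue_integral_def)
  then have A0: "set_lebesgue_integral lborel A H = 0" if "A \<in> sets borel" for A
    using that by (simp add: borel_eq_box)
  have Re: "AE t in lborel. Re (H t) = 0"
  proof (rule density_unique_real[of lborel "\<lambda>t. Re (H t)" "\<lambda>_. 0"])
    fix A :: "'a set" assume "A \<in> sets lborel"
    then have "A \<in> sets borel" by simp
    from A0[OF this] setint[OF this]
    have "Re (\<integral>t. indicator A t *\<^sub>R H t \<partial>lborel) = 0" by (simp add: set_lebesgue_integral_def)
    then show "(LINT x:A|lborel. Re (H x)) = (LINT x:A|lborel. 0)"
      using setint[OF \<open>A \<in> sets borel\<close>]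
      by (simp add: set_lebesgue_integral_def set_integrable_def flip: integral_Re)
  qed (use H in auto)
  have Im: "AE t in lborel. Im (H t) = 0"
  proof (rule density_unique_real[of lborel "\<lambda>t. Im (H t)" "\<lambda>_. 0"])
    fix A :: "'a set" assume "A \<in> sets lborel"
    then have "A \<in> sets borel" by simp
    from A0[OF this] setint[OF this]
    have "Im (\<integral>t. indicator A t *\<^sub>R H t \<partial>lborel) = 0" by (simp add: set_lebesgue_integral_def)
    then show "(LINT x:A|lborel. Im (H x)) = (LINT x:A|lborel. 0)"
      using setint[OF \<open>A \<in> sets borel\<close>]
      by (simp add: set_lebesgue_integral_def set_integrable_def flip: integral_Im)
  qed (use H in auto)
  from Re Im show ?thesis by eventually_elim (simp add: complex_eq_iff)
qed

lemma cdot_scaled: "cdot (\<i> *s cvec v) (\<i> *s cvec v) = - of_real (v \<bullet> v)"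
  "cdot (cvec t) (\<i> *s cvec v) = \<i> * of_real (t \<bullet> v)"
  "cdot (cvec t) (cvec v) = of_real (t \<bullet> v)"
proof -
  have "\<i> * of_real (v $ i) * (\<i> * of_real (v $ i)) = (- of_real (v $ i * v $ i) :: complex)" for i
    by (simp add: power2_eq_square[symmetric] power_mult_distrib)
  then show "cdot (\<i> *s cvec v) (\<i> *s cvec v) = - of_real (v \<bullet> v)"
    by (simp add: cdot_def cvec_def inner_vec_def sum_negf)
  show "cdot (cvec t) (\<i> *s cvec v) = \<i> * of_real (t \<bullet> v)"
    by (simp add: cdot_def cvec_def inner_vec_def sum_distrib_left mult.left_commute)
  show "cdot (cvec t) (cvec v) = of_real (t \<bullet> v)"
    by (simp add: cdot_def cvec_def inner_vec_def)
qed

lemma gaussian_integrable_vec: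
  fixes a :: real
  assumes "a > 0"
  shows "integrable lborel (\<lambda>t :: real ^ 'k. exp (- (a * (t \<bullet> t)) + t \<bullet> u))"
proof -
  have "integrable lborel (\<lambda>t :: real ^ 'k. exp (- of_real (a * (t \<bullet> t)) + cdot (cvec t) (cvec u)))"
    using has_bochner_integral_gaussian_vec[OF assms, of "cvec u"] by (rule integrable.intros)
  then have "integrable lborel (\<lambda>t :: real ^ 'k. complex_of_real (exp (- (a * (t \<bullet> t)) + t \<bullet> u)))"
    by (simp add: cdot_scaled exp_of_real[symmetric])
  then show ?thesis by (simp only: complex_of_real_integrable_eq)
qed

text \<open>The boxes are first smoothed by Gaussians, whose Fourier representation meets only the
  vanishing Fourier transform of \<open>H\<close>; the smoothing parameter then tends to \<open>0\<close>.\<close>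

lemma fourier_unique:
  fixes H :: "real ^ 'k \<Rightarrow> complex"
  assumes H: "integrable lborel H"
    and F0: "\<And>v. (\<integral>t. H t * exp (\<i> * of_real (t \<bullet> v)) \<partial>lborel) = 0"
  shows "AE t in lborel. H t = 0"
proof (rule AE_zero_if_box_integrals_zero[OF H])
  show "(\<integral>t. H t \<partial>lborel) = 0" using F0[of 0] by simp
  fix a b :: "real ^ 'k"
  let ?B = "box a b"
  have Hm [measurable]: "H \<in> borel_measurable borel" using H by auto
  define G where "G u = exp (- (u \<bullet> u) / 4)" for u :: "real ^ 'k"
  have Gm [measurable]: "G \<in> borel_measurable borel" unfolding G_def by measurable
  have Gint: "integrable lborel G"
    using gaussian_integrable_vec[of "1/4" 0] by (simp add: G_def[abs_def])
  define K where "K = (\<integral>u. G u \<partial>lborel)"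
  have K: "K > 0"
  proof -
    have "complex_of_real K = (\<integral>u. of_real (G u) \<partial>lborel)" by (simp add: K_def)
    also have "\<dots> = of_real (sqrt (pi / (1/4)) ^ CARD('k))"
      using has_bochner_integral_gaussian_vec[of "1/4" "0 :: complex ^ 'k"]
      by (simp add: has_bochner_integral_iff G_def[abs_def] cdot_def exp_of_real[symmetric])
    finally have "K = sqrt (pi / (1/4)) ^ CARD('k)" by (simp only: of_real_eq_iff)
    then show ?thesis by simp
  qed
  \<comment> \<open>The Gaussian is itself a Fourier integral. After Fubini, integrating H against
    any of its translates and dilates therefore involves only the Fourier transform of H.\<close>
  have Gft: "of_real (G u) = (\<integral>w. exp (- of_real (w \<bullet> w) + \<i> * of_real (u \<bullet> w)) \<partial>lborel) / of_real (sqrt pi ^ CARD('k))"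
    for u
    using has_bochner_integral_gaussian_vec[of 1 "\<i> *s cvec u"]
    by (simp add: has_bochner_integral_iff cdot_scaled G_def exp_of_real[symmetric] inner_commute)
  have conv0: "(\<integral>t. H t * of_real (G (e *\<^sub>R (s - t))) \<partial>lborel) = 0" for e s
  proof -
    define g where "g w = (exp (- of_real (w \<bullet> w)) :: complex)" for w :: "real ^ 'k"
    have gint: "integrable lborel g"
      using has_bochner_integral_gaussian_vec[of 1 0] by (auto simp: g_def[abs_def] has_bochner_integral_iff cdot_def)
    have [measurable]: "g \<in> borel_measurable borel" using gint by auto
    have int: "integrable (lborel \<Otimes>\<^sub>M lborel) (\<lambda>(t, w). H t * (g w * exp (\<i> * of_real ((e *\<^sub>R (s - t)) \<bullet> w))))"
    proof (rule Bochner_Integration.integrable_bound)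
      show "integrable (lborel \<Otimes>\<^sub>M lborel) (\<lambda>(t, w). H t * g w)"
        by (rule lborel_pair.integrable_pair_mult[OF H gint]) (auto simp: norm_mult)
      show "AE x in lborel \<Otimes>\<^sub>M lborel. norm (case x of (t, w) \<Rightarrow> H t * (g w * exp (\<i> * of_real ((e *\<^sub>R (s - t)) \<bullet> w))))
        \<le> norm (case x of (t, w) \<Rightarrow> H t * g w)"
        by (auto simp: norm_mult)
    qed measurable
    have "(\<integral>t. H t * of_real (G (e *\<^sub>R (s - t))) \<partial>lborel) * of_real (sqrt pi ^ CARD('k))
        = (\<integral>t. \<integral>w. H t * (g w * exp (\<i> * of_real ((e *\<^sub>R (s - t)) \<bullet> w))) \<partial>lborel \<partial>lborel)"
      unfolding integral_mult_left_zero[symmetric] Gft by (simp add: g_def exp_add[symmetric])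
    also have "\<dots> = (\<integral>w. \<integral>t. H t * (g w * exp (\<i> * of_real ((e *\<^sub>R (s - t)) \<bullet> w))) \<partial>lborel \<partial>lborel)"
      using lborel_pair.Fubini_integral[OF int] by simp
    also have "\<dots> = (\<integral>w. (\<integral>t. H t * exp (\<i> * of_real (t \<bullet> (- e *\<^sub>R w))) \<partial>lborel) * (g w * exp (\<i> * of_real ((e *\<^sub>R s) \<bullet> w))) \<partial>lborel)"
      unfolding integral_mult_left_zero[symmetric]
      by (intro Bochner_Integration.integral_cong refl) (simp add: inner_diff_left right_diff_distrib exp_diff exp_minus divide_inverse mult_ac)
    also have "\<dots> = 0" by (simp only: F0 mult_zero_left integral_zero)
    finally show ?thesis by simp
  qed
  \<comment> \<open>The indicator of the box, smoothed at scale 1 / (n + 1). The Gaussian is not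
    normalised, so its mass K stays as a factor in the limit.\<close>
  define W where "W n t = (\<integral>u. indicator ?B (t + u /\<^sub>R real (Suc n)) * G u \<partial>lborel)" for n t
  have W_bound: "\<bar>W n t\<bar> \<le> K" for n t
  proof -
    have "\<bar>W n t\<bar> \<le> (\<integral>u. \<bar>indicator ?B (t + u /\<^sub>R real (Suc n)) * G u\<bar> \<partial>lborel)"
      unfolding W_def by (rule integral_abs_bound)
    also have "\<dots> \<le> K"
      unfolding K_def by (rule integral_mono'[OF Gint]) (auto simp: G_def split: split_indicator)
    finally show ?thesis .
  qed
  \<comment> \<open>The boundary is excluded because only away from it is the indicator constant
    near t. It is a null set, so the later limit of the integrals does not see it.\<close>
  have W_lim: "(\<lambda>n. W n t) \<longlonglongrightarrow> indicator ?B t * K" if t: "t \<notin> cbox a b - ?B" for t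
    unfolding W_def K_def integral_mult_right_zero[symmetric]
  proof (rule integral_dominated_convergence[OF _ _ Gint])
    show "AE u in lborel. (\<lambda>n. indicator ?B (t + u /\<^sub>R real (Suc n)) * G u) \<longlonglongrightarrow> indicator ?B t * G u"
    proof (intro AE_I2 tendsto_mult tendsto_const)
      fix u
      have lim: "(\<lambda>n. t + u /\<^sub>R real (Suc n)) \<longlonglongrightarrow> t"
      proof -
        have "(\<lambda>n. t + inverse (real (Suc n)) *\<^sub>R u) \<longlonglongrightarrow> t + 0 *\<^sub>R u"
          by (intro tendsto_intros LIMSEQ_inverse_real_of_nat)
        then show ?thesis by simp
      qed
      consider "t \<in> ?B" | "t \<in> - cbox a b" using t by auto
      then show "(\<lambda>n. indicator ?B (t + u /\<^sub>R real (Suc n)) :: real) \<longlonglongrightarrow> indicator ?B t"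
      proof cases
        case 1
        then have "\<forall>\<^sub>F n in sequentially. t + u /\<^sub>R real (Suc n) \<in> ?B"
          using topological_tendstoD[OF lim open_box] by blast
        then show ?thesis using 1 by (intro tendsto_eventually) (auto elim: eventually_mono)
      next
        case 2
        then have "\<forall>\<^sub>F n in sequentially. t + u /\<^sub>R real (Suc n) \<in> - cbox a b"
          using topological_tendstoD[OF lim, of "- cbox a b"] by auto
        then have "\<forall>\<^sub>F n in sequentially. t + u /\<^sub>R real (Suc n) \<notin> ?B"
          by eventually_elim (use box_subset_cbox[of a b] in blast)
        moreover have "t \<notin> ?B" using 2 box_subset_cbox[of a b] by blast
        ultimately show ?thesis by (intro tendsto_eventually) (auto elim: eventually_mono)
      qed
    qed
  qed (auto simp: G_def split: split_indicator)
  have HW0: "(\<integral>t. H t * of_real (W n t) \<partial>lborel) = 0" for n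
  proof -
    define e where "e = real (Suc n)"
    have e: "e > 0" by (simp add: e_def)
    \<comment> \<open>The substitution u = e (s - t) moves the dependence on t from the box into the
      Gaussian, where the vanishing of the Gaussian averages of H applies.\<close>
    have W_eq: "W n t = e ^ CARD('k) * (\<integral>s. indicator ?B s * G (e *\<^sub>R (s - t)) \<partial>lborel)" for t
    proof -
      define f where "f u = indicator ?B (t + u /\<^sub>R e) * G u" for u
      have [measurable]: "f \<in> borel_measurable borel" unfolding f_def by measurable
      have fint: "integrable lborel f"
        by (rule Bochner_Integration.integrable_bound[OF Gint]) (auto simp: f_def G_def split: split_indicator)
      have "W n t = (\<integral>u. f u \<partial>lborel)" by (simp add: W_def f_def e_def)
      also have "\<dots> = (\<integral>u. f u \<partial>density (distr lborel borel (\<lambda>x. - (e *\<^sub>R t) + e *\<^sub>R x)) (\<lambda>_. ennreal (\<bar>e\<bar> ^ DIM(real ^ 'k))))"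
        using lborel_affine[of e "- (e *\<^sub>R t)"] e by simp
      also have "\<dots> = e ^ CARD('k) * (\<integral>s. f (- (e *\<^sub>R t) + e *\<^sub>R s) \<partial>lborel)"
        using e by (subst integral_density) (auto simp: integral_distr)
      also have "(\<lambda>s. f (- (e *\<^sub>R t) + e *\<^sub>R s)) = (\<lambda>s. indicator ?B s * G (e *\<^sub>R (s - t)))"
        using e by (auto simp: f_def algebra_simps)
      finally show ?thesis .
    qed
    have int: "integrable (lborel \<Otimes>\<^sub>M lborel) (\<lambda>(t, s). H t * of_real (indicator ?B s * G (e *\<^sub>R (s - t))))"
    proof (rule Bochner_Integration.integrable_bound)
      show "integrable (lborel \<Otimes>\<^sub>M lborel) (\<lambda>(t, s). H t * of_real (indicator ?B s))"
      proof (rule lborel_pair.integrable_pair_mult[OF H])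
        show "integrable lborel (\<lambda>s. complex_of_real (indicator ?B s))"
          by (intro integrable_of_real integrable_real_indicator) (auto simp: emeasure_lborel_box_eq)
      qed (auto simp: norm_mult)
      show "AE x in lborel \<Otimes>\<^sub>M lborel. norm (case x of (t, s) \<Rightarrow> H t * of_real (indicator ?B s * G (e *\<^sub>R (s - t))))
        \<le> norm (case x of (t, s) \<Rightarrow> H t * of_real (indicator ?B s))"
        using e by (intro AE_I2) (auto simp: norm_mult G_def intro!: mult_left_mono mult_left_le mult_nonneg_nonneg)
    qed measurable
    have "(\<integral>t. H t * of_real (W n t) \<partial>lborel) = of_real (e ^ CARD('k)) * (\<integral>t. \<integral>s. H t * of_real (indicator ?B s * G (e *\<^sub>R (s - t))) \<partial>lborel \<partial>lborel)"
    proof -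
      have "H t * of_real (W n t) = of_real (e ^ CARD('k)) * (\<integral>s. H t * of_real (indicator ?B s * G (e *\<^sub>R (s - t))) \<partial>lborel)" for t
        unfolding W_eq integral_mult_right_zero integral_complex_of_real by simp
      then show ?thesis by (simp only: integral_mult_right_zero)
    qed
    also have "\<dots> = of_real (e ^ CARD('k)) * (\<integral>s. \<integral>t. H t * of_real (indicator ?B s * G (e *\<^sub>R (s - t))) \<partial>lborel \<partial>lborel)"
      using lborel_pair.Fubini_integral[OF int] by simp
    also have "\<dots> = of_real (e ^ CARD('k)) * (\<integral>s. of_real (indicator ?B s) * (\<integral>t. H t * of_real (G (e *\<^sub>R (s - t))) \<partial>lborel) \<partial>lborel)"
      unfolding integral_mult_right_zero[symmetric] by (simp add: mult_ac)
    finally show ?thesis by (simp only: conv0) simp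
  qed
  have Wm [measurable]: "W n \<in> borel_measurable borel" for n unfolding W_def by measurable
  have "(\<lambda>n. \<integral>t. H t * of_real (W n t) \<partial>lborel) \<longlonglongrightarrow> (\<integral>t. H t * of_real (indicator ?B t * K) \<partial>lborel)"
  proof (rule integral_dominated_convergence[where w = "\<lambda>t. cmod (H t) * K"])
    have "cbox a b - ?B \<in> null_sets lborel"
      using negligible_frontier_interval[of a b] by (simp add: negligible_iff_null_sets null_sets_completion_iff)
    then have "AE t in lborel. t \<notin> cbox a b - ?B" by (rule AE_not_in)
    then show "AE t in lborel. (\<lambda>n. H t * of_real (W n t)) \<longlonglongrightarrow> H t * of_real (indicator ?B t * K)"
      by eventually_elim (intro tendsto_intros W_lim)
  qed (use H W_bound in \<open>auto simp: norm_mult intro!: mult_left_mono\<close>)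
  then have "(\<integral>t. H t * of_real (indicator ?B t * K) \<partial>lborel) = 0"
    unfolding HW0 by (rule LIMSEQ_unique[OF _ tendsto_const])
  also have "(\<integral>t. H t * of_real (indicator ?B t * K) \<partial>lborel) = of_real K * (\<integral>t. indicator ?B t *\<^sub>R H t \<partial>lborel)"
    unfolding integral_mult_right_zero[symmetric] by (simp add: scaleR_conv_of_real mult_ac)
  finally show "(\<integral>t. indicator ?B t *\<^sub>R H t \<partial>lborel) = 0" using K by simp
qed

section \<open>The Bargmann transform and the short-time Fourier transform\<close>

definition re_vec :: "complex ^ 'k \<Rightarrow> real ^ 'k" where "re_vec z = (\<chi> i. Re (z $ i))"
definition im_vec :: "complex ^ 'k \<Rightarrow> real ^ 'k" where "im_vec z = (\<chi> i. Im (z $ i))"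
definition cnj_vec :: "complex ^ 'k \<Rightarrow> complex ^ 'k" where "cnj_vec z = (\<chi> i. cnj (z $ i))"

lemma cdot_simps:
  "cdot (a + b) c = cdot a c + cdot b c" "cdot c (a + b) = cdot c a + cdot c b"
  "cdot (a - b) c = cdot a c - cdot b c" "cdot c (a - b) = cdot c a - cdot c b"
  "cdot (k *s a) c = k * cdot a c" "cdot c (k *s a) = k * cdot c a"
  "cdot (cvec s) (cvec t) = of_real (s \<bullet> t)"
  "cvec (s + t) = cvec s + cvec t" "cvec (s - t) = cvec s - cvec t" "cvec (r *\<^sub>R s) = of_real r *s cvec s"
  by (simp_all add: cdot_def cvec_def inner_vec_def vec_eq_iff sum.distrib sum_subtractf ring_distribs sum_distrib_left mult.assoc mult.left_commute)

lemma cdot_commute: "cdot a b = cdot b a"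
  by (simp add: cdot_def mult.commute)

lemma re_im_vec_simps:
  "re_vec (z + w) = re_vec z + re_vec w" "im_vec (z + w) = im_vec z + im_vec w"
  "re_vec (z - w) = re_vec z - re_vec w" "im_vec (z - w) = im_vec z - im_vec w"
  "re_vec (cvec t) = t" "im_vec (cvec t) = 0"
  "re_vec (cnj_vec z) = re_vec z" "im_vec (cnj_vec z) = - im_vec z"
  "re_vec (\<i> *s z) = - im_vec z" "im_vec (\<i> *s z) = re_vec z"
  by (simp_all add: re_vec_def im_vec_def cvec_def cnj_vec_def vec_eq_iff)

lemma Re_cdot_cvec: "Re (cdot (cvec t) z) = t \<bullet> re_vec z"
  by (simp add: cdot_def cvec_def re_vec_def inner_vec_def)

lemma Re_cdot_self: "Re (cdot z z) = re_vec z \<bullet> re_vec z - im_vec z \<bullet> im_vec z"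
  by (simp add: cdot_def re_vec_def im_vec_def inner_vec_def sum_subtractf)

lemma norm_cvec_power2: "(norm z)\<^sup>2 = re_vec z \<bullet> re_vec z + im_vec z \<bullet> im_vec z" for z :: "complex ^ 'k"
  by (simp add: norm_vec_def L2_set_def re_vec_def im_vec_def inner_vec_def sum_nonneg cmod_power2 sum.distrib power2_eq_square
      flip: sum.distrib) (simp add: cmod_def power2_eq_square[symmetric] sum.distrib)

lemma cdot_measurable [measurable]: "(\<lambda>t. cdot (cvec t) z) \<in> borel_measurable borel"
  unfolding cdot_def cvec_def by simp

text \<open>The factor exp (- pi z^2 / 2) of the Bargmann transform is split off, so that z enters
  only through an exponential linear in z; \<open>bargmann_normed\<close> restores the
  factor.\<close>

definition bargmann :: "(real ^ 'k \<Rightarrow> complex) \<Rightarrow> complex ^ 'k \<Rightarrow> complex" where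
  "bargmann F z = (\<integral>t. F t * exp (- of_real (pi * (t \<bullet> t)) + 2 * pi * cdot (cvec t) z) \<partial>lborel)"

definition stft :: "(real ^ 'k \<Rightarrow> complex) \<Rightarrow> (real ^ 'k \<Rightarrow> complex) \<Rightarrow> real ^ 'k \<Rightarrow> real ^ 'k \<Rightarrow> complex" where
  "stft G F x w = (\<integral>t. F t * cnj (G (t - x)) * exp (- 2 * pi * \<i> * of_real (t \<bullet> w)) \<partial>lborel)"

declare norm_exp_eq_Re [simp]

lemma L2_mult_integrable:
  assumes "L2 M F" "L2 M G"
  shows "integrable M (\<lambda>t. F t * G t)"
proof (rule Bochner_Integration.integrable_bound)
  show "integrable M (\<lambda>t. (cmod (F t))\<^sup>2 + (cmod (G t))\<^sup>2)" using assms by (auto simp: L2_def)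
  show "AE t in M. norm (F t * G t) \<le> norm ((cmod (F t))\<^sup>2 + (cmod (G t))\<^sup>2)"
  proof (rule AE_I2)
    fix t
    have "2 * (cmod (F t) * cmod (G t)) \<le> (cmod (F t))\<^sup>2 + (cmod (G t))\<^sup>2"
      using sum_squares_bound[of "cmod (F t)" "cmod (G t)"] by simp
    moreover have "0 \<le> cmod (F t) * cmod (G t)" by (intro mult_nonneg_nonneg norm_ge_zero)
    ultimately have "cmod (F t) * cmod (G t) \<le> (cmod (F t))\<^sup>2 + (cmod (G t))\<^sup>2" by linarith
    then show "norm (F t * G t) \<le> norm ((cmod (F t))\<^sup>2 + (cmod (G t))\<^sup>2)"
      by (simp add: norm_mult)
  qed
qed (use assms in \<open>auto simp: L2_def\<close>)

lemma L2_cnj: "L2 M F \<Longrightarrow> L2 M (\<lambda>t. cnj (F t))"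
  unfolding L2_def by (auto intro: borel_measurable_continuous_on[of cnj] continuous_intros)

lemma L2_shift: "L2 lborel F \<Longrightarrow> L2 lborel (\<lambda>t. F (t - x))"
  using integrable_lborel_shift[of "\<lambda>t. (cmod (F t))\<^sup>2" "- x"] by (auto simp: L2_def)

lemma L2_gaussian: "L2 lborel (\<lambda>t :: real ^ 'k. exp (- of_real (pi * (t \<bullet> t)) + 2 * pi * cdot (cvec t) z))"
proof -
  have "(\<lambda>t. (cmod (exp (- of_real (pi * (t \<bullet> t)) + 2 * pi * cdot (cvec t) z)))\<^sup>2)
      = (\<lambda>t. exp (- ((2 * pi) * (t \<bullet> t)) + t \<bullet> ((4 * pi) *\<^sub>R re_vec z)))"
    by (simp add: Re_cdot_cvec power2_eq_square mult_exp_exp algebra_simps)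
  then show ?thesis unfolding L2_def
    using gaussian_integrable_vec[of "2 * pi" "(4 * pi) *\<^sub>R re_vec z"] by simp
qed

lemma bargmann_integrable:
  assumes "L2 lborel F"
  shows "integrable lborel (\<lambda>t. F t * exp (- of_real (pi * (t \<bullet> t)) + 2 * pi * cdot (cvec t) z))"
  by (rule L2_mult_integrable[OF assms L2_gaussian])

text \<open>Peetre's inequality, for exponents of either sign: a weight centred at one point is
  moved to another at the price of a weight in the difference. For N < 0 the roles of a and b are
  exchanged.\<close>

lemma peetre:
  fixes a b :: "'a :: real_normed_vector"
  shows "(1 + norm a) powr N \<le> (1 + norm b) powr N * (1 + norm (a - b)) powr \<bar>N\<bar>"
proof -
  have *: "1 + norm a \<le> (1 + norm b) * (1 + norm (a - b))" for a b :: 'a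
  proof -
    have "norm a \<le> norm b + norm (a - b)" using norm_triangle_sub[of a b] by simp
    also have "\<dots> \<le> norm b + norm (a - b) + norm b * norm (a - b)" by simp
    finally show ?thesis by (simp add: algebra_simps)
  qed
  show ?thesis
  proof (cases "N \<ge> 0")
    case True
    have "(1 + norm a) powr N \<le> ((1 + norm b) * (1 + norm (a - b))) powr N"
      using True *[of a b] by (intro powr_mono2) auto
    then show ?thesis using True by (simp add: powr_mult)
  next
    case False
    have "(1 + norm b) powr - N \<le> ((1 + norm a) * (1 + norm (a - b))) powr - N"
      using False *[of b a] by (intro powr_mono2) (auto simp: norm_minus_commute)
    then have "(1 + norm b) powr - N \<le> (1 + norm a) powr - N * (1 + norm (a - b)) powr - N"
      by (simp add: powr_mult)
    then have "(1 + norm a) powr N * (1 + norm b) powr N * (1 + norm b) powr - N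
      \<le> (1 + norm a) powr N * (1 + norm b) powr N * ((1 + norm a) powr - N * (1 + norm (a - b)) powr - N)"
      by (intro mult_left_mono) auto
    moreover have "(1 + norm x) powr N * (1 + norm x) powr - N = 1" for x :: 'a
      using norm_ge_zero[of x] by (simp add: powr_add[symmetric] del: norm_ge_zero)
    ultimately show ?thesis using False
      by (simp add: mult.assoc) (metis (no_types, lifting) mult.assoc mult.commute mult.right_neutral)
  qed
qed

lemma weight_integrable:
  assumes "M \<ge> 0"
  shows "integrable lborel (\<lambda>x :: real ^ 'k. (1 + norm x) powr M * exp (- pi * (x \<bullet> x)))"
proof (rule Bochner_Integration.integrable_bound)
  \<comment> \<open>One unit of the Gaussian rate pays for the weight, since M r \<le> M^2 / 4 +
    r^2; the rate pi - 1 that is left is still positive.\<close>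
  show "integrable lborel (\<lambda>x :: real ^ 'k. exp (M\<^sup>2 / 4) * exp (- ((pi - 1) * (x \<bullet> x)) + x \<bullet> 0))"
    using gaussian_integrable_vec[of "pi - 1" 0] pi_gt3 by (intro integrable_mult_right) auto
  show "AE x :: real ^ 'k in lborel. norm ((1 + norm x) powr M * exp (- pi * (x \<bullet> x)))
     \<le> norm (exp (M\<^sup>2 / 4) * exp (- ((pi - 1) * (x \<bullet> x)) + x \<bullet> 0))"
  proof (rule AE_I2)
    fix x :: "real ^ 'k"
    have "(1 + norm x) powr M \<le> (exp (norm x)) powr M"
      using assms exp_ge_add_one_self[of "norm x"] by (intro powr_mono2) auto
    also have "\<dots> = exp (M * norm x)" by (simp add: powr_def)
    also have "\<dots> \<le> exp (M\<^sup>2 / 4 + x \<bullet> x)"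
    proof -
      have "0 \<le> (norm x - M / 2)\<^sup>2" by simp
      then have "M * norm x \<le> M\<^sup>2 / 4 + (norm x)\<^sup>2" by (simp add: power2_eq_square algebra_simps)
      then show ?thesis by (simp add: power2_norm_eq_inner)
    qed
    finally have "(1 + norm x) powr M * exp (- pi * (x \<bullet> x)) \<le> exp (M\<^sup>2 / 4 + x \<bullet> x) * exp (- pi * (x \<bullet> x))"
      by (intro mult_right_mono) auto
    also have "\<dots> = exp (M\<^sup>2 / 4) * exp (- ((pi - 1) * (x \<bullet> x)))"
      by (simp add: mult_exp_exp algebra_simps)
    finally show "norm ((1 + norm x) powr M * exp (- pi * (x \<bullet> x))) \<le> norm (exp (M\<^sup>2 / 4) * exp (- ((pi - 1) * (x \<bullet> x)) + x \<bullet> 0))"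
      by simp
  qed
qed simp

text \<open>The left-hand side is, up to a factor free of t, the product of the two Bargmann kernels
  at t and t - x. Writing it as a superposition of the characters exp (- 2 pi i t w) is what brings
  in the short-time Fourier transform.\<close>

lemma gaussian_as_fourier_integral:
  fixes s :: "complex ^ 'k"
  shows "exp (- 2 * of_real (pi * (t \<bullet> t)) + 2 * pi * cdot (cvec t) s) =
    exp (pi / 2 * cdot s s) / of_real (sqrt 2 ^ CARD('k)) *
      (\<integral>w. exp (- of_real (pi / 2 * (w \<bullet> w)) + pi * \<i> * cdot (cvec w) s) * exp (- 2 * pi * \<i> * of_real (t \<bullet> w)) \<partial>lborel)"
    and "integrable lborel (\<lambda>w :: real ^ 'k. exp (- of_real (pi / 2 * (w \<bullet> w)) + pi * \<i> * cdot (cvec w) s))"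
proof -
  \<comment> \<open>Collects the two terms linear in w, namely pi i w s and - 2 pi i t w.\<close>
  define u where "u = (pi * \<i>) *s (s - 2 *s cvec t)"
  have G: "has_bochner_integral lborel (\<lambda>w. exp (- of_real (pi / 2 * (w \<bullet> w)) + cdot (cvec w) u))
     (of_real (sqrt (pi / (pi / 2)) ^ CARD('k)) * exp (cdot u u / of_real (4 * (pi / 2))))"
    by (rule has_bochner_integral_gaussian_vec) auto
  have 1: "(\<lambda>w. exp (- of_real (pi / 2 * (w \<bullet> w)) + cdot (cvec w) u)) =
    (\<lambda>w. exp (- of_real (pi / 2 * (w \<bullet> w)) + pi * \<i> * cdot (cvec w) s) * exp (- 2 * pi * \<i> * of_real (t \<bullet> w)))"
    unfolding exp_add[symmetric] u_def
    by (intro ext arg_cong[where f = exp]) (simp add: cdot_simps inner_commute algebra_simps)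
  have "cdot u u / of_real (4 * (pi / 2)) = - pi / 2 * cdot s s + (- 2 * of_real (pi * (t \<bullet> t)) + 2 * pi * cdot (cvec t) s)"
  proof -
    have "cdot u u = (pi * \<i>) * (pi * \<i>) * (cdot s s - 4 * cdot (cvec t) s + 4 * of_real (t \<bullet> t))"
      by (simp add: u_def cdot_simps cdot_commute[of s "cvec t"] algebra_simps)
    also have "(pi * \<i>) * (pi * \<i>) = - (of_real pi * of_real pi)" by (simp add: algebra_simps)
    finally show ?thesis by (simp add: field_simps)
  qed
  then have 2: "of_real (sqrt (pi / (pi / 2)) ^ CARD('k)) * exp (cdot u u / of_real (4 * (pi / 2)))
    = of_real (sqrt 2 ^ CARD('k)) * (exp (- pi / 2 * cdot s s) * exp (- 2 * of_real (pi * (t \<bullet> t)) + 2 * pi * cdot (cvec t) s))"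
    by (simp only: exp_add) simp
  have 3: "exp (pi / 2 * cdot s s) * exp (- pi / 2 * cdot s s) = 1"
    by (simp add: mult_exp_exp)
  show "exp (- 2 * of_real (pi * (t \<bullet> t)) + 2 * pi * cdot (cvec t) s) =
    exp (pi / 2 * cdot s s) / of_real (sqrt 2 ^ CARD('k)) *
      (\<integral>w. exp (- of_real (pi / 2 * (w \<bullet> w)) + pi * \<i> * cdot (cvec w) s) * exp (- 2 * pi * \<i> * of_real (t \<bullet> w)) \<partial>lborel)"
  proof -
    have "(\<integral>w. exp (- of_real (pi / 2 * (w \<bullet> w)) + pi * \<i> * cdot (cvec w) s) * exp (- 2 * pi * \<i> * of_real (t \<bullet> w)) \<partial>lborel)
      = of_real (sqrt 2 ^ CARD('k)) * (exp (- pi / 2 * cdot s s) * exp (- 2 * of_real (pi * (t \<bullet> t)) + 2 * pi * cdot (cvec t) s))"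
      using G unfolding 1 2 by (simp only: has_bochner_integral_iff)
    then show ?thesis using 3 by (simp only: times_divide_eq_left) (simp add: mult.assoc[symmetric])
  qed
  have "(\<lambda>w :: real ^ 'k. exp (- of_real (pi / 2 * (w \<bullet> w)) + pi * \<i> * cdot (cvec w) s))
     = (\<lambda>w. exp (- of_real (pi / 2 * (w \<bullet> w)) + cdot (cvec w) ((pi * \<i>) *s s)))"
    by (simp add: cdot_simps)
  then show "integrable lborel (\<lambda>w :: real ^ 'k. exp (- of_real (pi / 2 * (w \<bullet> w)) + pi * \<i> * cdot (cvec w) s))"
    using has_bochner_integral_gaussian_vec[of "pi / 2" "(pi * \<i>) *s s"] by (simp only: has_bochner_integral_iff) simp
qed

lemma integral_norm_bound_AE:
  fixes f :: "'a \<Rightarrow> 'b :: {banach, second_countable_topology}"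
  assumes "integrable M f" "integrable M g" "AE x in M. norm (f x) \<le> g x"
  shows "norm (\<integral>x. f x \<partial>M) \<le> (\<integral>x. g x \<partial>M)"
  by (rule order_trans[OF integral_norm_bound integral_mono_AE]) (use assms in auto)

text \<open>With t - x as second integration variable, the exponents of the two kernels add up to -
  2 pi t^2 + 2 pi t s, where s = x + z + \<open>cnj_vec y\<close>, plus terms without t. Expanding
  this Gaussian into characters leaves exactly \<open>stft G F x w\<close> after integration over t.
  The vector y is conjugated because the second factor is.\<close>

lemma bargmann_product_eq:
  fixes F G :: "real ^ 'k \<Rightarrow> complex"
  assumes F: "L2 lborel F" and G: "L2 lborel G"
  defines "e \<equiv> \<lambda>s w. exp (- of_real (pi / 2 * (w \<bullet> w)) + pi * \<i> * cdot (cvec w) s)"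
  obtains A where "integrable lborel A"
    "bargmann F z * cnj (bargmann G y) = (\<integral>x. A x \<partial>lborel)"
    "\<And>x. A x = exp (- of_real (pi * (x \<bullet> x)) - 2 * pi * cdot (cvec x) (cnj_vec y)
             + pi / 2 * cdot (cvec x + (z + cnj_vec y)) (cvec x + (z + cnj_vec y)))
           / of_real (sqrt 2 ^ CARD('k)) * (\<integral>w. e (cvec x + (z + cnj_vec y)) w * stft G F x w \<partial>lborel)"
    "\<And>x. integrable lborel (\<lambda>w. e (cvec x + (z + cnj_vec y)) w * stft G F x w)"
proof -
  define f where "f t = F t * exp (- of_real (pi * (t \<bullet> t)) + 2 * pi * cdot (cvec t) z)" for t
  define g where "g t = cnj (G t) * exp (- of_real (pi * (t \<bullet> t)) + 2 * pi * cdot (cvec t) (cnj_vec y))" for t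
  have f: "integrable lborel f" unfolding f_def by (rule bargmann_integrable[OF F])
  have g: "integrable lborel g" unfolding g_def by (rule bargmann_integrable[OF L2_cnj[OF G]])
  have [measurable]: "f \<in> borel_measurable borel" "g \<in> borel_measurable borel" using f g by auto
  have Fm [measurable]: "F \<in> borel_measurable borel" and Gm [measurable]: "G \<in> borel_measurable borel"
    using F G by (auto simp: L2_def)
  have bf: "bargmann F z = integral\<^sup>L lborel f" by (simp add: bargmann_def f_def[abs_def])
  have bg: "cnj (bargmann G y) = integral\<^sup>L lborel g"
  proof -
    have "cnj (bargmann G y) = (\<integral>t. cnj (G t * exp (- of_real (pi * (t \<bullet> t)) + 2 * pi * cdot (cvec t) y)) \<partial>lborel)"
      unfolding bargmann_def by (rule Bochner_Integration.integral_cnj[symmetric])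
    moreover have "cnj (cdot (cvec t) y) = cdot (cvec t) (cnj_vec y)" for t
      by (simp add: cdot_def cvec_def cnj_vec_def)
    ultimately show ?thesis by (simp add: g_def[abs_def] exp_cnj)
  qed
  have int: "integrable (lborel \<Otimes>\<^sub>M lborel) (\<lambda>(t, x). f t * g (t - x))"
  proof (rule lborel_pair.Fubini_integrable)
    show "integrable lborel (\<lambda>t. \<integral>x. norm (case (t, x) of (t, x) \<Rightarrow> f t * g (t - x)) \<partial>lborel)"
      using f by (simp add: norm_mult integral_lborel_reflect[of "\<lambda>x. cmod (g x)"])
    show "AE t in lborel. integrable lborel (\<lambda>x. case (t, x) of (t, x) \<Rightarrow> f t * g (t - x))"
      using integrable_lborel_reflect[OF g] by simp
  qed measurable
  define A where "A x = (\<integral>t. f t * g (t - x) \<partial>lborel)" for x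
  have "integrable lborel A"
    unfolding A_def using lborel_pair.integrable_snd[OF int] by simp
  moreover have "bargmann F z * cnj (bargmann G y) = (\<integral>x. A x \<partial>lborel)"
  proof -
    have "bargmann F z * cnj (bargmann G y) = (\<integral>t. f t * (\<integral>x. g (t - x) \<partial>lborel) \<partial>lborel)"
      by (simp add: bf bg integral_lborel_reflect)
    also have "\<dots> = (\<integral>t. \<integral>x. f t * g (t - x) \<partial>lborel \<partial>lborel)" by simp
    also have "\<dots> = (\<integral>x. A x \<partial>lborel)"
      unfolding A_def by (rule lborel_pair.Fubini_integral[OF int, symmetric])
    finally show ?thesis .
  qed
  moreover have "integrable lborel (\<lambda>w. e (cvec x + (z + cnj_vec y)) w * stft G F x w) \<and>
       A x = exp (- of_real (pi * (x \<bullet> x)) - 2 * pi * cdot (cvec x) (cnj_vec y)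
             + pi / 2 * cdot (cvec x + (z + cnj_vec y)) (cvec x + (z + cnj_vec y)))
           / of_real (sqrt 2 ^ CARD('k)) * (\<integral>w. e (cvec x + (z + cnj_vec y)) w * stft G F x w \<partial>lborel)" for x
  proof -
    define s where "s = cvec x + (z + cnj_vec y)"
    define K where "K t = F t * cnj (G (t - x))" for t
    have K: "integrable lborel K"
      unfolding K_def by (intro L2_mult_integrable[OF F] L2_cnj L2_shift G)
    have [measurable]: "K \<in> borel_measurable borel" using K by auto
    have es: "integrable lborel (e s)" unfolding e_def by (rule gaussian_as_fourier_integral(2))
    have [measurable]: "e s \<in> borel_measurable borel" using es by auto
    define c where "c = exp (- of_real (pi * (x \<bullet> x)) - 2 * pi * cdot (cvec x) (cnj_vec y))"
    define E where "E t w = exp (- 2 * pi * \<i> * of_real (t \<bullet> w))" for t w :: "real ^ 'k"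
    define d where "d = exp (pi / 2 * cdot s s) / of_real (sqrt 2 ^ CARD('k))"
    have fg: "f t * g (t - x) = c * K t * (d * (\<integral>w. e s w * E t w \<partial>lborel))" for t
    proof -
      have "(- of_real (pi * (t \<bullet> t)) + 2 * pi * cdot (cvec t) z) + (- of_real (pi * ((t - x) \<bullet> (t - x))) + 2 * pi * cdot (cvec (t - x)) (cnj_vec y))
         = (- of_real (pi * (x \<bullet> x)) - 2 * pi * cdot (cvec x) (cnj_vec y)) + (- 2 * of_real (pi * (t \<bullet> t)) + 2 * pi * cdot (cvec t) s)"
        by (simp add: s_def cdot_simps inner_simps inner_commute algebra_simps)
      then have "exp (- of_real (pi * (t \<bullet> t)) + 2 * pi * cdot (cvec t) z) * exp (- of_real (pi * ((t - x) \<bullet> (t - x))) + 2 * pi * cdot (cvec (t - x)) (cnj_vec y))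
         = c * exp (- 2 * of_real (pi * (t \<bullet> t)) + 2 * pi * cdot (cvec t) s)"
        unfolding c_def mult_exp_exp by (simp only:)
      also have "\<dots> = c * (d * (\<integral>w. e s w * E t w \<partial>lborel))"
        unfolding gaussian_as_fourier_integral(1) e_def E_def d_def ..
      finally show ?thesis unfolding f_def g_def K_def by (simp add: mult_ac)
    qed
    have int2: "integrable (lborel \<Otimes>\<^sub>M lborel) (\<lambda>(t, w). K t * (e s w * E t w))"
      by (rule lborel_pair.integrable_pair_mult[OF K es]) (auto simp: E_def norm_mult)
    have V: "(\<integral>t. K t * (e s w * E t w) \<partial>lborel) = e s w * stft G F x w" for w
      unfolding stft_def K_def E_def integral_mult_right_zero[symmetric] by (simp add: mult_ac)
    have "A x = (\<integral>t. (c * d) * (\<integral>w. K t * (e s w * E t w) \<partial>lborel) \<partial>lborel)"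
      unfolding A_def fg by (simp add: mult_ac)
    also have "\<dots> = c * d * (\<integral>w. \<integral>t. K t * (e s w * E t w) \<partial>lborel \<partial>lborel)"
      unfolding integral_mult_right_zero lborel_pair.Fubini_integral[OF int2] ..
    finally have "A x = c * d * (\<integral>w. e s w * stft G F x w \<partial>lborel)" by (simp only: V)
    moreover have "c * d = exp (- of_real (pi * (x \<bullet> x)) - 2 * pi * cdot (cvec x) (cnj_vec y) + pi / 2 * cdot s s) / of_real (sqrt 2 ^ CARD('k))"
      unfolding c_def d_def exp_add by simp
    moreover have "integrable lborel (\<lambda>w. e s w * stft G F x w)"
      using lborel_pair.integrable_snd[OF int2] by (simp only: V)
    ultimately show ?thesis unfolding s_def by (simp only:)
  qed
  ultimately show thesis using that by blast
qed

text \<open>The modulus of the kernel times the assumed decay is a Gaussian of rate pi centred at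
  half of (a, b), where (a, b) is z - y up to the sign of its imaginary part. Peetre's inequality
  moves the weight to that centre; the remaining weights are integrable against the
  Gaussian.\<close>

lemma bargmann_product_bound:
  fixes F G :: "real ^ 'k \<Rightarrow> complex"
  assumes F: "L2 lborel F" and G: "L2 lborel G" and C: "C \<ge> 0"
    and decay: "AE x in lborel. AE w in lborel.
      cmod (stft G F x w) \<le> C * (1 + norm (x, w)) powr N * exp (- pi * (x \<bullet> x + w \<bullet> w) / 2)"
  obtains B where "B \<ge> 0"
    "\<And>z y. cmod (bargmann F z * bargmann G y) \<le> B * (1 + norm (z - y)) powr N *
       exp (pi * (re_vec z \<bullet> re_vec z + re_vec y \<bullet> re_vec y) - pi / 4 * (norm (z - y))\<^sup>2)"
proof -
  define M where "M = \<bar>N\<bar>"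
  define h where "h x = (1 + norm x) powr M * exp (- pi * (x \<bullet> x))" for x :: "real ^ 'k"
  have h: "integrable lborel h" unfolding h_def by (rule weight_integrable) (simp add: M_def)
  have h0: "h x \<ge> 0" for x by (simp add: h_def)
  define I where "I = integral\<^sup>L lborel h"
  have I0: "I \<ge> 0" unfolding I_def using h0 by (intro Bochner_Integration.integral_nonneg) auto
  define B where "B = C * 2 powr M * I * I"
  have B0: "B \<ge> 0" using C I0 by (simp add: B_def)
  moreover have "cmod (bargmann F z * bargmann G y) \<le> B * (1 + norm (z - y)) powr N *
       exp (pi * (re_vec z \<bullet> re_vec z + re_vec y \<bullet> re_vec y) - pi / 4 * (norm (z - y))\<^sup>2)" for z y
  proof -
    define e where "e s w = exp (- of_real (pi / 2 * (w \<bullet> w)) + pi * \<i> * cdot (cvec w) s)" for s and w :: "real ^ 'k"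
    define s where "s x = cvec x + (z + cnj_vec y)" for x
    obtain A where A: "integrable lborel A"
      "bargmann F z * cnj (bargmann G y) = (\<integral>x. A x \<partial>lborel)"
      "\<And>x. A x = exp (- of_real (pi * (x \<bullet> x)) - 2 * pi * cdot (cvec x) (cnj_vec y) + pi / 2 * cdot (s x) (s x))
           / of_real (sqrt 2 ^ CARD('k)) * (\<integral>w. e (s x) w * stft G F x w \<partial>lborel)"
      "\<And>x. integrable lborel (\<lambda>w. e (s x) w * stft G F x w)"
      using bargmann_product_eq[OF F G, of z y] unfolding e_def s_def by blast
    define p q a b where "p = re_vec z" and "q = re_vec y" and "a = re_vec z - re_vec y" and "b = im_vec y - im_vec z"
    \<comment> \<open>The value left over after completing the squares in x and w; it is the entire
      exponential growth in z and y.\<close>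
    define \<rho> where "\<rho> = exp (pi * (p \<bullet> p + q \<bullet> q) - pi / 4 * (a \<bullet> a + b \<bullet> b))"
    define D where "D = C * (2 powr M * (1 + norm (z - y)) powr N)"
    have D0: "D \<ge> 0" using C by (simp add: D_def)
    have nab: "norm (a, b) = norm (z - y)" "a \<bullet> a + b \<bullet> b = (norm (z - y))\<^sup>2"
    proof -
      show ab: "a \<bullet> a + b \<bullet> b = (norm (z - y))\<^sup>2"
        unfolding norm_cvec_power2 by (simp add: re_im_vec_simps a_def b_def inner_diff_left inner_diff_right)
      then have "(norm (a, b))\<^sup>2 = (norm (z - y))\<^sup>2" by (simp add: norm_prod_def power2_norm_eq_inner)
      then show "norm (a, b) = norm (z - y)" by simp
    qed
    have norm_e: "cmod (exp (- of_real (pi * (x \<bullet> x)) - 2 * pi * cdot (cvec x) (cnj_vec y) + pi / 2 * cdot (s x) (s x))) * cmod (e (s x) w)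
        * exp (- pi * (x \<bullet> x + w \<bullet> w) / 2)
      = \<rho> * (exp (- pi * ((x - a /\<^sub>R 2) \<bullet> (x - a /\<^sub>R 2))) * exp (- pi * ((w - b /\<^sub>R 2) \<bullet> (w - b /\<^sub>R 2))))" for x w
    proof -
      have 1: "re_vec (s x) = x + (p + q)" "im_vec (s x) = - b"
        by (simp_all add: s_def re_im_vec_simps p_def q_def b_def)
      have "- Im (cdot (cvec w) (s x)) = w \<bullet> b"
        using Re_cdot_cvec[of w "\<i> *s s x"] by (simp add: cdot_simps re_im_vec_simps 1)
      then have "Re (pi * \<i> * cdot (cvec w) (s x)) = pi * (w \<bullet> b)" by (simp flip: \<open>- Im _ = _\<close>)
      then have 2: "Re (- of_real (pi / 2 * (w \<bullet> w)) + pi * \<i> * cdot (cvec w) (s x)) = - (pi / 2 * (w \<bullet> w)) + pi * (w \<bullet> b)"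
        by simp
      have 3: "Re (- of_real (pi * (x \<bullet> x)) - 2 * pi * cdot (cvec x) (cnj_vec y) + pi / 2 * cdot (s x) (s x))
        = - (pi * (x \<bullet> x)) - 2 * pi * (x \<bullet> q) + pi / 2 * ((x + (p + q)) \<bullet> (x + (p + q)) - b \<bullet> b)"
        by (simp add: Re_cdot_cvec Re_cdot_self 1 re_im_vec_simps q_def)
      have a: "a = p - q" by (simp add: a_def p_def q_def)
      have "(- (pi * (x \<bullet> x)) - 2 * pi * (x \<bullet> q) + pi / 2 * ((x + (p + q)) \<bullet> (x + (p + q)) - b \<bullet> b))
          + (- (pi / 2 * (w \<bullet> w)) + pi * (w \<bullet> b)) + (- pi * (x \<bullet> x + w \<bullet> w) / 2)
         = (pi * (p \<bullet> p + q \<bullet> q) - pi / 4 * (a \<bullet> a + b \<bullet> b)) +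
           (- pi * ((x - a /\<^sub>R 2) \<bullet> (x - a /\<^sub>R 2)) + - pi * ((w - b /\<^sub>R 2) \<bullet> (w - b /\<^sub>R 2)))"
        by (simp add: a inner_simps inner_commute field_simps)
      then show ?thesis
        unfolding e_def norm_exp_eq_Re 2 3 \<rho>_def exp_add[symmetric] by (rule arg_cong)
    qed
    have powr_le: "(1 + norm (x, w)) powr N \<le> 2 powr M * (1 + norm (z - y)) powr N * ((1 + norm (x - a /\<^sub>R 2)) powr M * (1 + norm (w - b /\<^sub>R 2)) powr M)" for x w
    proof -
      define m where "m = (a /\<^sub>R 2, b /\<^sub>R 2)"
      have nm: "norm m = norm (z - y) / 2"
      proof -
        have "m = (1 / 2) *\<^sub>R (a, b)" by (simp add: m_def)
        then show ?thesis by (simp only: norm_scaleR nab)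
      qed
      have "(1 + norm m) powr N \<le> 2 powr M * (1 + norm (z - y)) powr N"
      proof (cases "N \<ge> 0")
        case True
        have "(1 + norm m) powr N \<le> 1 * (1 + norm (z - y)) powr N" using True by (simp add: nm powr_mono2)
        also have "\<dots> \<le> 2 powr M * (1 + norm (z - y)) powr N" by (intro mult_right_mono) (auto simp: M_def ge_one_powr_ge_zero)
        finally show ?thesis .
      next
        case False
        \<comment> \<open>For N < 0, replacing half of the norm by the full norm costs
          \<open>2 powr (- N)\<close>. This is the origin of \<open>2 powr M\<close> in B.\<close>
        have "(1 + norm m) powr N \<le> ((1 + norm (z - y)) / 2) powr N" unfolding nm using False
          by (intro powr_mono2') (auto intro: add_pos_nonneg)
        also have "\<dots> = 2 powr M * (1 + norm (z - y)) powr N" using False by (simp add: M_def powr_divide powr_minus_divide)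
        finally show ?thesis .
      qed
      moreover have "(1 + norm ((x, w) - m)) powr M \<le> (1 + norm (x - a /\<^sub>R 2)) powr M * (1 + norm (w - b /\<^sub>R 2)) powr M"
      proof -
        have "norm ((x, w) - m) \<le> norm (x - a /\<^sub>R 2) + norm (w - b /\<^sub>R 2)"
          unfolding m_def using norm_Pair_le[of "x - a /\<^sub>R 2" "w - b /\<^sub>R 2"] by simp
        moreover have "1 + r \<le> (1 + A) * (1 + B)" if "r \<le> A + B" "A \<ge> 0" "B \<ge> 0" for r A B :: real
          using that(1) mult_nonneg_nonneg[OF that(2,3)] by (simp add: algebra_simps)
        ultimately have "1 + norm ((x, w) - m) \<le> (1 + norm (x - a /\<^sub>R 2)) * (1 + norm (w - b /\<^sub>R 2))"
          using norm_ge_zero by blast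
        then have "(1 + norm ((x, w) - m)) powr M \<le> ((1 + norm (x - a /\<^sub>R 2)) * (1 + norm (w - b /\<^sub>R 2))) powr M"
          by (intro powr_mono2) (auto simp: M_def)
        then show ?thesis by (simp add: powr_mult)
      qed
      ultimately show ?thesis
        using order_trans[OF peetre[of "(x, w)" N m] mult_mono] unfolding M_def by auto
    qed
    have Abound: "AE x in lborel. cmod (A x) \<le> D * \<rho> * I * h (x - a /\<^sub>R 2)"
      using decay
    proof eventually_elim
      case (elim x)
      define c where "c = exp (- of_real (pi * (x \<bullet> x)) - 2 * pi * cdot (cvec x) (cnj_vec y) + pi / 2 * cdot (s x) (s x))"
      have "AE w in lborel. cmod (c * (e (s x) w * stft G F x w)) \<le> D * \<rho> * h (x - a /\<^sub>R 2) * h (w - b /\<^sub>R 2)"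
        using elim
      proof eventually_elim
        case (elim w)
        have "cmod (c * (e (s x) w * stft G F x w)) = cmod c * cmod (e (s x) w) * cmod (stft G F x w)"
          by (simp add: norm_mult)
        also have "\<dots> \<le> cmod c * cmod (e (s x) w) * (C * (1 + norm (x, w)) powr N * exp (- pi * (x \<bullet> x + w \<bullet> w) / 2))"
          by (intro mult_left_mono elim) auto
        also have "\<dots> = C * (1 + norm (x, w)) powr N * (cmod c * cmod (e (s x) w) * exp (- pi * (x \<bullet> x + w \<bullet> w) / 2))"
          by (simp only: mult_ac)
        also have "\<dots> = C * (1 + norm (x, w)) powr N * (\<rho> * (exp (- pi * ((x - a /\<^sub>R 2) \<bullet> (x - a /\<^sub>R 2))) * exp (- pi * ((w - b /\<^sub>R 2) \<bullet> (w - b /\<^sub>R 2)))))"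
          unfolding c_def norm_e ..
        also have "\<dots> \<le> C * (2 powr M * (1 + norm (z - y)) powr N * ((1 + norm (x - a /\<^sub>R 2)) powr M * (1 + norm (w - b /\<^sub>R 2)) powr M))
           * (\<rho> * (exp (- pi * ((x - a /\<^sub>R 2) \<bullet> (x - a /\<^sub>R 2))) * exp (- pi * ((w - b /\<^sub>R 2) \<bullet> (w - b /\<^sub>R 2)))))"
          by (intro mult_right_mono mult_left_mono powr_le C) (auto simp: \<rho>_def)
        also have "\<dots> = D * \<rho> * h (x - a /\<^sub>R 2) * h (w - b /\<^sub>R 2)"
          by (simp only: D_def h_def mult_ac)
        finally show ?case .
      qed
      moreover have "integrable lborel (\<lambda>w. D * \<rho> * h (x - a /\<^sub>R 2) * h (w - b /\<^sub>R 2))"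
        using integrable_lborel_shift[OF h, of "- (b /\<^sub>R 2)"] by simp
      moreover have "integrable lborel (\<lambda>w. c * (e (s x) w * stft G F x w))" using A(4)[of x] by simp
      ultimately have "cmod (\<integral>w. c * (e (s x) w * stft G F x w) \<partial>lborel) \<le> (\<integral>w. D * \<rho> * h (x - a /\<^sub>R 2) * h (w - b /\<^sub>R 2) \<partial>lborel)"
        by (intro integral_norm_bound_AE)
      also have "\<dots> = D * \<rho> * h (x - a /\<^sub>R 2) * I"
        using integral_lborel_shift[of h "- (b /\<^sub>R 2)"] by (simp add: I_def)
      finally have le: "cmod (\<integral>w. c * (e (s x) w * stft G F x w) \<partial>lborel) \<le> D * \<rho> * h (x - a /\<^sub>R 2) * I" .
      have "A x = (\<integral>w. c * (e (s x) w * stft G F x w) \<partial>lborel) / of_real (sqrt 2 ^ CARD('k))"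
        unfolding A(3) c_def by simp
      then have "cmod (A x) = cmod (\<integral>w. c * (e (s x) w * stft G F x w) \<partial>lborel) / sqrt 2 ^ CARD('k)"
        by (simp add: norm_divide norm_power)
      also have "\<dots> \<le> cmod (\<integral>w. c * (e (s x) w * stft G F x w) \<partial>lborel)"
        using divide_left_mono[OF one_le_power[of "sqrt 2" "CARD('k)"] norm_ge_zero] by simp
      also note le
      finally show ?case by (simp add: mult_ac)
    qed
    have "cmod (bargmann F z * bargmann G y) = cmod (\<integral>x. A x \<partial>lborel)"
      unfolding A(2)[symmetric] by (simp add: norm_mult)
    also have "\<dots> \<le> (\<integral>x. D * \<rho> * I * h (x - a /\<^sub>R 2) \<partial>lborel)"
      using Abound A(1) integrable_lborel_shift[OF h, of "- (a /\<^sub>R 2)"] by (intro integral_norm_bound_AE) auto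
    also have "\<dots> = D * \<rho> * I * I"
      using integral_lborel_shift[of h "- (a /\<^sub>R 2)"] by (simp add: I_def)
    also have "\<dots> = B * (1 + norm (z - y)) powr N * \<rho>" by (simp add: B_def D_def)
    finally show ?thesis unfolding \<rho>_def nab p_def q_def .
  qed
  ultimately show thesis by (rule that)
qed

section \<open>Polynomials in several variables\<close>

text \<open>The predicate minimised by \<open>total_deg\<close>; being an upper bound on the degree,
  it is stable under the algebra of polynomials.\<close>

definition poly_upto :: "nat \<Rightarrow> (real ^ 'k \<Rightarrow> complex) \<Rightarrow> bool" where
  "poly_upto n P \<longleftrightarrow> (\<exists>a. \<forall>x. P x = (\<Sum>m\<in>{m. (\<Sum>i\<in>UNIV. m i) \<le> n}. a m * monomial_fun m x))"

lemma total_deg_le: "poly_upto n P \<Longrightarrow> total_deg P \<le> n"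
  unfolding total_deg_def poly_upto_def by (rule Least_le)

lemma finite_multiindices: "finite {m :: 'k::finite \<Rightarrow> nat. (\<Sum>i\<in>UNIV. m i) \<le> n}"
proof (rule finite_subset)
  show "{m :: 'k \<Rightarrow> nat. (\<Sum>i\<in>UNIV. m i) \<le> n} \<subseteq> PiE UNIV (\<lambda>_. {..n})"
  proof safe
    fix m :: "'k \<Rightarrow> nat" and i assume "(\<Sum>i\<in>UNIV. m i) \<le> n"
    then show "m i \<le> n" using member_le_sum[of i UNIV m] by simp
  qed auto
qed (auto intro: finite_PiE)

text \<open>Different summands may carry the same exponent; their coefficients are
  collected.\<close>

lemma poly_upto_sumI:
  assumes "finite S" and "\<And>s. s \<in> S \<Longrightarrow> (\<Sum>i\<in>UNIV. e s i) \<le> n"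
    and P: "\<And>x. P x = (\<Sum>s\<in>S. c s * monomial_fun (e s) x)"
  shows "poly_upto n P"
  unfolding poly_upto_def
proof (intro exI allI)
  fix x
  have "P x = (\<Sum>m\<in>{m. (\<Sum>i\<in>UNIV. m i) \<le> n}. \<Sum>s\<in>{s \<in> S. e s = m}. c s * monomial_fun (e s) x)"
    unfolding P using assms(1,2) finite_multiindices[of n]
    by (intro sum.group[symmetric]) auto
  also have "\<dots> = (\<Sum>m\<in>{m. (\<Sum>i\<in>UNIV. m i) \<le> n}. (\<Sum>s\<in>{s \<in> S. e s = m}. c s) * monomial_fun m x)"
    unfolding sum_distrib_right by (intro sum.cong refl) auto
  finally show "P x = (\<Sum>m\<in>{m. (\<Sum>i\<in>UNIV. m i) \<le> n}. (\<Sum>s\<in>{s \<in> S. e s = m}. c s) * monomial_fun m x)" .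
qed

lemma monomial_fun_0 [simp]: "monomial_fun (\<lambda>_. 0) x = 1"
  by (simp add: monomial_fun_def)

lemma monomial_fun_add: "monomial_fun (\<lambda>i. m i + l i) x = monomial_fun m x * monomial_fun l x"
  by (simp add: monomial_fun_def power_add prod.distrib)

lemma monomial_fun_scale: "monomial_fun m (r *\<^sub>R x) = of_real r ^ (\<Sum>i\<in>UNIV. m i) * monomial_fun m x"
  by (simp add: monomial_fun_def power_mult_distrib prod.distrib power_sum)

lemma poly_upto_const: "poly_upto 0 (\<lambda>_. c)"
  by (rule poly_upto_sumI[of "{()}" "\<lambda>_ _. 0" _ _ "\<lambda>_. c"]) auto

lemma poly_upto_coord: "poly_upto 1 (\<lambda>x. of_real (x $ i))"
proof (rule poly_upto_sumI[of "{()}" "\<lambda>_ j. if j = i then 1 else 0" _ _ "\<lambda>_. 1"])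
  show "of_real (x $ i) = (\<Sum>s\<in>{()}. 1 * monomial_fun (\<lambda>j. if j = i then 1 else 0) x)" for x
  proof -
    have "(\<Prod>j\<in>UNIV. complex_of_real (x $ j) ^ (if j = i then 1 else 0)) = (\<Prod>j\<in>UNIV. if j = i then of_real (x $ j) else 1)"
      by (rule prod.cong) auto
    also have "\<dots> = of_real (x $ i)" by simp
    finally show ?thesis by (simp add: monomial_fun_def)
  qed
qed auto

lemma poly_upto_add:
  assumes "poly_upto n P" "poly_upto m Q"
  shows "poly_upto (max n m) (\<lambda>x. P x + Q x)"
proof -
  from assms obtain a b where
    a: "\<And>x. P x = (\<Sum>l\<in>{l. (\<Sum>i\<in>UNIV. l i) \<le> n}. a l * monomial_fun l x)" and
    b: "\<And>x. Q x = (\<Sum>l\<in>{l. (\<Sum>i\<in>UNIV. l i) \<le> m}. b l * monomial_fun l x)"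
    unfolding poly_upto_def by blast
  show ?thesis
  proof (rule poly_upto_sumI[of "{l. (\<Sum>i\<in>UNIV. l i) \<le> n} <+> {l. (\<Sum>i\<in>UNIV. l i) \<le> m}" "case_sum id id" _ _ "case_sum a b"])
    show "P x + Q x = (\<Sum>s\<in>{l. sum l UNIV \<le> n} <+> {l. sum l UNIV \<le> m}. case_sum a b s * monomial_fun (case_sum id id s) x)" for x
      by (subst sum.Plus) (auto simp: finite_multiindices a b)
  qed (auto simp: finite_multiindices)
qed

lemma poly_upto_mult:
  assumes "poly_upto n P" "poly_upto m Q"
  shows "poly_upto (n + m) (\<lambda>x. P x * Q x)"
proof -
  from assms obtain a b where
    a: "\<And>x. P x = (\<Sum>l\<in>{l. (\<Sum>i\<in>UNIV. l i) \<le> n}. a l * monomial_fun l x)" and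
    b: "\<And>x. Q x = (\<Sum>l\<in>{l. (\<Sum>i\<in>UNIV. l i) \<le> m}. b l * monomial_fun l x)"
    unfolding poly_upto_def by blast
  show ?thesis
  proof (rule poly_upto_sumI[of "{l. (\<Sum>i\<in>UNIV. l i) \<le> n} \<times> {l. (\<Sum>i\<in>UNIV. l i) \<le> m}" "\<lambda>(k, l) i. k i + l i" _ _ "\<lambda>(k, l). a k * b l"])
    show "P x * Q x = (\<Sum>s\<in>{l. sum l UNIV \<le> n} \<times> {l. sum l UNIV \<le> m}. (case s of (k, l) \<Rightarrow> a k * b l) * monomial_fun (case s of (k, l) \<Rightarrow> \<lambda>i. k i + l i) x)" for x
      by (simp add: a b sum_product sum.cartesian_product monomial_fun_add case_prod_unfold mult_ac)
  qed (auto simp: finite_multiindices sum.distrib add_mono)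
qed

definition is_poly :: "(real ^ 'k \<Rightarrow> complex) \<Rightarrow> bool" where
  "is_poly P \<longleftrightarrow> (\<exists>n. poly_upto n P)"

lemma is_poly_const [simp]: "is_poly (\<lambda>_. c)"
  and is_poly_coord [simp]: "is_poly (\<lambda>x. of_real (x $ i))"
  and is_poly_add: "is_poly P \<Longrightarrow> is_poly Q \<Longrightarrow> is_poly (\<lambda>x. P x + Q x)"
  and is_poly_mult: "is_poly P \<Longrightarrow> is_poly Q \<Longrightarrow> is_poly (\<lambda>x. P x * Q x)"
  unfolding is_poly_def
  using poly_upto_const poly_upto_coord poly_upto_add poly_upto_mult by blast+

lemma is_poly_sum: "(\<And>s. s \<in> S \<Longrightarrow> is_poly (f s)) \<Longrightarrow> is_poly (\<lambda>x. \<Sum>s\<in>S. f s x)"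
  by (induction S rule: infinite_finite_induct) (auto intro: is_poly_add)

lemma is_poly_prod: "(\<And>s. s \<in> S \<Longrightarrow> is_poly (f s)) \<Longrightarrow> is_poly (\<lambda>x. \<Prod>s\<in>S. f s x)"
  by (induction S rule: infinite_finite_induct) (auto intro: is_poly_mult)

lemma is_poly_power: "is_poly P \<Longrightarrow> is_poly (\<lambda>x. P x ^ n)"
  by (induction n) (auto intro: is_poly_mult)

lemma is_poly_poly_coord: "is_poly (\<lambda>x. poly p (of_real (x $ i)))"
  unfolding poly_altdef by (intro is_poly_sum is_poly_mult is_poly_const is_poly_power is_poly_coord)

lemma poly_line:
  assumes "is_poly P"
  shows "\<exists>p. \<forall>r. P (x + r *\<^sub>R v) = poly p (of_real r)"
proof -
  from assms obtain n a where a: "\<And>x. P x = (\<Sum>m\<in>{m. (\<Sum>i\<in>UNIV. m i) \<le> n}. a m * monomial_fun m x)"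
    unfolding is_poly_def poly_upto_def by blast
  define p where "p = (\<Sum>m\<in>{m. (\<Sum>i\<in>UNIV. m i) \<le> n}. smult (a m) (\<Prod>i\<in>UNIV. [:of_real (x $ i), of_real (v $ i):] ^ m i))"
  have "P (x + r *\<^sub>R v) = poly p (of_real r)" for r
    by (simp add: a p_def poly_sum poly_prod poly_power monomial_fun_def mult.commute)
  then show ?thesis by blast
qed

lemma continuous_on_is_poly:
  assumes "is_poly P"
  shows "continuous_on S P"
proof -
  from assms obtain n a where "P = (\<lambda>x. \<Sum>m\<in>{m. (\<Sum>i\<in>UNIV. m i) \<le> n}. a m * monomial_fun m x)"
    unfolding is_poly_def poly_upto_def by blast
  then show ?thesis unfolding monomial_fun_def by (auto intro!: continuous_intros)
qed

text \<open>The order of quantifiers is the point: L is independent of p, so the values at the nodes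
  0, ..., n are the only data and may depend on further variables.\<close>

lemma lagrange_interpolation:
  "\<exists>L :: nat \<Rightarrow> complex poly. \<forall>p. degree p \<le> n \<longrightarrow> p = (\<Sum>j\<le>n. smult (poly p (of_nat j)) (L j))"
proof -
  define L where "L j = (\<Prod>l\<in>{..n} - {j}. smult (1 / (of_nat j - of_nat l)) [:- of_nat l, 1 :: complex:])" for j
  have deg: "degree (L j) \<le> n" if "j \<le> n" for j
  proof -
    have "degree (L j) \<le> (\<Sum>l\<in>{..n} - {j}. degree (smult (1 / (of_nat j - of_nat l)) [:- of_nat l, 1 :: complex:]))"
      unfolding L_def by (rule order_trans[OF degree_prod_sum_le]) auto
    also have "\<dots> \<le> (\<Sum>l\<in>{..n} - {j}. 1)" by (intro sum_mono) auto
    also have "\<dots> = n" using that by simp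
    finally show ?thesis .
  qed
  have eval: "poly (L j) (of_nat i) = (if i = j then 1 else 0)" if "i \<le> n" "j \<le> n" for i j
  proof (cases "i = j")
    case True
    have "poly (smult (1 / (a - b)) [:- b, 1:]) a = 1" if "a \<noteq> b" for a b :: complex
      using that by (simp flip: diff_divide_distrib)
    then have "poly (smult (1 / (of_nat j - of_nat l)) [:- of_nat l, 1 :: complex:]) (of_nat j) = 1" if "l \<noteq> j" for l
      using that by (metis of_nat_eq_iff)
    then show ?thesis using True by (simp only: L_def poly_prod) (auto intro!: prod.neutral)
  next
    case False
    then have "\<exists>l\<in>{..n} - {j}. poly (smult (1 / (of_nat j - of_nat l)) [:- of_nat l, 1 :: complex:]) (of_nat i) = 0"
      using that by (intro bexI[of _ i]) auto
    then show ?thesis using False by (simp add: L_def poly_prod prod_zero_iff)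
  qed
  have "p = (\<Sum>j\<le>n. smult (poly p (of_nat j)) (L j))" if "degree p \<le> n" for p
  proof (rule poly_eqI_degree[where A = "of_nat ` {..n}"])
    fix x :: complex assume "x \<in> of_nat ` {..n}"
    then obtain i where "i \<le> n" "x = of_nat i" by auto
    then show "poly p x = poly (\<Sum>j\<le>n. smult (poly p (of_nat j)) (L j)) x"
      by (simp add: poly_sum eval if_distrib[of "\<lambda>x. _ * x"] cong: if_cong)
  next
    have card: "card (of_nat ` {..n} :: complex set) = Suc n" by (simp add: card_image inj_on_def)
    show "degree p < card (of_nat ` {..n} :: complex set)" using card that by simp
    have "degree (\<Sum>j\<le>n. smult (poly p (of_nat j)) (L j)) \<le> n"
      by (intro degree_sum_le) (auto intro: order_trans[OF degree_smult_le] deg)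
    then show "degree (\<Sum>j\<le>n. smult (poly p (of_nat j)) (L j)) < card (of_nat ` {..n} :: complex set)"
      using card by simp
  qed
  then show ?thesis by blast
qed

text \<open>Induction over the coordinates on which \<open>f\<close> depends, interpolating in one of them at a time.\<close>

lemma separately_poly_imp_is_poly:
  fixes f :: "real ^ 'k \<Rightarrow> complex"
  assumes "\<And>x i. \<exists>p. degree p \<le> n \<and> (\<forall>r. f (x + r *\<^sub>R axis i 1) = poly p (of_real r))"
  shows "is_poly f"
proof -
  have "is_poly f" if "finite S"
    "\<And>x i. i \<in> S \<Longrightarrow> \<exists>p. degree p \<le> n \<and> (\<forall>r. f (x + r *\<^sub>R axis i 1) = poly p (of_real r))"
    "\<And>x y. (\<And>i. i \<in> S \<Longrightarrow> x $ i = y $ i) \<Longrightarrow> f x = f y" for S and f :: "real ^ 'k \<Rightarrow> complex"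
    using that
  proof (induction S arbitrary: f rule: finite_induct)
    case empty
    have "f = (\<lambda>_. f 0)" using empty(2) by (intro ext) auto
    then show ?case by (metis is_poly_const)
  next
    case (insert a S)
    obtain L :: "nat \<Rightarrow> complex poly" where L: "\<And>p. degree p \<le> n \<Longrightarrow> p = (\<Sum>j\<le>n. smult (poly p (of_nat j)) (L j))"
      using lagrange_interpolation[of n] by blast
    \<comment> \<open>Freezing coordinate a at a node produces a function that no longer depends on
      that coordinate, to which the induction hypothesis applies.\<close>
    define set where "set x r = (\<chi> i. if i = a then r else x $ i)" for x :: "real ^ 'k" and r
    have f_eq: "f x = (\<Sum>j\<le>n. f (set x (real j)) * poly (L j) (of_real (x $ a)))" for x
    proof -
      obtain p where p: "degree p \<le> n" "\<And>r. f (set x 0 + r *\<^sub>R axis a 1) = poly p (of_real r)"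
        using insert.prems(1)[of a "set x 0"] by auto
      have s: "set x 0 + r *\<^sub>R axis a 1 = set x r" for r
        by (auto simp: set_def vec_eq_iff axis_def)
      have "f x = f (set x (x $ a))" by (rule insert.prems(2)) (auto simp: set_def)
      also have "\<dots> = poly p (of_real (x $ a))" using p(2) s by metis
      also have "\<dots> = (\<Sum>j\<le>n. poly p (of_nat j) * poly (L j) (of_real (x $ a)))"
        by (subst L[OF p(1)]) (simp add: poly_sum)
      also have "\<dots> = (\<Sum>j\<le>n. f (set x (real j)) * poly (L j) (of_real (x $ a)))"
      proof (rule sum.cong[OF refl])
        fix j
        have "f (set x (real j)) = poly p (of_nat j)" using p(2)[of "real j"] unfolding s by simp
        then show "poly p (of_nat j) * poly (L j) (of_real (x $ a)) = f (set x (real j)) * poly (L j) (of_real (x $ a))" by simp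
      qed
      finally show ?thesis .
    qed
    have "is_poly (\<lambda>x. f (set x (real j)))" for j
    proof (rule insert.IH)
      fix x i assume i: "i \<in> S"
      then have "i \<noteq> a" using insert.hyps by auto
      then have "set (x + r *\<^sub>R axis i 1) (real j) = set x (real j) + r *\<^sub>R axis i 1" for r
        by (auto simp: set_def vec_eq_iff axis_def)
      then show "\<exists>p. degree p \<le> n \<and> (\<forall>r. f (set (x + r *\<^sub>R axis i 1) (real j)) = poly p (of_real r))"
        using insert.prems(1)[of i "set x (real j)"] i by simp
    next
      fix x y :: "real ^ 'k" assume "\<And>i. i \<in> S \<Longrightarrow> x $ i = y $ i"
      then show "f (set x (real j)) = f (set y (real j))"
        by (intro insert.prems(2)) (auto simp: set_def)
    qed
    then have "is_poly (\<lambda>x. \<Sum>j\<le>n. f (set x (real j)) * poly (L j) (of_real (x $ a)))"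
      by (intro is_poly_sum is_poly_mult is_poly_poly_coord)
    moreover have "(\<lambda>x. \<Sum>j\<le>n. f (set x (real j)) * poly (L j) (of_real (x $ a))) = f"
      using f_eq[symmetric] by (rule ext)
    ultimately show ?case by (simp only:)
  qed
  from this[of UNIV f] show ?thesis using assms by (metis UNIV_I finite vec_eq_iff)
qed

text \<open>Here h is the homogeneous part of top degree n, with n chosen minimal, and h v is the
  coefficient of r^n on the line through 0 in direction v. The degree is thus visible on every line
  in a direction where h is nonzero.\<close>

lemma is_poly_top_degree:
  assumes "is_poly P" "P x0 \<noteq> 0"
  obtains n h v0 where "poly_upto n P" "is_poly h" "h v0 \<noteq> 0"
    "\<And>v. h v \<noteq> 0 \<Longrightarrow> \<exists>p. p \<noteq> 0 \<and> degree p = n \<and> (\<forall>r. P (r *\<^sub>R v) = poly p (of_real r))"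
proof -
  define n where "n = (LEAST n. poly_upto n P)"
  have n: "poly_upto n P" unfolding n_def using assms(1) by (metis LeastI_ex is_poly_def)
  then obtain a where a: "\<And>x. P x = (\<Sum>m\<in>{m. (\<Sum>i\<in>UNIV. m i) \<le> n}. a m * monomial_fun m x)"
    unfolding poly_upto_def by blast
  define h where "h j x = (\<Sum>m\<in>{m. (\<Sum>i\<in>UNIV. m i) = j}. a m * monomial_fun m x)" for j x
  have fin: "finite {m :: 'a \<Rightarrow> nat. (\<Sum>i\<in>UNIV. m i) = j}" for j
    by (rule finite_subset[OF _ finite_multiindices[of j]]) auto
  have P: "P (r *\<^sub>R v) = (\<Sum>j\<le>n. h j v * of_real r ^ j)" for r v
  proof -
    have "P (r *\<^sub>R v) = (\<Sum>m\<in>{m. (\<Sum>i\<in>UNIV. m i) \<le> n}. a m * monomial_fun m v * of_real r ^ (\<Sum>i\<in>UNIV. m i))"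
      unfolding a monomial_fun_scale by (simp add: mult_ac)
    also have "\<dots> = (\<Sum>j\<le>n. \<Sum>m\<in>{m \<in> {m. (\<Sum>i\<in>UNIV. m i) \<le> n}. (\<Sum>i\<in>UNIV. m i) = j}. a m * monomial_fun m v * of_real r ^ (\<Sum>i\<in>UNIV. m i))"
      using finite_multiindices by (intro sum.group[symmetric]) auto
    also have "\<dots> = (\<Sum>j\<le>n. h j v * of_real r ^ j)"
      unfolding h_def sum_distrib_right by (intro sum.cong) auto
    finally show ?thesis .
  qed
  have "\<exists>v. h n v \<noteq> 0"
  proof (rule ccontr)
    assume "\<not> ?thesis"
    then have hn: "h n v = 0" for v by blast
    show False
    \<comment> \<open>For n = 0 minimality gives nothing, and the assumption that P is not
      identically zero takes its place.\<close>
    proof (cases n)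
      case 0
      then show False using P[of 1 x0] hn assms(2) by simp
    next
      case (Suc k)
      have "poly_upto k P"
      proof (rule poly_upto_sumI[OF finite_multiindices[of k], of "\<lambda>m. m" _ _ a])
        fix x
        have "{m :: 'a \<Rightarrow> nat. (\<Sum>i\<in>UNIV. m i) \<le> n} = {m. (\<Sum>i\<in>UNIV. m i) \<le> k} \<union> {m. (\<Sum>i\<in>UNIV. m i) = n}"
          using Suc by auto
        then have "P x = (\<Sum>m\<in>{m. (\<Sum>i\<in>UNIV. m i) \<le> k}. a m * monomial_fun m x) + h n x"
          unfolding a h_def using fin finite_multiindices Suc by (subst sum.union_disjoint[symmetric]) auto
        then show "P x = (\<Sum>m\<in>{m. (\<Sum>i\<in>UNIV. m i) \<le> k}. a m * monomial_fun m x)" using hn by simp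
      qed auto
      then have "n \<le> k" unfolding n_def by (rule Least_le)
      then show False using Suc by simp
    qed
  qed
  then obtain v0 where v0: "h n v0 \<noteq> 0" by blast
  show thesis
  proof
    show "poly_upto n P" by fact
    show "is_poly (h n)"
      unfolding h_def[abs_def] monomial_fun_def
      by (intro is_poly_sum is_poly_mult is_poly_const is_poly_prod is_poly_power is_poly_coord)
    show "h n v0 \<noteq> 0" by fact
    fix v assume hv: "h n v \<noteq> 0"
    define p where "p = (\<Sum>j\<le>n. monom (h j v) j)"
    have cn: "coeff p n \<noteq> 0" using hv by (simp add: p_def coeff_sum)
    then have "p \<noteq> 0" by auto
    moreover have "degree p \<le> n" unfolding p_def by (intro degree_sum_le) (auto intro: order_trans[OF degree_monom_le])
    then have "degree p = n" using cn by (simp add: le_antisym le_degree)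
    moreover have "P (r *\<^sub>R v) = poly p (of_real r)" for r by (simp add: P p_def poly_sum poly_monom)
    ultimately show "\<exists>p. p \<noteq> 0 \<and> degree p = n \<and> (\<forall>r. P (r *\<^sub>R v) = poly p (of_real r))" by blast
  qed
qed

lemma poly_nonzero_real:
  fixes p :: "complex poly"
  assumes "p \<noteq> 0"
  obtains r :: real where "poly p (of_real r) \<noteq> 0"
proof -
  have "finite {x. poly p x = 0}" by (rule poly_roots_finite[OF assms])
  moreover have "infinite (range complex_of_real)" by (simp add: finite_image_iff inj_on_def infinite_UNIV_char_0)
  ultimately obtain x where "x \<in> range complex_of_real" "poly p x \<noteq> 0"
    by (metis (mono_tags, lifting) mem_Collect_eq rev_finite_subset subsetI)
  then show thesis using that by auto
qed

text \<open>On the line through v and w both restrictions are nonzero polynomials in one variable,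
  hence so is their product.\<close>

lemma is_poly_common_nonzero:
  assumes "is_poly P" "is_poly Q" "P v \<noteq> 0" "Q w \<noteq> 0"
  obtains x where "P x \<noteq> 0" "Q x \<noteq> 0"
proof -
  obtain p q where p: "\<And>r. P (v + r *\<^sub>R (w - v)) = poly p (of_real r)" and q: "\<And>r. Q (v + r *\<^sub>R (w - v)) = poly q (of_real r)"
    using poly_line[OF assms(1)] poly_line[OF assms(2)] by metis
  have "p \<noteq> 0" using p[of 0] assms(3) by auto
  moreover have "q \<noteq> 0" using q[of 1] assms(4) by auto
  ultimately obtain r where "poly (p * q) (complex_of_real r) \<noteq> 0" by (metis no_zero_divisors poly_nonzero_real)
  then show thesis using that[of "v + r *\<^sub>R (w - v)"] p q by auto
qed

section \<open>Exponential polynomials along lines\<close>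

text \<open>The exponent belongs to the direction v and not to the line: each line of one function
  can be paired with a fixed line of the other, whose exponent is unique. The exponents of the
  coordinate directions form the vector c, and after division by exp (c t) both functions are
  polynomials of bounded degree in each coordinate. Since \<psi> is followed backwards, its
  exponents - c on the lines belong to the same factor exp (c t).\<close>

lemma exponential_poly_from_lines:
  fixes \<phi> \<psi> :: "real ^ 'k \<Rightarrow> complex"
  assumes lines: "\<And>s t v r r'. \<phi> (s + r *\<^sub>R v) \<noteq> 0 \<Longrightarrow> \<psi> (t - r' *\<^sub>R v) \<noteq> 0 \<Longrightarrow>
      \<exists>(c :: complex) (p :: complex poly) (q :: complex poly). p \<noteq> 0 \<and> q \<noteq> 0 \<and> real (degree p + degree q) \<le> N \<and>
        (\<forall>r::real. \<phi> (s + r *\<^sub>R v) = poly p (of_real r) * exp (c * r)) \<and>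
        (\<forall>r::real. \<psi> (t - r *\<^sub>R v) = poly q (of_real r) * exp (- c * r))"
    and nz: "\<phi> s0 \<noteq> 0" "\<psi> t0 \<noteq> 0"
  obtains c n m p q where "real (n + m) \<le> N" "poly_upto n p" "poly_upto m q"
    "\<And>t. \<phi> t = p t * exp (cdot (cvec t) c)" "\<And>t. \<psi> t = q t * exp (cdot (cvec t) c)"
proof -
  \<comment> \<open>Both degrees are at most N, hence at most its integer part; this uniform bound
    is what interpolation needs.\<close>
  define D where "D = nat \<lfloor>N\<rfloor>"
  have D: "degree p \<le> D" "degree q \<le> D" if "real (degree p + degree q) \<le> N" for p q :: "complex poly"
    using that by (auto simp: D_def le_nat_floor)
  \<comment> \<open>Lines on which the function vanishes are included, with the zero polynomial, so
    that the statement covers all lines in direction v.\<close>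
  define P where "P v c \<longleftrightarrow> (\<forall>s. \<exists>p :: complex poly. degree p \<le> D \<and> (\<forall>r::real. \<phi> (s + r *\<^sub>R v) = poly p (of_real r) * exp (c * r))) \<and>
     (\<forall>t. \<exists>q :: complex poly. degree q \<le> D \<and> (\<forall>r::real. \<psi> (t - r *\<^sub>R v) = poly q (of_real r) * exp (- c * r)))" for v and c :: complex
  have "\<exists>c. P v c" for v
  proof -
    from lines[of s0 0 v t0 0] nz obtain c :: complex and p0 q0 :: "complex poly" where c: "p0 \<noteq> 0" "q0 \<noteq> 0"
      "\<And>r::real. \<phi> (s0 + r *\<^sub>R v) = poly p0 (of_real r) * exp (c * r)"
      "\<And>r::real. \<psi> (t0 - r *\<^sub>R v) = poly q0 (of_real r) * exp (- c * r)" by auto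
    have "\<exists>p :: complex poly. degree p \<le> D \<and> (\<forall>r::real. \<phi> (s + r *\<^sub>R v) = poly p (of_real r) * exp (c * r))" for s
    proof (cases "\<exists>r. \<phi> (s + r *\<^sub>R v) \<noteq> 0")
      case True
      then obtain r where "\<phi> (s + r *\<^sub>R v) \<noteq> 0" by blast
      from lines[OF this, of t0 0] nz obtain c' :: complex and p q :: "complex poly" where c': "q \<noteq> 0" "real (degree p + degree q) \<le> N"
        "\<And>r::real. \<phi> (s + r *\<^sub>R v) = poly p (of_real r) * exp (c' * r)"
        "\<And>r::real. \<psi> (t0 - r *\<^sub>R v) = poly q (of_real r) * exp (- c' * r)" by auto
      have "- c = - c'" using exp_poly_unique[OF c(2), of "- c" q "- c'"] c(4) c'(4) by metis
      then show ?thesis using c' D(1)[OF c'(2)] by (intro exI[of _ p]) auto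
    next
      case False
      then show ?thesis by (intro exI[of _ 0]) auto
    qed
    moreover have "\<exists>q :: complex poly. degree q \<le> D \<and> (\<forall>r::real. \<psi> (t - r *\<^sub>R v) = poly q (of_real r) * exp (- c * r))" for t
    proof (cases "\<exists>r. \<psi> (t - r *\<^sub>R v) \<noteq> 0")
      case True
      then obtain r where r: "\<psi> (t - r *\<^sub>R v) \<noteq> 0" by blast
      have "\<phi> (s0 + 0 *\<^sub>R v) \<noteq> 0" using nz by simp
      from lines[OF this r] obtain c' :: complex and p q :: "complex poly" where c': "p \<noteq> 0" "real (degree p + degree q) \<le> N"
        "\<And>r::real. \<phi> (s0 + r *\<^sub>R v) = poly p (of_real r) * exp (c' * r)"
        "\<And>r::real. \<psi> (t - r *\<^sub>R v) = poly q (of_real r) * exp (- c' * r)" by auto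
      have "c = c'" using exp_poly_unique[OF c(1), of c p c'] c(3) c'(3) by metis
      then show ?thesis using c' D(2)[OF c'(2)] by (intro exI[of _ q]) auto
    next
      case False
      then show ?thesis by (intro exI[of _ 0]) auto
    qed
    ultimately show ?thesis unfolding P_def by blast
  qed
  then obtain C where C: "\<And>v. P v (C v)" by metis
  define c where "c = (\<chi> i. C (axis i 1))"
  have ce: "cdot (cvec (axis i r)) c = of_real r * C (axis i 1)" for i r
  proof -
    have "cdot (cvec (axis i r)) c = (\<Sum>j\<in>UNIV. if j = i then of_real r * c $ j else 0)"
      unfolding cdot_def cvec_def by (intro sum.cong) (auto simp: axis_def)
    then show ?thesis by (simp add: c_def)
  qed
  have cdot_add: "cdot (cvec (x + y)) c = cdot (cvec x) c + cdot (cvec y) c" for x y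
    by (simp add: cdot_def cvec_def ring_distribs sum.distrib)
  have cdot_scale: "cdot (cvec (r *\<^sub>R x)) c = of_real r * cdot (cvec x) c" for r x
    by (simp add: cdot_def cvec_def sum_distrib_left mult.assoc)
  define p q where "p t = \<phi> t * exp (- cdot (cvec t) c)" and "q t = \<psi> t * exp (- cdot (cvec t) c)" for t
  have axis_scale: "r *\<^sub>R axis i 1 = (axis i r :: real ^ 'k)" for i r
    by (auto simp: vec_eq_iff axis_def)
  have p: "is_poly p"
  proof (rule separately_poly_imp_is_poly[of D])
    fix x and i :: 'k
    from C[of "axis i 1"] obtain p' :: "complex poly" where p': "degree p' \<le> D"
       "\<And>r::real. \<phi> (x + r *\<^sub>R axis i 1) = poly p' (of_real r) * exp (C (axis i 1) * r)" unfolding P_def by blast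
    have "p (x + r *\<^sub>R axis i 1) = poly (smult (exp (- cdot (cvec x) c)) p') (of_real r)" for r
      by (simp add: p_def p'(2)[unfolded axis_scale] cdot_add axis_scale ce exp_diff exp_minus field_simps)
    moreover have "degree (smult (exp (- cdot (cvec x) c)) p') \<le> D" using p' by simp
    ultimately show "\<exists>p'. degree p' \<le> D \<and> (\<forall>r. p (x + r *\<^sub>R axis i 1) = poly p' (of_real r))" by blast
  qed
  have q: "is_poly q"
  proof (rule separately_poly_imp_is_poly[of D])
    fix x and i :: 'k
    from C[of "axis i 1"] obtain q' :: "complex poly" where q': "degree q' \<le> D"
       "\<And>r::real. \<psi> (x - r *\<^sub>R axis i 1) = poly q' (of_real r) * exp (- C (axis i 1) * r)" unfolding P_def by blast
    have "q (x + r *\<^sub>R axis i 1) = poly (smult (exp (- cdot (cvec x) c)) (pcompose q' [:0, -1:])) (of_real r)" for r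
    proof -
      \<comment> \<open>The lines for \<psi> run backwards, so the variable of the polynomial is
        reflected; this preserves its degree.\<close>
      have eq: "x - axis i (- r) = x + axis i r" by (simp add: axis_def vec_eq_iff)
      show ?thesis
        using q'(2)[of "- r"] unfolding axis_scale eq by (simp add: q_def cdot_add axis_scale ce poly_pcompose exp_diff exp_minus field_simps)
    qed
    moreover have "degree (smult (exp (- cdot (cvec x) c)) (pcompose q' [:0, -1:])) \<le> D" using q' by (simp add: degree_pcompose)
    ultimately show "\<exists>p'. degree p' \<le> D \<and> (\<forall>r. q (x + r *\<^sub>R axis i 1) = poly p' (of_real r))" by blast
  qed
  have \<phi>: "\<phi> t = p t * exp (cdot (cvec t) c)" for t by (simp add: p_def exp_minus)
  have \<psi>: "\<psi> t = q t * exp (cdot (cvec t) c)" for t by (simp add: q_def exp_minus)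
  obtain n h v0 where h: "poly_upto n p" "is_poly h" "h v0 \<noteq> 0"
    "\<And>v. h v \<noteq> 0 \<Longrightarrow> \<exists>p'. p' \<noteq> 0 \<and> degree p' = n \<and> (\<forall>r. p (r *\<^sub>R v) = poly p' (of_real r))"
  proof -
    have "p s0 \<noteq> 0" using nz by (simp add: p_def)
    from is_poly_top_degree[OF p this] that show thesis by metis
  qed
  obtain m k w0 where k: "poly_upto m q" "is_poly k" "k w0 \<noteq> 0"
    "\<And>v. k v \<noteq> 0 \<Longrightarrow> \<exists>p'. p' \<noteq> 0 \<and> degree p' = m \<and> (\<forall>r. q (r *\<^sub>R v) = poly p' (of_real r))"
  proof -
    have "q t0 \<noteq> 0" using nz by (simp add: q_def)
    from is_poly_top_degree[OF q this] that show thesis by metis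
  qed
  have "real (n + m) \<le> N"
  proof -
    \<comment> \<open>In a direction where both top forms are nonzero, the restrictions have the
      full degrees n and m, and the bound for this single pair of lines is the bound on n +
      m.\<close>
    obtain v where v: "h v \<noteq> 0" "k v \<noteq> 0"
      using is_poly_common_nonzero[OF h(2) k(2) h(3) k(3)] by blast
    obtain p' q' :: "complex poly" where p': "p' \<noteq> 0" "degree p' = n" "\<And>r. p (r *\<^sub>R v) = poly p' (of_real r)"
      and q': "q' \<noteq> 0" "degree q' = m" "\<And>r. q (r *\<^sub>R v) = poly q' (of_real r)"
      using h(4)[OF v(1)] k(4)[OF v(2)] by blast
    define q'' where "q'' = pcompose q' [:0, -1:]"
    have q'': "q'' \<noteq> 0" "degree q'' = m" using q' by (simp_all add: q''_def pcompose_eq_0_iff degree_pcompose)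
    define \<kappa> where "\<kappa> = cdot (cvec v) c"
    have \<phi>v: "\<phi> (0 + r *\<^sub>R v) = poly p' (of_real r) * exp (\<kappa> * of_real r)" for r
      by (simp add: \<phi> p'(3) cdot_scale \<kappa>_def mult.commute)
    have \<psi>v: "\<psi> (0 - r *\<^sub>R v) = poly q'' (of_real r) * exp (- \<kappa> * of_real r)" for r
      using \<psi>[of "(- r) *\<^sub>R v"] by (simp only: q'(3) cdot_scale) (simp add: \<kappa>_def q''_def poly_pcompose mult.commute)
    obtain r r' where "poly p' (complex_of_real r) \<noteq> 0" "poly q'' (complex_of_real r') \<noteq> 0"
      using poly_nonzero_real p'(1) q''(1) by metis
    then have "\<phi> (0 + r *\<^sub>R v) \<noteq> 0" "\<psi> (0 - r' *\<^sub>R v) \<noteq> 0" unfolding \<phi>v \<psi>v by auto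
    from lines[OF this] obtain c2 :: complex and p2 q2 :: "complex poly" where c2: "real (degree p2 + degree q2) \<le> N"
      "\<And>r::real. \<phi> (0 + r *\<^sub>R v) = poly p2 (of_real r) * exp (c2 * r)"
      "\<And>r::real. \<psi> (0 - r *\<^sub>R v) = poly q2 (of_real r) * exp (- c2 * r)" by blast
    have "\<kappa> = c2 \<and> p' = p2"
      using exp_poly_unique[OF p'(1), of \<kappa> p2 c2] c2(2) \<phi>v by metis
    moreover have "- \<kappa> = - c2 \<and> q'' = q2"
      using exp_poly_unique[OF q''(1), of "- \<kappa>" q2 "- c2"] c2(3) \<psi>v by metis
    ultimately show ?thesis using c2(1) p'(2) q''(2) by simp
  qed
  then show thesis using that[OF _ h(1) k(1) \<phi> \<psi>] by blast
qed

section \<open>The normalised Bargmann transform on complex lines\<close>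

definition bargmann_normed :: "(real ^ 'k \<Rightarrow> complex) \<Rightarrow> complex ^ 'k \<Rightarrow> complex" where
  "bargmann_normed F z = bargmann F z * exp (- pi / 2 * cdot z z)"

text \<open>With real s and v the parameter \<zeta> enters as exp (\<zeta> q) with a real function
  q, which is the situation of \<open>exp_integral_has_derivative\<close>.\<close>

lemma bargmann_line_holomorphic:
  fixes F :: "real ^ 'k \<Rightarrow> complex"
  assumes F: "L2 lborel F"
  shows "(\<lambda>\<zeta>. bargmann F (cvec s + \<zeta> *s cvec v)) holomorphic_on UNIV"
proof -
  define h where "h t = F t * exp (- of_real (pi * (t \<bullet> t)) + 2 * pi * cdot (cvec t) (cvec s))" for t
  define q where "q t = 2 * pi * (t \<bullet> v)" for t
  have [measurable]: "F \<in> borel_measurable borel" using F by (simp add: L2_def)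
  have [measurable]: "h \<in> borel_measurable borel" "q \<in> borel_measurable borel" unfolding h_def q_def by measurable
  have int: "integrable lborel (\<lambda>t. cmod (h t) * exp (r * \<bar>q t\<bar>))" for r
  proof (rule Bochner_Integration.integrable_bound)
    \<comment> \<open>The estimate exp (r |q|) \<le> exp (r q) + exp (- r q) reduces integrability
      to two Bargmann integrals, at s + r v and s - r v.\<close>
    let ?g = "\<lambda>u t. F t * exp (- of_real (pi * (t \<bullet> t)) + 2 * pi * cdot (cvec t) (cvec (s + u *\<^sub>R v)))"
    show "integrable lborel (\<lambda>t. cmod (?g r t) + cmod (?g (- r) t))"
      by (intro Bochner_Integration.integrable_add integrable_norm bargmann_integrable F)
    have g: "cmod (?g u t) = cmod (h t) * exp (u * q t)" for u t
      by (simp add: h_def q_def norm_mult cdot_simps inner_simps mult_exp_exp algebra_simps)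
    have "cmod (h t) * exp (r * \<bar>q t\<bar>) \<le> cmod (?g r t) + cmod (?g (- r) t)" for t
      unfolding g by (cases "q t \<ge> 0") auto
    then show "AE t in lborel. norm (cmod (h t) * exp (r * \<bar>q t\<bar>)) \<le> norm (cmod (?g r t) + cmod (?g (- r) t))"
      by (intro AE_I2) (simp add: abs_mult)
  qed measurable
  have "((\<lambda>\<zeta>. \<integral>t. h t * exp (\<zeta> * of_real (q t)) \<partial>lborel) has_field_derivative
     (\<integral>t. (h t * of_real (q t)) * exp (\<zeta> * of_real (q t)) \<partial>lborel)) (at \<zeta>)" for \<zeta>
    by (rule exp_integral_has_derivative) (use int in auto)
  moreover have "(\<integral>t. h t * exp (\<zeta> * of_real (q t)) \<partial>lborel) = bargmann F (cvec s + \<zeta> *s cvec v)" for \<zeta>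
    unfolding bargmann_def
    by (intro Bochner_Integration.integral_cong refl)
      (simp add: h_def q_def cdot_simps mult.assoc mult_exp_exp algebra_simps)
  ultimately show ?thesis
    by (auto simp: holomorphic_on_def field_differentiable_def intro: has_field_derivative_at_within)
qed

lemma bargmann_normed_line_holomorphic:
  assumes "L2 lborel F"
  shows "(\<lambda>\<zeta>. bargmann_normed F (cvec s + \<zeta> *s cvec v)) holomorphic_on UNIV"
  unfolding bargmann_normed_def cdot_simps
  by (intro holomorphic_intros bargmann_line_holomorphic assms)

text \<open>The normalising factors turn pi |Re z|^2 into pi |z|^2 / 2, and likewise for y. The
  parallelogram law then gives |z|^2 / 2 + |y|^2 / 2 - |z - y|^2 / 4 = |z + y|^2 / 4.\<close>

lemma bargmann_normed_product_bound:
  fixes F G :: "real ^ 'k \<Rightarrow> complex"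
  assumes "L2 lborel F" "L2 lborel G" "C \<ge> 0"
    and "AE x in lborel. AE w in lborel.
      cmod (stft G F x w) \<le> C * (1 + norm (x, w)) powr N * exp (- pi * (x \<bullet> x + w \<bullet> w) / 2)"
  obtains B where "B \<ge> 0"
    "\<And>z y. cmod (bargmann_normed F z * bargmann_normed G y) \<le> B * (1 + norm (z - y)) powr N * exp (pi / 4 * (norm (z + y))\<^sup>2)"
proof -
  obtain B where B: "B \<ge> 0"
    "\<And>z y. cmod (bargmann F z * bargmann G y) \<le> B * (1 + norm (z - y)) powr N *
       exp (pi * (re_vec z \<bullet> re_vec z + re_vec y \<bullet> re_vec y) - pi / 4 * (norm (z - y))\<^sup>2)"
    using bargmann_product_bound[OF assms] by blast
  have "cmod (bargmann_normed F z * bargmann_normed G y) \<le> B * (1 + norm (z - y)) powr N * exp (pi / 4 * (norm (z + y))\<^sup>2)" for z y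
  proof -
    define a b where "a = - pi / 2 * (re_vec z \<bullet> re_vec z - im_vec z \<bullet> im_vec z)" and "b = - pi / 2 * (re_vec y \<bullet> re_vec y - im_vec y \<bullet> im_vec y)"
    define e where "e = pi * (re_vec z \<bullet> re_vec z + re_vec y \<bullet> re_vec y) - pi / 4 * (norm (z - y))\<^sup>2"
    have "cmod (bargmann_normed F z * bargmann_normed G y) = cmod (bargmann F z * bargmann G y) * (exp a * exp b)"
      by (simp add: bargmann_normed_def norm_mult Re_cdot_self a_def b_def)
    also have "\<dots> \<le> B * (1 + norm (z - y)) powr N * exp e * (exp a * exp b)"
      unfolding e_def by (intro mult_right_mono B(2)) auto
    also have "\<dots> = B * (1 + norm (z - y)) powr N * exp (e + (a + b))"
      by (simp add: exp_add)
    also have "e + (a + b) = pi / 4 * (norm (z + y))\<^sup>2"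
      unfolding norm_cvec_power2 e_def a_def b_def
      by (simp add: re_im_vec_simps inner_simps inner_commute field_simps)
    finally show ?thesis .
  qed
  with B(1) show thesis using that by blast
qed

lemma norm_cvec [simp]: "norm (cvec v) = norm v"
  by (simp add: cvec_def norm_vec_def)

lemma norm_vector_scale [simp]: "norm (c *s v) = cmod c * norm v" for v :: "complex ^ 'k"
  by (simp add: norm_vec_def norm_mult L2_set_right_distrib[symmetric])

text \<open>The two lines are followed in opposite directions, so the sum of the arguments is a
  constant e while their difference is a constant plus 2 \<zeta> v. For N < 0 the weight must be
  bounded through a lower bound on that difference; this is the role of
  \<open>norm v \<ge> 1 / 2\<close>, which makes |2 \<zeta> v| at least |\<zeta>|.\<close>

lemma bargmann_lines:
  fixes F G :: "real ^ 'k \<Rightarrow> complex"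
  assumes F: "L2 lborel F" and G: "L2 lborel G" and C: "C \<ge> 0"
    and decay: "AE x in lborel. AE w in lborel.
      cmod (stft G F x w) \<le> C * (1 + norm (x, w)) powr N * exp (- pi * (x \<bullet> x + w \<bullet> w) / 2)"
    and v: "N \<ge> 0 \<or> norm v \<ge> 1 / 2"
    and nz: "bargmann_normed F (cvec (s + r *\<^sub>R v)) \<noteq> 0" "bargmann_normed G (cvec (t - r' *\<^sub>R v)) \<noteq> 0"
  obtains c p q where "p \<noteq> 0" "q \<noteq> 0" "real (degree p + degree q) \<le> N"
    "\<And>r::real. bargmann_normed F (cvec (s + r *\<^sub>R v)) = poly p (of_real r) * exp (c * of_real r)"
    "\<And>r::real. bargmann_normed G (cvec (t - r *\<^sub>R v)) = poly q (of_real r) * exp (- c * of_real r)"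
proof -
  obtain B where B: "B \<ge> 0"
    "\<And>z y. cmod (bargmann_normed F z * bargmann_normed G y) \<le> B * (1 + norm (z - y)) powr N * exp (pi / 4 * (norm (z + y))\<^sup>2)"
    using bargmann_normed_product_bound[OF F G C decay] by blast
  define f where "f \<zeta> = bargmann_normed F (cvec s + \<zeta> *s cvec v)" for \<zeta>
  define g where "g \<zeta> = bargmann_normed G (cvec t + \<zeta> *s cvec (- v))" for \<zeta>
  have fg: "bargmann_normed F (cvec (s + r *\<^sub>R v)) = f (of_real r)" "bargmann_normed G (cvec (t - r *\<^sub>R v)) = g (of_real r)" for r
  proof -
    have "cvec t + of_real r *s cvec (- v) = cvec (t - r *\<^sub>R v)" by (simp add: cvec_def vec_eq_iff)
    then show "bargmann_normed G (cvec (t - r *\<^sub>R v)) = g (of_real r)" by (simp add: g_def)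
  qed (simp add: f_def cdot_simps)
  have hol: "f holomorphic_on UNIV" "g holomorphic_on UNIV"
    unfolding f_def g_def by (rule bargmann_normed_line_holomorphic F G)+
  have growth: "\<exists>C. \<forall>z. cmod (f z * g (z - \<tau>)) \<le> C * (1 + cmod z) powr N" for \<tau>
  proof -
    define d where "d = cvec s - cvec t - \<tau> *s cvec v"
    define e where "e = cvec s + cvec t + \<tau> *s cvec v"
    define K where "K = B * exp (pi / 4 * (norm e)\<^sup>2) * (1 + norm d) powr \<bar>N\<bar> * (1 + 2 * norm v) powr \<bar>N\<bar>"
    have "cmod (f \<zeta> * g (\<zeta> - \<tau>)) \<le> K * (1 + cmod \<zeta>) powr N" for \<zeta>
    proof -
      define z y where "z = cvec s + \<zeta> *s cvec v" and "y = cvec t + (\<zeta> - \<tau>) *s cvec (- v)"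
      have zy: "z + y = e" "z - y = d + (2 * \<zeta>) *s cvec v"
        by (simp_all add: z_def y_def d_def e_def cvec_def vec_eq_iff algebra_simps)
      have "(1 + norm (z - y)) powr N \<le> (1 + norm ((2 * \<zeta>) *s cvec v)) powr N * (1 + norm d) powr \<bar>N\<bar>"
        unfolding zy using peetre[of "d + (2 * \<zeta>) *s cvec v" N "(2 * \<zeta>) *s cvec v"] by simp
      also have "(1 + norm ((2 * \<zeta>) *s cvec v)) powr N \<le> (1 + 2 * norm v) powr \<bar>N\<bar> * (1 + cmod \<zeta>) powr N"
      proof (cases "N \<ge> 0")
        case True
        have "1 + norm ((2 * \<zeta>) *s cvec v) \<le> (1 + 2 * norm v) * (1 + cmod \<zeta>)"
          by (simp add: algebra_simps norm_mult)
        then have "(1 + norm ((2 * \<zeta>) *s cvec v)) powr N \<le> ((1 + 2 * norm v) * (1 + cmod \<zeta>)) powr N"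
          using True by (intro powr_mono2) auto
        then show ?thesis using True by (simp add: powr_mult)
      next
        case False
        then have "1 / 2 \<le> norm v" using v by simp
        then have "1 + cmod \<zeta> \<le> 1 + norm ((2 * \<zeta>) *s cvec v)"
          using mult_left_mono[of 1 "2 * norm v" "cmod \<zeta>"] by (simp add: norm_mult mult_ac)
        then have "(1 + norm ((2 * \<zeta>) *s cvec v)) powr N \<le> 1 * (1 + cmod \<zeta>) powr N"
          using False by (simp add: powr_mono2' add_pos_nonneg)
        also have "\<dots> \<le> (1 + 2 * norm v) powr \<bar>N\<bar> * (1 + cmod \<zeta>) powr N"
          by (intro mult_right_mono) (auto simp: ge_one_powr_ge_zero)
        finally show ?thesis .
      qed
      finally have le: "(1 + norm (z - y)) powr N \<le> (1 + 2 * norm v) powr \<bar>N\<bar> * (1 + cmod \<zeta>) powr N * (1 + norm d) powr \<bar>N\<bar>"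
        by (simp add: mult_right_mono)
      have "cmod (f \<zeta> * g (\<zeta> - \<tau>)) \<le> B * (1 + norm (z - y)) powr N * exp (pi / 4 * (norm e)\<^sup>2)"
      proof -
        have "f \<zeta> = bargmann_normed F z" "g (\<zeta> - \<tau>) = bargmann_normed G y"
          by (simp_all only: f_def g_def z_def y_def)
        then show ?thesis using B(2)[of z y] by (simp only: zy(1))
      qed
      also have "\<dots> \<le> B * ((1 + 2 * norm v) powr \<bar>N\<bar> * (1 + cmod \<zeta>) powr N * (1 + norm d) powr \<bar>N\<bar>) * exp (pi / 4 * (norm e)\<^sup>2)"
        by (intro mult_right_mono mult_left_mono le B(1)) auto
      also have "\<dots> = K * (1 + cmod \<zeta>) powr N" by (simp add: K_def mult_ac)
      finally show ?thesis .
    qed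
    then show ?thesis by blast
  qed
  from entire_pair_growth[OF hol nz[unfolded fg] growth] that show thesis
    unfolding fg by metis
qed

lemma bargmann_structure:
  fixes F G :: "real ^ 'k \<Rightarrow> complex"
  assumes F: "L2 lborel F" and G: "L2 lborel G" and C: "C \<ge> 0"
    and decay: "AE x in lborel. AE w in lborel.
      cmod (stft G F x w) \<le> C * (1 + norm (x, w)) powr N * exp (- pi * (x \<bullet> x + w \<bullet> w) / 2)"
    and nz: "bargmann_normed F (cvec s0) \<noteq> 0" "bargmann_normed G (cvec t0) \<noteq> 0"
  obtains c n m p q where "real (n + m) \<le> N" "poly_upto n p" "poly_upto m q"
    "\<And>t. bargmann_normed F (cvec t) = p t * exp (cdot (cvec t) c)"
    "\<And>t. bargmann_normed G (cvec t) = q t * exp (cdot (cvec t) c)"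
proof -
  \<comment> \<open>A unit direction is admissible for either sign of N. It yields two degrees whose
    sum is at most N, so N cannot be negative once both transforms are nonzero somewhere.\<close>
  have N: "N \<ge> 0"
  proof -
    define v :: "real ^ 'k" where "v = axis undefined 1"
    have v: "N \<ge> 0 \<or> norm v \<ge> 1 / 2" by (simp add: v_def)
    have "bargmann_normed F (cvec (s0 + 0 *\<^sub>R v)) \<noteq> 0" "bargmann_normed G (cvec (t0 - 0 *\<^sub>R v)) \<noteq> 0"
      using nz by simp_all
    then show ?thesis
    proof (rule bargmann_lines[OF F G C decay v])
      fix p q :: "complex poly" assume "real (degree p + degree q) \<le> N"
      then show ?thesis by linarith
    qed
  qed
  show thesis
  proof (rule exponential_poly_from_lines[of "\<lambda>t. bargmann_normed F (cvec t)" "\<lambda>t. bargmann_normed G (cvec t)" N, OF _ nz])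
    fix s t v :: "real ^ 'k" and r r'
    assume "bargmann_normed F (cvec (s + r *\<^sub>R v)) \<noteq> 0" "bargmann_normed G (cvec (t - r' *\<^sub>R v)) \<noteq> 0"
    then show "\<exists>(c :: complex) (p :: complex poly) (q :: complex poly). p \<noteq> 0 \<and> q \<noteq> 0 \<and> real (degree p + degree q) \<le> N \<and>
        (\<forall>r::real. bargmann_normed F (cvec (s + r *\<^sub>R v)) = poly p (of_real r) * exp (c * r)) \<and>
        (\<forall>r::real. bargmann_normed G (cvec (t - r *\<^sub>R v)) = poly q (of_real r) * exp (- c * r))"
    proof (rule bargmann_lines[OF F G C decay disjI1[OF N]])
      fix c and p q :: "complex poly"
      assume "p \<noteq> 0" "q \<noteq> 0" "real (degree p + degree q) \<le> N"
        "\<And>r::real. bargmann_normed F (cvec (s + r *\<^sub>R v)) = poly p (of_real r) * exp (c * of_real r)"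
        "\<And>r::real. bargmann_normed G (cvec (t - r *\<^sub>R v)) = poly q (of_real r) * exp (- c * of_real r)"
      then show ?thesis by (intro exI[of _ c] exI[of _ p] exI[of _ q] conjI allI)
    qed
  qed (use that in blast)
qed

section \<open>Inverting the Bargmann transform\<close>

text \<open>The common shape of the recursions for Hermite polynomials and for Gaussian moments: the
  derivative is too small to cancel the leading term.\<close>

lemma degree_X_mult_plus_pderiv:
  fixes h :: "'a :: field_char_0 poly"
  assumes "h \<noteq> 0" "a \<noteq> 0"
  shows "degree (smult a (pCons 0 h) + smult b (pderiv h)) = Suc (degree h)"
proof -
  have "degree (smult b (pderiv h)) \<le> degree h" by (simp add: degree_pderiv)
  also have "degree h < degree (smult a (pCons 0 h))" using assms by simp
  finally show ?thesis using assms by (subst degree_add_eq_left) auto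
qed

lemma degree_hermite_poly: "degree (hermite_poly n) = n"
proof (induction n)
  case (Suc n)
  have "hermite_poly n \<noteq> 0" using Suc by (cases n) auto
  moreover have "hermite_poly (Suc n) = smult 2 (pCons 0 (hermite_poly n)) + smult (- 1) (pderiv (hermite_poly n))"
    by (simp del: mult_pCons_left) (simp add: numeral_poly)
  ultimately show ?case using degree_X_mult_plus_pderiv[of "hermite_poly n" 2 "- 1"] Suc by simp
qed simp

lemma monom_in_triangular_basis:
  fixes b :: "nat \<Rightarrow> 'a :: field poly"
  assumes "\<And>n. degree (b n) = n" "b 0 \<noteq> 0"
  shows "\<exists>c. monom 1 n = (\<Sum>j\<le>n. smult (c j) (b j))"
proof -
  have "\<exists>c. p = (\<Sum>j\<le>n. smult (c j) (b j))" if "degree p \<le> n" for p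
    using that
  proof (induction n arbitrary: p)
    case 0
    then obtain x y where "p = [:x:]" "b 0 = [:y:]" using assms(1) by (metis degree_eq_zeroE le_zero_eq)
    then show ?case using assms(2) by (intro exI[of _ "\<lambda>_. x / y"]) simp
  next
    case (Suc n)
    define k where "k = coeff p (Suc n) / lead_coeff (b (Suc n))"
    have nz: "lead_coeff (b (Suc n)) \<noteq> 0" using assms(1)[of "Suc n"] by (metis degree_0 leading_coeff_0_iff nat.distinct(1))
    have "degree (p - smult k (b (Suc n))) \<le> n"
    proof (rule degree_le, intro allI impI)
      fix i assume i: "i > n"
      show "coeff (p - smult k (b (Suc n))) i = 0"
      proof (cases "i = Suc n")
        case True
        then show ?thesis using nz assms(1)[of "Suc n"] by (simp add: k_def)
      next
        case False
        then show ?thesis using i Suc.prems assms(1)[of "Suc n"] by (simp add: coeff_eq_0)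
      qed
    qed
    from Suc.IH[OF this] obtain c where c: "p - smult k (b (Suc n)) = (\<Sum>j\<le>n. smult (c j) (b j))" by blast
    have "p = (\<Sum>j\<le>n. smult (c j) (b j)) + smult k (b (Suc n))" using c by (metis diff_add_cancel)
    also have "\<dots> = (\<Sum>j\<le>Suc n. smult ((c(Suc n := k)) j) (b j))"
      by (simp add: sum.atMost_Suc)
    finally show ?case by blast
  qed
  then show ?thesis by (simp add: degree_monom_eq)
qed

text \<open>Each monomial is expanded coordinate by coordinate. Only indices with l i \<le> m i
  occur, so the bound n on the total degree survives the change of basis. It is used for Gaussian
  moments and again for Hermite polynomials.\<close>

lemma poly_upto_triangular_basis:
  fixes P :: "real ^ 'k \<Rightarrow> complex" and b :: "'k \<Rightarrow> nat \<Rightarrow> complex poly"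
  assumes P: "poly_upto n P" and b: "\<And>i j. degree (b i j) = j" "\<And>i. b i 0 \<noteq> 0"
  shows "\<exists>d. \<forall>x. P x = (\<Sum>m\<in>{m. (\<Sum>i\<in>UNIV. m i) \<le> n}. d m * (\<Prod>i\<in>UNIV. poly (b i (m i)) (of_real (x $ i))))"
proof -
  let ?M = "{m :: 'k \<Rightarrow> nat. (\<Sum>i\<in>UNIV. m i) \<le> n}"
  from P obtain a where a: "\<And>x. P x = (\<Sum>m\<in>?M. a m * monomial_fun m x)"
    unfolding poly_upto_def by blast
  have "\<forall>i. \<exists>c. \<forall>k. monom 1 k = (\<Sum>j\<le>k. smult (c k j) (b i j))"
    using monom_in_triangular_basis[OF b] by (intro allI choice)
  then have "\<exists>c. \<forall>i k. monom 1 k = (\<Sum>j\<le>k. smult (c i k j) (b i j))" by (rule choice)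
  then obtain c where c: "\<And>i k. monom 1 k = (\<Sum>j\<le>k. smult (c i k j) (b i j))" by blast
  define B where "B m x = (\<Prod>i\<in>UNIV. poly (b i (m i)) (of_real (x $ i)))" for m and x :: "real ^ 'k"
  have mono: "monomial_fun m x = (\<Sum>l\<in>PiE UNIV (\<lambda>i. {..m i}). (\<Prod>i\<in>UNIV. c i (m i) (l i)) * B l x)" for m x
  proof -
    have "of_real (x $ i) ^ m i = (\<Sum>j\<le>m i. c i (m i) j * poly (b i j) (of_real (x $ i)))" for i
      using arg_cong[OF c[of "m i" i], of "\<lambda>p. poly p (of_real (x $ i))"] by (simp add: poly_monom poly_sum)
    then have "monomial_fun m x = (\<Prod>i\<in>UNIV. \<Sum>j\<le>m i. c i (m i) j * poly (b i j) (of_real (x $ i)))"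
      by (simp add: monomial_fun_def)
    also have "\<dots> = (\<Sum>l\<in>PiE UNIV (\<lambda>i. {..m i}). \<Prod>i\<in>UNIV. c i (m i) (l i) * poly (b i (l i)) (of_real (x $ i)))"
      by (rule prod_sum_PiE) auto
    also have "\<dots> = (\<Sum>l\<in>PiE UNIV (\<lambda>i. {..m i}). (\<Prod>i\<in>UNIV. c i (m i) (l i)) * B l x)"
      by (simp add: prod.distrib B_def)
    finally show ?thesis .
  qed
  have fin: "finite (PiE UNIV (\<lambda>i. {..m i}))" for m :: "'k \<Rightarrow> nat" by (intro finite_PiE) auto
  define S where "S = (SIGMA m:?M. PiE UNIV (\<lambda>i. {..m i}))"
  have S: "finite S" unfolding S_def using finite_multiindices fin by (intro finite_SigmaI) auto
  define w where "w = (\<lambda>(m, l). a m * (\<Prod>i\<in>UNIV. c i (m i) (l i)))"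
  have "P x = (\<Sum>l\<in>?M. (\<Sum>s\<in>{s\<in>S. snd s = l}. w s) * B l x)" for x
  proof -
    have "P x = (\<Sum>m\<in>?M. \<Sum>l\<in>PiE UNIV (\<lambda>i. {..m i}). w (m, l) * B l x)"
      unfolding a mono sum_distrib_left w_def by (simp add: mult.assoc)
    also have "\<dots> = (\<Sum>s\<in>S. w s * B (snd s) x)"
      unfolding S_def using finite_multiindices fin by (subst sum.Sigma) (auto simp: case_prod_unfold)
    also have "\<dots> = (\<Sum>l\<in>?M. \<Sum>s\<in>{s\<in>S. snd s = l}. w s * B (snd s) x)"
    proof (rule sum.group[symmetric, OF S finite_multiindices])
      show "snd ` S \<subseteq> ?M"
      proof safe
        fix s assume "s \<in> S"
        then have "(\<Sum>i\<in>UNIV. fst s i) \<le> n" and le: "\<And>i. snd s i \<le> fst s i"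
          by (auto simp: S_def PiE_iff)
        moreover have "(\<Sum>i\<in>UNIV. snd s i) \<le> (\<Sum>i\<in>UNIV. fst s i)" by (intro sum_mono le)
        ultimately show "(\<Sum>i\<in>UNIV. snd s i) \<le> n" by linarith
      qed
    qed
    also have "\<dots> = (\<Sum>l\<in>?M. (\<Sum>s\<in>{s\<in>S. snd s = l}. w s) * B l x)"
      unfolding sum_distrib_right by (intro sum.cong) auto
    finally show ?thesis .
  qed
  then show ?thesis
    unfolding B_def by (intro exI[of _ "\<lambda>l. \<Sum>s\<in>{s\<in>S. snd s = l}. w s"] allI)
qed

text \<open>Differentiation in s produces the next power of t under the integral. The rate 2 pi is
  the sum of pi from the Gaussian being transformed and pi from the Bargmann kernel.\<close>

lemma gaussian_moment:
  "\<exists>h :: complex poly. degree h = m \<and> h \<noteq> 0 \<and> (\<forall>s :: complex. has_bochner_integral lborel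
     (\<lambda>t :: real. of_real t ^ m * exp (- of_real (2 * pi * t\<^sup>2) + of_real t * (2 * pi * s)))
     (poly h s * exp (pi / 2 * s\<^sup>2)))"
proof (induction m)
  case 0
  have int: "has_bochner_integral lborel (\<lambda>t :: real. exp (- of_real (2 * pi * t\<^sup>2) + of_real t * (2 * pi * s)))
    (of_real (sqrt (pi / (2 * pi))) * exp ((2 * pi * s)\<^sup>2 / of_real (4 * (2 * pi))))" for s :: complex
    by (rule has_bochner_integral_gaussian) simp
  have eq: "(2 * pi * s)\<^sup>2 / of_real (4 * (2 * pi)) = pi / 2 * s\<^sup>2" for s :: complex
    by (simp add: power2_eq_square field_simps)
  show ?case
    using int unfolding eq by (intro exI[of _ "[:of_real (sqrt (pi / (2 * pi))):]"] conjI allI) simp_all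
next
  case (Suc m)
  then obtain h :: "complex poly" where h: "degree h = m" "h \<noteq> 0"
    "\<And>s :: complex. has_bochner_integral lborel (\<lambda>t :: real. of_real t ^ m * exp (- of_real (2 * pi * t\<^sup>2) + of_real t * (2 * pi * s)))
     (poly h s * exp (pi / 2 * s\<^sup>2))" by blast
  define g where "g t = complex_of_real t ^ m * exp (- of_real (2 * pi * t\<^sup>2))" for t :: real
  define q where "q t = 2 * pi * t" for t :: real
  have [measurable]: "g \<in> borel_measurable borel" "q \<in> borel_measurable borel" unfolding g_def q_def by measurable
  have gq: "g t * exp (s * of_real (q t)) = of_real t ^ m * exp (- of_real (2 * pi * t\<^sup>2) + of_real t * (2 * pi * s))" for s :: complex and t
    by (simp add: g_def q_def mult.assoc mult_exp_exp mult_ac)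
  have I: "integrable lborel (\<lambda>t. g t * exp (s * of_real (q t)))" for s :: complex
    using h(3)[of s] unfolding gq by (rule integrable.intros)
  have int: "integrable lborel (\<lambda>t. cmod (g t) * exp (r * \<bar>q t\<bar>))" for r
  proof (rule Bochner_Integration.integrable_bound)
    show "integrable lborel (\<lambda>t. cmod (g t * exp (of_real r * of_real (q t))) + cmod (g t * exp (of_real (- r) * of_real (q t))))"
      by (intro Bochner_Integration.integrable_add integrable_norm I)
    have "cmod (g t) * exp (r * \<bar>q t\<bar>) \<le> cmod (g t * exp (of_real r * of_real (q t))) + cmod (g t * exp (of_real (- r) * of_real (q t)))" for t
      by (cases "q t \<ge> 0") (auto simp: norm_mult)
    then show "AE t in lborel. norm (cmod (g t) * exp (r * \<bar>q t\<bar>)) \<le> norm (cmod (g t * exp (of_real r * of_real (q t))) + cmod (g t * exp (of_real (- r) * of_real (q t))))"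
      by (intro AE_I2) (simp add: abs_mult)
  qed measurable
  have int2: "integrable lborel (\<lambda>t. (g t * of_real (q t)) * exp (s * of_real (q t)))" for s :: complex
  proof (rule Bochner_Integration.integrable_bound[OF int[of "cmod s + 1"]])
    show "AE t in lborel. norm ((g t * of_real (q t)) * exp (s * of_real (q t))) \<le> norm (cmod (g t) * exp ((cmod s + 1) * \<bar>q t\<bar>))"
    proof (rule AE_I2)
      fix t
      have "\<bar>q t\<bar> \<le> exp \<bar>q t\<bar>" using exp_ge_add_one_self[of "\<bar>q t\<bar>"] by linarith
      moreover have "exp (Re (s * of_real (q t))) \<le> exp (cmod s * \<bar>q t\<bar>)"
        using complex_Re_le_cmod[of "s * of_real (q t)"] by (simp add: norm_mult)
      ultimately have "\<bar>q t\<bar> * exp (Re (s * of_real (q t))) \<le> exp \<bar>q t\<bar> * exp (cmod s * \<bar>q t\<bar>)"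
        by (intro mult_mono) auto
      also have "\<dots> = exp ((cmod s + 1) * \<bar>q t\<bar>)" by (simp add: mult_exp_exp algebra_simps)
      finally have "cmod (g t) * (\<bar>q t\<bar> * exp (Re (s * of_real (q t)))) \<le> cmod (g t) * exp ((cmod s + 1) * \<bar>q t\<bar>)"
        by (intro mult_left_mono) auto
      then show "norm ((g t * of_real (q t)) * exp (s * of_real (q t))) \<le> norm (cmod (g t) * exp ((cmod s + 1) * \<bar>q t\<bar>))"
        by (simp add: norm_mult mult.assoc)
    qed
  qed measurable
  \<comment> \<open>The derivative of h exp (pi s^2 / 2) is (pi s h + h') exp (pi s^2 / 2); division
    by 2 pi gives k.\<close>
  define k where "k = smult (1 / 2) (pCons 0 h) + smult (1 / (2 * pi)) (pderiv h)"
  have "(\<integral>t. (g t * of_real (q t)) * exp (s * of_real (q t)) \<partial>lborel) = 2 * pi * (poly k s * exp (pi / 2 * s\<^sup>2))" for s :: complex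
  proof -
    have "((\<lambda>s. \<integral>t. g t * exp (s * of_real (q t)) \<partial>lborel) has_field_derivative
       (\<integral>t. (g t * of_real (q t)) * exp (s * of_real (q t)) \<partial>lborel)) (at s)"
      by (rule exp_integral_has_derivative) (use int in auto)
    moreover have "(\<integral>t. g t * exp (s * of_real (q t)) \<partial>lborel) = poly h s * exp (pi / 2 * s\<^sup>2)" for s :: complex
      using h(3)[of s] unfolding gq by (simp only: has_bochner_integral_iff)
    moreover have "((\<lambda>s. poly h s * exp (pi / 2 * s\<^sup>2)) has_field_derivative 2 * pi * (poly k s * exp (pi / 2 * s\<^sup>2))) (at s)"
      by (auto intro!: derivative_eq_intros poly_DERIV simp: k_def field_simps power2_eq_square)
    ultimately show ?thesis using DERIV_unique by force
  qed
  then have "has_bochner_integral lborel (\<lambda>t. (g t * of_real (q t)) * exp (s * of_real (q t))) (2 * pi * (poly k s * exp (pi / 2 * s\<^sup>2)))" for s :: complex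
    using int2 by (simp add: has_bochner_integral_iff)
  then have "has_bochner_integral lborel (\<lambda>t. (1 / (2 * pi)) * ((g t * of_real (q t)) * exp (s * of_real (q t)))) ((1 / (2 * pi)) * (2 * pi * (poly k s * exp (pi / 2 * s\<^sup>2))))" for s :: complex
    by (intro has_bochner_integral_mult_right)
  moreover have "complex_of_real (1 / (2 * pi)) * ((g t * of_real (q t)) * exp (s * of_real (q t))) =
     of_real t ^ Suc m * exp (- of_real (2 * pi * t\<^sup>2) + of_real t * (2 * pi * s))" for s :: complex and t
    using gq[of t s] by (simp add: q_def field_simps)
  moreover have "complex_of_real (1 / (2 * pi)) * (2 * pi * (poly k s * exp (pi / 2 * s\<^sup>2))) = poly k s * exp (pi / 2 * s\<^sup>2)" for s :: complex
    by simp
  moreover have "degree k = Suc m"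
    unfolding k_def using degree_X_mult_plus_pderiv[OF h(2), of "1 / 2"] h(1) by simp
  moreover from this have "k \<noteq> 0" by auto
  ultimately show ?case by (intro exI[of _ k] conjI allI) (simp_all only: not_False_eq_True)
qed

text \<open>The Bargmann kernel at \<kappa>, now in the role of a signal: the real part of \<kappa>
  is the centre and the imaginary part the frequency.\<close>

definition cgauss :: "complex ^ 'k \<Rightarrow> real ^ 'k \<Rightarrow> complex" where
  "cgauss \<kappa> t = exp (- of_real (pi * (t \<bullet> t)) + 2 * pi * cdot (cvec t) \<kappa>)"

text \<open>The two linear terms merge into one with z + \<kappa>, and the integral factorises into
  one-dimensional moments.\<close>

lemma monomial_cgauss_bargmann:
  fixes \<kappa> :: "complex ^ 'k" and h :: "nat \<Rightarrow> complex poly"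
  assumes h: "\<And>m (s :: complex). has_bochner_integral lborel
     (\<lambda>t :: real. of_real t ^ m * exp (- of_real (2 * pi * t\<^sup>2) + of_real t * (2 * pi * s)))
     (poly (h m) s * exp (pi / 2 * s\<^sup>2))"
  shows "L2 lborel (\<lambda>t. monomial_fun m t * cgauss \<kappa> t)"
    and "bargmann (\<lambda>t. monomial_fun m t * cgauss \<kappa> t) z =
      (\<Prod>i\<in>UNIV. poly (h (m i)) (z $ i + \<kappa> $ i)) * exp (pi / 2 * cdot (z + \<kappa>) (z + \<kappa>))"
proof -
  have prod_eq: "(\<Prod>i\<in>UNIV. of_real (t $ i) ^ m i * exp (- of_real (2 * pi * (t $ i)\<^sup>2) + of_real (t $ i) * (2 * pi * (y $ i))))
      = monomial_fun m t * exp (- of_real (2 * pi * (t \<bullet> t)) + 2 * pi * cdot (cvec t) y)" for m and t :: "real ^ 'k" and y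
  proof -
    have "(\<Sum>i\<in>UNIV. - of_real (2 * pi * (t $ i)\<^sup>2) + of_real (t $ i) * (2 * pi * (y $ i)))
      = - of_real (2 * pi * (t \<bullet> t)) + 2 * pi * cdot (cvec t) y"
      by (simp add: sum.distrib sum_subtractf sum_negf inner_vec_def cdot_def cvec_def sum_distrib_left power2_eq_square mult_ac)
    then show ?thesis by (simp only: prod.distrib monomial_fun_def exp_sum[OF finite, symmetric])
  qed
  have I: "has_bochner_integral lborel (\<lambda>t. monomial_fun m t * exp (- of_real (2 * pi * (t \<bullet> t)) + 2 * pi * cdot (cvec t) y))
     (\<Prod>i\<in>UNIV. poly (h (m i)) (y $ i) * exp (pi / 2 * (y $ i)\<^sup>2))" for m and y :: "complex ^ 'k"
    using has_bochner_integral_lborel_vec_prod[OF h, of m "\<lambda>i. y $ i"] unfolding prod_eq .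
  have [measurable]: "monomial_fun m \<in> borel_measurable borel" for m :: "'k \<Rightarrow> nat"
    unfolding monomial_fun_def by measurable
  show "L2 lborel (\<lambda>t. monomial_fun m t * cgauss \<kappa> t)"
    unfolding L2_def
  proof
    show "(\<lambda>t. monomial_fun m t * cgauss \<kappa> t) \<in> borel_measurable lborel" unfolding cgauss_def by measurable
    \<comment> \<open>The squared modulus is the modulus of a function of the same kind, with
      doubled exponents and with twice the real part of \<kappa>.\<close>
    have "(cmod (monomial_fun m t * cgauss \<kappa> t))\<^sup>2 =
        cmod (monomial_fun (\<lambda>i. m i + m i) t * exp (- of_real (2 * pi * (t \<bullet> t)) + 2 * pi * cdot (cvec t) (2 *s cvec (re_vec \<kappa>))))" for t
      by (simp add: monomial_fun_add cgauss_def norm_mult Re_cdot_cvec cdot_simps power2_eq_square mult_exp_exp algebra_simps)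
    moreover have "integrable lborel (\<lambda>t. cmod (monomial_fun (\<lambda>i. m i + m i) t * exp (- of_real (2 * pi * (t \<bullet> t)) + 2 * pi * cdot (cvec t) (2 *s cvec (re_vec \<kappa>)))))"
      using I by (intro integrable_norm integrable.intros)
    ultimately show "integrable lborel (\<lambda>t. (cmod (monomial_fun m t * cgauss \<kappa> t))\<^sup>2)" by simp
  qed
  have "bargmann (\<lambda>t. monomial_fun m t * cgauss \<kappa> t) z
     = (\<integral>t. monomial_fun m t * exp (- of_real (2 * pi * (t \<bullet> t)) + 2 * pi * cdot (cvec t) (z + \<kappa>)) \<partial>lborel)"
    unfolding bargmann_def cgauss_def
    by (intro Bochner_Integration.integral_cong refl) (simp add: mult.assoc mult_exp_exp cdot_simps algebra_simps)
  also have "\<dots> = (\<Prod>i\<in>UNIV. poly (h (m i)) ((z + \<kappa>) $ i) * exp (pi / 2 * ((z + \<kappa>) $ i)\<^sup>2))"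
    using I[of m "z + \<kappa>"] by (simp only: has_bochner_integral_iff)
  also have "\<dots> = (\<Prod>i\<in>UNIV. poly (h (m i)) (z $ i + \<kappa> $ i)) * exp (pi / 2 * cdot (z + \<kappa>) (z + \<kappa>))"
  proof -
    have "(\<Sum>i\<in>UNIV. pi / 2 * ((z + \<kappa>) $ i)\<^sup>2) = pi / 2 * cdot (z + \<kappa>) (z + \<kappa>)"
      by (simp add: cdot_def sum_distrib_left power2_eq_square)
    then show ?thesis by (simp only: prod.distrib exp_sum[OF finite, symmetric] vector_add_component)
  qed
  finally show "bargmann (\<lambda>t. monomial_fun m t * cgauss \<kappa> t) z =
      (\<Prod>i\<in>UNIV. poly (h (m i)) (z $ i + \<kappa> $ i)) * exp (pi / 2 * cdot (z + \<kappa>) (z + \<kappa>))" .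
qed

lemma L2_add: "L2 M f \<Longrightarrow> L2 M g \<Longrightarrow> L2 M (\<lambda>x. f x + g x)"
proof -
  assume fg: "L2 M f" "L2 M g"
  then have [measurable]: "f \<in> borel_measurable M" "g \<in> borel_measurable M" by (auto simp: L2_def)
  have "integrable M (\<lambda>x. (cmod (f x + g x))\<^sup>2)"
  proof (rule Bochner_Integration.integrable_bound)
    show "integrable M (\<lambda>x. 2 * (cmod (f x))\<^sup>2 + 2 * (cmod (g x))\<^sup>2)" using fg by (auto simp: L2_def)
    have "(cmod (f x + g x))\<^sup>2 \<le> 2 * (cmod (f x))\<^sup>2 + 2 * (cmod (g x))\<^sup>2" for x
    proof -
      have "(cmod (f x + g x))\<^sup>2 \<le> (cmod (f x) + cmod (g x))\<^sup>2" by (intro power_mono norm_triangle_ineq) auto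
      also have "\<dots> \<le> 2 * (cmod (f x))\<^sup>2 + 2 * (cmod (g x))\<^sup>2"
        using sum_squares_bound[of "cmod (f x)" "cmod (g x)"] by (simp add: power2_sum)
      finally show ?thesis .
    qed
    then show "AE x in M. norm ((cmod (f x + g x))\<^sup>2) \<le> norm (2 * (cmod (f x))\<^sup>2 + 2 * (cmod (g x))\<^sup>2)"
      by (intro AE_I2) simp
  qed measurable
  then show ?thesis by (simp add: L2_def)
qed

lemma L2_cmult: "L2 M f \<Longrightarrow> L2 M (\<lambda>x. c * f x)"
  by (auto simp: L2_def norm_mult power_mult_distrib)

lemma L2_sum: "(\<And>i. i \<in> S \<Longrightarrow> L2 M (f i)) \<Longrightarrow> L2 M (\<lambda>x. \<Sum>i\<in>S. f i x)"
  by (induction S rule: infinite_finite_induct) (auto intro: L2_add, auto simp: L2_def)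

lemma bargmann_sum:
  assumes "\<And>i. i \<in> S \<Longrightarrow> L2 lborel (f i)"
  shows "bargmann (\<lambda>x. \<Sum>i\<in>S. c i * f i x) z = (\<Sum>i\<in>S. c i * bargmann (f i) z)"
proof -
  have "bargmann (\<lambda>x. \<Sum>i\<in>S. c i * f i x) z =
      (\<integral>t. (\<Sum>i\<in>S. c i * (f i t * exp (- of_real (pi * (t \<bullet> t)) + 2 * pi * cdot (cvec t) z))) \<partial>lborel)"
    unfolding bargmann_def by (simp add: sum_distrib_right mult.assoc)
  also have "\<dots> = (\<Sum>i\<in>S. \<integral>t. c i * (f i t * exp (- of_real (pi * (t \<bullet> t)) + 2 * pi * cdot (cvec t) z)) \<partial>lborel)"
    using assms bargmann_integrable by (intro Bochner_Integration.integral_sum integrable_mult_right) blast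
  finally show ?thesis unfolding bargmann_def by simp
qed

text \<open>Vanishing at real points extends along complex lines through 0 to purely imaginary
  points, where the transform is the Fourier transform of F(t) exp (- pi t^2).\<close>

lemma bargmann_inject:
  fixes F :: "real ^ 'k \<Rightarrow> complex"
  assumes F: "L2 lborel F" and z: "\<And>t. bargmann F (cvec t) = 0"
  shows "AE t in lborel. F t = 0"
proof -
  define H where "H t = F t * exp (- of_real (pi * (t \<bullet> t)))" for t
  have "integrable lborel H"
    using bargmann_integrable[OF F, of 0] by (simp add: H_def[abs_def] cdot_def)
  moreover have "(\<integral>t. H t * exp (\<i> * of_real (t \<bullet> u)) \<partial>lborel) = 0" for u
  proof -
    define v where "v = u /\<^sub>R (2 * pi)"
    have "bargmann F (cvec 0 + \<zeta> *s cvec v) = 0" for \<zeta>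
    proof (rule entire_zero_on_reals[OF bargmann_line_holomorphic[OF F]])
      fix r
      have "cvec 0 + of_real r *s cvec v = cvec (r *\<^sub>R v)" by (simp add: cvec_def vec_eq_iff)
      then show "bargmann F (cvec 0 + of_real r *s cvec v) = 0" using z by simp
    qed
    from this[of \<i>] have "(\<integral>t. F t * exp (- of_real (pi * (t \<bullet> t)) + 2 * pi * cdot (cvec t) (cvec 0 + \<i> *s cvec v)) \<partial>lborel) = 0"
      unfolding bargmann_def .
    moreover have "F t * exp (- of_real (pi * (t \<bullet> t)) + 2 * pi * cdot (cvec t) (cvec 0 + \<i> *s cvec v)) = H t * exp (\<i> * of_real (t \<bullet> u))" for t
    proof -
      have "2 * pi * (t \<bullet> v) = t \<bullet> u" by (simp add: v_def)
      moreover have "- of_real (pi * (t \<bullet> t)) + 2 * pi * cdot (cvec t) (cvec 0 + \<i> *s cvec v)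
         = - of_real (pi * (t \<bullet> t)) + \<i> * of_real (2 * pi * (t \<bullet> v))"
        by (simp add: cdot_simps)
      ultimately show ?thesis unfolding H_def mult.assoc mult_exp_exp by (simp only:)
    qed
    ultimately show ?thesis by simp
  qed
  ultimately have "AE t in lborel. H t = 0" by (rule fourier_unique)
  then show ?thesis by eventually_elim (simp add: H_def)
qed

text \<open>A function F' of the desired form with the same transform as F is written down, and
  injectivity identifies the two. The parameter c / pi arises since the cross term of pi (t +
  \<kappa>)^2 / 2 is pi t \<kappa>, which has to equal t c.\<close>

lemma recover_from_bargmann:
  fixes F :: "real ^ 'k \<Rightarrow> complex"
  assumes F: "L2 lborel F" and p: "poly_upto n p"
    and eq: "\<And>t. bargmann_normed F (cvec t) = p t * exp (cdot (cvec t) c)"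
  obtains P where "poly_upto n P" "AE t in lborel. F t = P t * cgauss ((1 / pi) *s c) t"
proof -
  define \<kappa> where "\<kappa> = (1 / pi) *s c"
  have "\<exists>h. \<forall>m. degree (h m) = m \<and> h m \<noteq> 0 \<and> (\<forall>s :: complex. has_bochner_integral lborel
     (\<lambda>t :: real. of_real t ^ m * exp (- of_real (2 * pi * t\<^sup>2) + of_real t * (2 * pi * s)))
     (poly (h m) s * exp (pi / 2 * s\<^sup>2)))"
    by (intro choice allI gaussian_moment)
  then obtain h :: "nat \<Rightarrow> complex poly" where h: "\<And>m. degree (h m) = m" "\<And>m. h m \<noteq> 0"
    "\<And>m (s :: complex). has_bochner_integral lborel
     (\<lambda>t :: real. of_real t ^ m * exp (- of_real (2 * pi * t\<^sup>2) + of_real t * (2 * pi * s)))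
     (poly (h m) s * exp (pi / 2 * s\<^sup>2))"
    by blast
  \<comment> \<open>The transform of a monomial times \<open>cgauss \<kappa>\<close> is a polynomial
    in z + \<kappa>, so p is expanded in the moment polynomials shifted by \<kappa>.\<close>
  define b where "b i j = pcompose (h j) [:\<kappa> $ i, 1:]" for i j
  have b: "degree (b i j) = j" "b i 0 \<noteq> 0" for i j
    using h(1,2) by (simp_all add: b_def degree_pcompose pcompose_eq_0_iff)
  let ?M = "{m :: 'k \<Rightarrow> nat. (\<Sum>i\<in>UNIV. m i) \<le> n}"
  obtain d where d: "\<And>x. p x = (\<Sum>m\<in>?M. d m * (\<Prod>i\<in>UNIV. poly (b i (m i)) (of_real (x $ i))))"
    using poly_upto_triangular_basis[OF p, of b, OF b] by blast
  \<comment> \<open>Cancels the constant part of pi (t + \<kappa>)^2 / 2.\<close>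
  define K where "K = exp (- pi / 2 * cdot \<kappa> \<kappa>)"
  define P where "P t = (\<Sum>m\<in>?M. (d m * K) * monomial_fun m t)" for t
  have P: "poly_upto n P" unfolding poly_upto_def P_def by (intro exI[of _ "\<lambda>m. d m * K"] allI refl)
  define F' where "F' t = (\<Sum>m\<in>?M. (d m * K) * (monomial_fun m t * cgauss \<kappa> t))" for t
  have F'P: "F' t = P t * cgauss \<kappa> t" for t by (simp add: F'_def P_def sum_distrib_right mult.assoc)
  have F': "L2 lborel F'"
    unfolding F'_def by (intro L2_sum L2_cmult monomial_cgauss_bargmann(1)[OF h(3)])
  have "bargmann F' (cvec t) = bargmann F (cvec t)" for t
  proof -
    have tk: "exp (pi / 2 * cdot (cvec t + \<kappa>) (cvec t + \<kappa>)) * K = exp (pi / 2 * cdot (cvec t) (cvec t)) * exp (cdot (cvec t) c)"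
    proof -
      have "pi / 2 * cdot (cvec t + \<kappa>) (cvec t + \<kappa>) + - pi / 2 * cdot \<kappa> \<kappa> = pi / 2 * cdot (cvec t) (cvec t) + pi * cdot (cvec t) \<kappa>"
        by (simp add: cdot_simps(1-6) cdot_commute[of \<kappa> "cvec t"] field_simps)
      moreover have "pi * cdot (cvec t) \<kappa> = cdot (cvec t) c" by (simp add: \<kappa>_def cdot_simps)
      ultimately show ?thesis unfolding K_def mult_exp_exp by (simp only:)
    qed
    have "bargmann F' (cvec t) = (\<Sum>m\<in>?M. (d m * K) * ((\<Prod>i\<in>UNIV. poly (h (m i)) (cvec t $ i + \<kappa> $ i)) * exp (pi / 2 * cdot (cvec t + \<kappa>) (cvec t + \<kappa>))))"
      unfolding F'_def by (subst bargmann_sum) (simp_all only: monomial_cgauss_bargmann[OF h(3)])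
    also have "\<dots> = (\<Sum>m\<in>?M. d m * (\<Prod>i\<in>UNIV. poly (b i (m i)) (of_real (t $ i)))) * (exp (pi / 2 * cdot (cvec t + \<kappa>) (cvec t + \<kappa>)) * K)"
      unfolding sum_distrib_right by (simp add: b_def poly_pcompose cvec_def add.commute mult_ac)
    also have "\<dots> = p t * exp (cdot (cvec t) c) * exp (pi / 2 * cdot (cvec t) (cvec t))"
      unfolding tk d by (simp only: mult_ac)
    also have "\<dots> = bargmann F (cvec t)"
      unfolding eq[symmetric] bargmann_normed_def by (simp add: mult.assoc mult_exp_exp)
    finally show ?thesis .
  qed
  \<comment> \<open>The difference F - F' is written as a sum over two indices, so that linearity
    over finite sums applies.\<close>
  then have "bargmann (\<lambda>t. \<Sum>i\<in>{True, False}. (if i then 1 else - 1) * (if i then F else F') t) (cvec t) = 0" for t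
    using F F' by (subst bargmann_sum) auto
  moreover have "L2 lborel (\<lambda>t. \<Sum>i\<in>{True, False}. (if i then 1 else - 1) * (if i then F else F') t)"
    using F F' by (intro L2_sum L2_cmult) auto
  ultimately have "AE t in lborel. (\<Sum>i\<in>{True, False}. (if i then 1 else - 1) * (if i then F else F') t) = 0"
    using bargmann_inject by blast
  then have "AE t in lborel. F t = P t * cgauss \<kappa> t"
    by eventually_elim (simp add: F'P)
  then show thesis using P unfolding \<kappa>_def by (rule that[rotated])
qed

text \<open>Completing the square in the real part of \<kappa>. The matrix is the identity, and
  centre and frequency are both real.\<close>

lemma cgauss_eq_gaussian:
  "cgauss \<kappa> t = exp (pi * (re_vec \<kappa> \<bullet> re_vec \<kappa>)) * gaussian (cvec (re_vec \<kappa>)) (cvec (im_vec \<kappa>)) (mat 1) t"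
proof -
  define u v where "u = re_vec \<kappa>" and "v = im_vec \<kappa>"
  have k: "\<kappa> = cvec u + \<i> *s cvec v"
    by (simp add: u_def v_def re_vec_def im_vec_def cvec_def vec_eq_iff complex_eq)
  have m: "map_matrix complex_of_real (mat 1) = (mat 1 :: complex ^ 'a ^ 'a)"
    by (simp add: map_matrix_def mat_def vec_eq_iff)
  have "- of_real (pi * (t \<bullet> t)) + 2 * pi * cdot (cvec t) \<kappa> = of_real (pi * (u \<bullet> u)) +
     (2 * pi * \<i> * cdot (cvec v) (cvec t) + - pi * cdot (cvec t - cvec u) (cvec t - cvec u))"
    by (simp add: k cdot_simps inner_commute algebra_simps)
  then have "cgauss \<kappa> t = exp (of_real (pi * (u \<bullet> u))) * (exp (2 * pi * \<i> * cdot (cvec v) (cvec t)) * exp (- pi * cdot (cvec t - cvec u) (cvec t - cvec u)))"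
    unfolding cgauss_def by (simp only: exp_add)
  then show ?thesis unfolding gaussian_def m matrix_vector_mul_lid u_def v_def by (simp only: exp_of_real)
qed

lemma poly_upto_cmult: "poly_upto n P \<Longrightarrow> poly_upto n (\<lambda>t. c * P t)"
  unfolding poly_upto_def
proof safe
  fix a assume "\<forall>x. P x = (\<Sum>m\<in>{m. sum m UNIV \<le> n}. a m * monomial_fun m x)"
  then show "\<exists>a. \<forall>x. c * P x = (\<Sum>m\<in>{m. sum m UNIV \<le> n}. a m * monomial_fun m x)"
    by (intro exI[of _ "\<lambda>m. c * a m"]) (simp add: sum_distrib_left mult.assoc)
qed

text \<open>Here n only bounds the degree. The zero function therefore satisfies the predicate for
  all parameters, which later covers the vanishing slices.\<close>

definition poly_gauss :: "real ^ 'k \<Rightarrow> real ^ 'k \<Rightarrow> nat \<Rightarrow> (real ^ 'k \<Rightarrow> complex) \<Rightarrow> bool" where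
  "poly_gauss u v n F \<longleftrightarrow> (\<exists>P. poly_upto n P \<and> (AE t in lborel. F t = P t * gaussian (cvec u) (cvec v) (mat 1) t))"

text \<open>A negative \<open>N\<close> rules out the third alternative; this settles the case \<open>\<alpha> > 1\<close>.\<close>

lemma stft_hardy:
  fixes F G :: "real ^ 'k \<Rightarrow> complex"
  assumes F: "L2 lborel F" and G: "L2 lborel G" and C: "C \<ge> 0"
    and decay: "AE x in lborel. AE w in lborel.
      cmod (stft G F x w) \<le> C * (1 + norm (x, w)) powr N * exp (- pi * (x \<bullet> x + w \<bullet> w) / 2)"
  shows "(AE t in lborel. F t = 0) \<or> (AE t in lborel. G t = 0) \<or>
    (\<exists>u v n m. real (n + m) \<le> N \<and> poly_gauss u v n F \<and> poly_gauss u v m G)"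
proof (rule ccontr)
  assume contra: "\<not> ?thesis"
  have "\<exists>t. bargmann_normed F (cvec t) \<noteq> 0" "\<exists>t. bargmann_normed G (cvec t) \<noteq> 0"
    using bargmann_inject[OF F] bargmann_inject[OF G] contra unfolding bargmann_normed_def by auto
  then obtain s0 t0 where nz: "bargmann_normed F (cvec s0) \<noteq> 0" "bargmann_normed G (cvec t0) \<noteq> 0" by blast
  have gauss: "poly_gauss (re_vec \<kappa>) (im_vec \<kappa>) n F"
    if "poly_upto n P" "AE t in lborel. F t = P t * cgauss \<kappa> t" for n P \<kappa> and F :: "real ^ 'k \<Rightarrow> complex"
    unfolding poly_gauss_def
  proof (intro exI conjI)
    show "poly_upto n (\<lambda>t. exp (pi * (re_vec \<kappa> \<bullet> re_vec \<kappa>)) * P t)" by (rule poly_upto_cmult[OF that(1)])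
    show "AE t in lborel. F t = exp (pi * (re_vec \<kappa> \<bullet> re_vec \<kappa>)) * P t * gaussian (cvec (re_vec \<kappa>)) (cvec (im_vec \<kappa>)) (mat 1) t"
      using that(2) by eventually_elim (simp add: cgauss_eq_gaussian)
  qed
  show False
  proof (rule bargmann_structure[OF F G C decay nz])
    fix c n m p q
    assume nm: "real (n + m) \<le> N" and pq: "poly_upto n p" "poly_upto m q"
      and eq: "\<And>t. bargmann_normed F (cvec t) = p t * exp (cdot (cvec t) c)"
        "\<And>t. bargmann_normed G (cvec t) = q t * exp (cdot (cvec t) c)"
    obtain P where "poly_upto n P" "AE t in lborel. F t = P t * cgauss ((1 / pi) *s c) t"
      using recover_from_bargmann[OF F pq(1) eq(1)] by blast
    moreover obtain Q where "poly_upto m Q" "AE t in lborel. G t = Q t * cgauss ((1 / pi) *s c) t"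
      using recover_from_bargmann[OF G pq(2) eq(2)] by blast
    ultimately show False using gauss nm contra by blast
  qed
qed

section \<open>Slices\<close>

lemma nn_integral_rearrange:
  assumes "sigma_finite_measure A" "sigma_finite_measure B" "sigma_finite_measure C" "sigma_finite_measure D"
    and h [measurable]: "h \<in> borel_measurable ((A \<Otimes>\<^sub>M B) \<Otimes>\<^sub>M (C \<Otimes>\<^sub>M D))"
  shows "(\<integral>\<^sup>+l. h l \<partial>((A \<Otimes>\<^sub>M B) \<Otimes>\<^sub>M (C \<Otimes>\<^sub>M D))) =
    (\<integral>\<^sup>+x2. \<integral>\<^sup>+w2. \<integral>\<^sup>+x1. \<integral>\<^sup>+w1. h ((x1, x2), (w1, w2)) \<partial>C \<partial>A \<partial>D \<partial>B)"
proof -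
  interpret A: sigma_finite_measure A by fact
  interpret B: sigma_finite_measure B by fact
  interpret C: sigma_finite_measure C by fact
  interpret D: sigma_finite_measure D by fact
  interpret AB: pair_sigma_finite A B ..
  interpret CD: pair_sigma_finite C D ..
  interpret AD: pair_sigma_finite A D ..
  have "(\<integral>\<^sup>+l. h l \<partial>((A \<Otimes>\<^sub>M B) \<Otimes>\<^sub>M (C \<Otimes>\<^sub>M D))) = (\<integral>\<^sup>+x. \<integral>\<^sup>+w. h (x, w) \<partial>(C \<Otimes>\<^sub>M D) \<partial>(A \<Otimes>\<^sub>M B))"
    by (rule sigma_finite_measure.nn_integral_fst[OF sigma_finite_pair_measure[OF assms(3,4)], symmetric]) measurable
  also have "\<dots> = (\<integral>\<^sup>+x1. \<integral>\<^sup>+x2. \<integral>\<^sup>+w. h ((x1, x2), w) \<partial>(C \<Otimes>\<^sub>M D) \<partial>B \<partial>A)"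
    by (rule B.nn_integral_fst[symmetric]) measurable
  also have "\<dots> = (\<integral>\<^sup>+x2. \<integral>\<^sup>+x1. \<integral>\<^sup>+w. h ((x1, x2), w) \<partial>(C \<Otimes>\<^sub>M D) \<partial>A \<partial>B)"
    by (rule AB.Fubini'[symmetric]) measurable
  also have "\<dots> = (\<integral>\<^sup>+x2. \<integral>\<^sup>+x1. \<integral>\<^sup>+w2. \<integral>\<^sup>+w1. h ((x1, x2), (w1, w2)) \<partial>C \<partial>D \<partial>A \<partial>B)"
  proof (intro nn_integral_cong)
    fix x1 x2 assume [measurable]: "x1 \<in> space A" "x2 \<in> space B"
    show "(\<integral>\<^sup>+w. h ((x1, x2), w) \<partial>(C \<Otimes>\<^sub>M D)) = (\<integral>\<^sup>+w2. \<integral>\<^sup>+w1. h ((x1, x2), (w1, w2)) \<partial>C \<partial>D)"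
      by (subst CD.nn_integral_snd) (auto simp: case_prod_unfold)
  qed
  also have "\<dots> = (\<integral>\<^sup>+x2. \<integral>\<^sup>+w2. \<integral>\<^sup>+x1. \<integral>\<^sup>+w1. h ((x1, x2), (w1, w2)) \<partial>C \<partial>A \<partial>D \<partial>B)"
  proof (intro nn_integral_cong)
    fix x2 assume [measurable]: "x2 \<in> space B"
    show "(\<integral>\<^sup>+x1. \<integral>\<^sup>+w2. \<integral>\<^sup>+w1. h ((x1, x2), (w1, w2)) \<partial>C \<partial>D \<partial>A)
        = (\<integral>\<^sup>+w2. \<integral>\<^sup>+x1. \<integral>\<^sup>+w1. h ((x1, x2), (w1, w2)) \<partial>C \<partial>A \<partial>D)"
      by (rule AD.Fubini'[symmetric]) measurable
  qed
  finally show ?thesis .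
qed

text \<open>The slice variables must be quantified first, so that the remaining statement concerns
  an ordinary transform. The property is replaced by a measurable null set containing its
  exceptions, whose measure is an iterated integral in any order; hence \<open>P\<close> itself may
  be non-measurable.\<close>

lemma AE_rearrange:
  assumes sf: "sigma_finite_measure A" "sigma_finite_measure B" "sigma_finite_measure C" "sigma_finite_measure D"
    and ae: "AE l in (A \<Otimes>\<^sub>M B) \<Otimes>\<^sub>M (C \<Otimes>\<^sub>M D). P l"
  shows "AE x2 in B. AE w2 in D. AE x1 in A. AE w1 in C. P ((x1, x2), (w1, w2))"
proof -
  interpret A: sigma_finite_measure A by fact
  interpret C: sigma_finite_measure C by fact
  interpret D: sigma_finite_measure D by fact
  let ?M = "(A \<Otimes>\<^sub>M B) \<Otimes>\<^sub>M (C \<Otimes>\<^sub>M D)"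
  from ae obtain N where N: "{l \<in> space ?M. \<not> P l} \<subseteq> N" "emeasure ?M N = 0" and [measurable]: "N \<in> sets ?M"
    by (rule AE_E)
  have "(\<integral>\<^sup>+x2. \<integral>\<^sup>+w2. \<integral>\<^sup>+x1. \<integral>\<^sup>+w1. indicator N ((x1, x2), (w1, w2)) \<partial>C \<partial>A \<partial>D \<partial>B) = 0"
    using nn_integral_rearrange[OF sf, of "indicator N"] N(2) by simp
  then have "AE x2 in B. (\<integral>\<^sup>+w2. \<integral>\<^sup>+x1. \<integral>\<^sup>+w1. indicator N ((x1, x2), (w1, w2)) \<partial>C \<partial>A \<partial>D) = 0"
    by (subst (asm) nn_integral_0_iff_AE) simp_all
  with AE_space[of B] show ?thesis
  proof eventually_elim
    case (elim x2)
    then have [measurable]: "x2 \<in> space B" by simp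
    from elim(2) have "AE w2 in D. (\<integral>\<^sup>+x1. \<integral>\<^sup>+w1. indicator N ((x1, x2), (w1, w2)) \<partial>C \<partial>A) = 0"
      by (subst (asm) nn_integral_0_iff_AE) simp_all
    with AE_space[of D] show ?case
    proof eventually_elim
      case (elim w2)
      then have [measurable]: "w2 \<in> space D" by simp
      from elim(2) have "AE x1 in A. (\<integral>\<^sup>+w1. indicator N ((x1, x2), (w1, w2)) \<partial>C) = 0"
        by (subst (asm) nn_integral_0_iff_AE) simp_all
      with AE_space[of A] show ?case
      proof eventually_elim
        case (elim x1)
        then have [measurable]: "x1 \<in> space A" by simp
        from elim(2) have "AE w1 in C. indicator N ((x1, x2), (w1, w2)) = (0 :: ennreal)"
          by (subst (asm) nn_integral_0_iff_AE) simp_all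
        with AE_space[of C] show ?case
        proof eventually_elim
          case (elim w1)
          then have "((x1, x2), (w1, w2)) \<in> space ?M" "((x1, x2), (w1, w2)) \<notin> N"
            using \<open>x1 \<in> space A\<close> \<open>x2 \<in> space B\<close> \<open>w2 \<in> space D\<close> by (auto simp: space_pair_measure split: split_indicator_asm)
          then show ?case using N(1) by blast
        qed
      qed
    qed
  qed
qed

lemma (in pair_sigma_finite) AE_pair_fst: "AE x in M1. P x \<Longrightarrow> AE z in M1 \<Otimes>\<^sub>M M2. P (fst z)"
proof (elim AE_E)
  fix N assume N: "{x \<in> space M1. \<not> P x} \<subseteq> N" "emeasure M1 N = 0" and [measurable]: "N \<in> sets M1"
  have "AE x in M1. x \<notin> N" using N(2) \<open>N \<in> sets M1\<close> by (intro AE_not_in) (auto simp: null_sets_def)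
  then have "AE x in M1. AE y in M2. fst (x, y) \<notin> N" by eventually_elim simp
  then have "AE z in M1 \<Otimes>\<^sub>M M2. fst z \<notin> N" by (intro AE_pair_measure) measurable
  with AE_space[of "M1 \<Otimes>\<^sub>M M2"] show "AE z in M1 \<Otimes>\<^sub>M M2. P (fst z)"
    by eventually_elim (use N(1) in \<open>auto simp: space_pair_measure\<close>)
qed

lemma (in pair_sigma_finite) AE_pair_snd: "AE y in M2. P y \<Longrightarrow> AE z in M1 \<Otimes>\<^sub>M M2. P (snd z)"
proof (elim AE_E)
  fix N assume N: "{x \<in> space M2. \<not> P x} \<subseteq> N" "emeasure M2 N = 0" and [measurable]: "N \<in> sets M2"
  have "AE x in M2. x \<notin> N" using N(2) \<open>N \<in> sets M2\<close> by (intro AE_not_in) (auto simp: null_sets_def)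
  then have "AE x in M1. AE y in M2. snd (x, y) \<notin> N" by simp
  then have "AE z in M1 \<Otimes>\<^sub>M M2. snd z \<notin> N" by (intro AE_pair_measure) measurable
  with AE_space[of "M1 \<Otimes>\<^sub>M M2"] show "AE z in M1 \<Otimes>\<^sub>M M2. P (snd z)"
    by eventually_elim (use N(1) in \<open>auto simp: space_pair_measure\<close>)
qed

lemma (in pair_sigma_finite) AE_pair_swapped:
  assumes "{z \<in> space (M1 \<Otimes>\<^sub>M M2). P z} \<in> sets (M1 \<Otimes>\<^sub>M M2)"
  shows "(AE z in M1 \<Otimes>\<^sub>M M2. P z) \<longleftrightarrow> (AE y in M2. AE x in M1. P (x, y))"
  using AE_commute[of "\<lambda>x y. P (x, y)"] AE_pair_iff[of "\<lambda>x y. P (x, y)"] assms by simp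

section \<open>Reflection of the second factor\<close>

lemma sigma_finite_Rn: "sigma_finite_measure (Rn n)"
proof -
  interpret product_sigma_finite "\<lambda>_ :: nat. lborel :: real measure" ..
  show ?thesis unfolding Rn_def by (rule sigma_finite) simp
qed

lemma uminus_Rn_measurable [measurable]: "uminus_Rn n \<in> Rn n \<rightarrow>\<^sub>M Rn n"
  unfolding uminus_Rn_def Rn_def by measurable

lemma distr_uminus_Rn: "distr (Rn n) (Rn n) (uminus_Rn n) = Rn n"
proof -
  interpret product_sigma_finite "\<lambda>_ :: nat. lborel :: real measure" ..
  have "distr (Rn n) (Rn n) (uminus_Rn n) = Pi\<^sub>M {..<n} (\<lambda>_. lborel)"
  proof (rule PiM_eqI)
    fix A :: "nat \<Rightarrow> real set" assume A: "\<And>i. i \<in> {..<n} \<Longrightarrow> A i \<in> sets lborel"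
    have "uminus_Rn n -` Pi\<^sub>E {..<n} A \<inter> space (Rn n) = Pi\<^sub>E {..<n} (\<lambda>i. uminus -` A i)"
      by (auto simp: uminus_Rn_def Rn_def space_PiM PiE_iff extensional_def)
    moreover have "Pi\<^sub>E {..<n} A \<in> sets (Rn n)" unfolding Rn_def using A by (intro sets_PiM_I_finite) auto
    moreover have m: "uminus -` A i \<in> sets lborel" if "i < n" for i
      using measurable_sets[of uminus borel borel "A i"] A[of i] that by simp
    moreover have "emeasure lborel (uminus -` A i) = emeasure lborel (A i)" if "i < n" for i
      using emeasure_distr[of uminus lborel borel "A i"] A[of i] that unfolding lborel_distr_uminus by simp
    moreover have "emeasure (Rn n) (Pi\<^sub>E {..<n} (\<lambda>i. uminus -` A i)) = (\<Prod>i\<in>{..<n}. emeasure lborel (uminus -` A i))"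
      unfolding Rn_def using m by (intro emeasure_PiM) auto
    ultimately show "emeasure (distr (Rn n) (Rn n) (uminus_Rn n)) (Pi\<^sub>E {..<n} A) = (\<Prod>i\<in>{..<n}. emeasure lborel (A i))"
      by (simp add: emeasure_distr)
  qed (auto simp: Rn_def)
  then show ?thesis by (simp add: Rn_def)
qed

lemma uminus_uminus_Rn: "y \<in> space (Rn n) \<Longrightarrow> uminus_Rn n (uminus_Rn n y) = y"
  by (auto simp: uminus_Rn_def Rn_def space_PiM PiE_iff extensional_def)

lemma AE_uminus_Rn: "(AE y in Rn n. P (uminus_Rn n y)) \<longleftrightarrow> (AE y in Rn n. P y)"
proof -
  have *: "AE y in Rn n. P (uminus_Rn n y)" if "AE y in Rn n. P y" for P
    using AE_distrD[OF uminus_Rn_measurable, of P] that unfolding distr_uminus_Rn .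
  show ?thesis
  proof
    assume "AE y in Rn n. P (uminus_Rn n y)"
    from *[OF this] AE_space show "AE y in Rn n. P y"
      by eventually_elim (simp add: uminus_uminus_Rn)
  qed (rule *)
qed

text \<open>The degree \<open>a\<close> is attained on a slice of \<open>f\<close> that is paired with almost every slice of \<open>g\<close>,
  so that the remaining budget \<open>N - a\<close> bounds the degrees of the latter.\<close>

lemma common_parameters:
  fixes PF :: "'c \<Rightarrow> nat \<Rightarrow> 'a \<Rightarrow> bool" and PG :: "'c \<Rightarrow> nat \<Rightarrow> 'b \<Rightarrow> bool"
  assumes rel: "AE x in M. AE y in K. ZF x \<or> ZG y \<or> (\<exists>c n m. n + m \<le> N \<and> PF c n x \<and> PG c m y)"
    and nz: "\<not> (AE x in M. ZF x)" "\<not> (AE y in K. ZG y)"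
    and uniq: "\<And>x c c' n n'. \<not> ZF x \<Longrightarrow> PF c n x \<Longrightarrow> PF c' n' x \<Longrightarrow> c = c'"
      "\<And>y c c' n n'. \<not> ZG y \<Longrightarrow> PG c n y \<Longrightarrow> PG c' n' y \<Longrightarrow> c = c'"
    and mono: "\<And>c n n' x. PF c n x \<Longrightarrow> n \<le> n' \<Longrightarrow> PF c n' x" "\<And>c n n' y. PG c n y \<Longrightarrow> n \<le> n' \<Longrightarrow> PG c n' y"
  obtains c a b where "a + b \<le> N" "AE x in M. ZF x \<or> PF c a x" "AE y in K. ZG y \<or> PG c b y"
proof -
  define R where "R x y \<longleftrightarrow> ZF x \<or> ZG y \<or> (\<exists>c n m. n + m \<le> N \<and> PF c n x \<and> PG c m y)" for x y
  define good where "good x \<longleftrightarrow> \<not> ZF x \<and> (AE y in K. R x y)" for x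
  have ae_good: "AE x in M. ZF x \<or> good x"
    using rel by eventually_elim (auto simp: good_def R_def)
  \<comment> \<open>Two good slices are each related to almost every y, while \<open>ZG\<close>
    fails on a set that is not null, so they share a partner with \<open>ZG\<close> false.
    Uniqueness at that partner carries the parameter from one slice to the other.\<close>
  have pair: "\<exists>y. \<not> ZG y \<and> R x y \<and> R x' y" if "good x" "good x'" for x x'
  proof (rule ccontr)
    assume c: "\<not> ?thesis"
    have "AE y in K. R x y" "AE y in K. R x' y" using that by (auto simp: good_def)
    then have "AE y in K. ZG y" by eventually_elim (use c in blast)
    then show False using nz by blast
  qed
  obtain x0 where x0: "good x0"
  proof (rule ccontr)
    assume "\<not> thesis"
    then have "\<not> good x" for x using that by blast
    then show False using ae_good nz by simp
  qed
  obtain y0 where "\<not> ZG y0" "R x0 y0" using pair[OF x0 x0] by blast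
  then obtain c n0 where c: "PF c n0 x0" "n0 \<le> N" using x0 by (auto simp: R_def good_def)
  have good_c: "\<exists>n\<le>N. PF c n x" if x: "good x" for x
  proof -
    obtain y where y: "\<not> ZG y" "R x y" "R x0 y" using pair[OF x x0] by blast
    from y x obtain c1 n1 m1 where 1: "n1 + m1 \<le> N" "PF c1 n1 x" "PG c1 m1 y" by (auto simp: R_def good_def)
    from y x0 obtain c2 n2 m2 where 2: "PF c2 n2 x0" "PG c2 m2 y" by (auto simp: R_def good_def)
    have "c2 = c" using uniq(1) 2(1) c(1) x0 by (auto simp: good_def)
    moreover have "c1 = c2" using uniq(2) y(1) 1(3) 2(2) by blast
    ultimately show ?thesis using 1 by (intro exI[of _ n1]) auto
  qed
  define deg where "deg x = (LEAST n. PF c n x)" for x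
  have deg: "PF c (deg x) x" "deg x \<le> N" if "good x" for x
  proof -
    show "PF c (deg x) x" unfolding deg_def using good_c[OF that] by (metis LeastI_ex)
    show "deg x \<le> N" using good_c[OF that] unfolding deg_def by (metis Least_le order_trans)
  qed
  define a where "a = Max (deg ` {x. good x})"
  have fin: "finite (deg ` {x. good x})" by (rule finite_subset[of _ "{..N}"]) (auto simp: deg(2))
  moreover have "deg ` {x. good x} \<noteq> {}" using x0 by auto
  ultimately have "a \<in> deg ` {x. good x}" unfolding a_def by (rule Max_in)
  then obtain xa where xa: "good xa" "deg xa = a" by auto
  have "AE y in K. ZG y \<or> PG c (N - a) y"
  proof -
    have "AE y in K. R xa y" using xa by (simp add: good_def)
    then show ?thesis
    proof eventually_elim
      case (elim y)
      show ?case
      proof (rule disjCI)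
        assume "\<not> PG c (N - a) y"
        show "ZG y"
        proof (rule ccontr)
          assume "\<not> ZG y"
          with elim xa(1) obtain c1 n m where 1: "n + m \<le> N" "PF c1 n xa" "PG c1 m y" by (auto simp: R_def good_def)
          have "c1 = c" using uniq(1) 1(2) deg(1)[OF xa(1)] xa(1) by (auto simp: good_def)
          then have "a \<le> n" using 1(2) xa(2) unfolding deg_def by (metis Least_le)
          then have "m \<le> N - a" using 1(1) by simp
          then show False using mono(2) 1(3) \<open>c1 = c\<close> \<open>\<not> PG c (N - a) y\<close> by blast
        qed
      qed
    qed
  qed
  moreover have "AE x in M. ZF x \<or> PF c a x"
    using ae_good
  proof eventually_elim
    case (elim x)
    moreover have "deg x \<le> a" if "good x" unfolding a_def using fin that by (intro Max_ge) auto
    ultimately show ?case using deg(1) mono(1) by blast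
  qed
  moreover have "a + (N - a) \<le> N" using deg(2)[OF xa(1)] xa(2) by simp
  ultimately show thesis using that by blast
qed

section \<open>Uniqueness of the Gaussian and measurable recovery of the polynomial\<close>

lemma poly_upto_mono:
  assumes "poly_upto n P" "n \<le> n'"
  shows "poly_upto n' P"
proof -
  from assms obtain a where "\<And>x. P x = (\<Sum>m\<in>{m. (\<Sum>i\<in>UNIV. m i) \<le> n}. a m * monomial_fun m x)"
    unfolding poly_upto_def by blast
  then show ?thesis
    using assms(2) by (intro poly_upto_sumI[OF finite_multiindices[of n], of "\<lambda>m. m"]) auto
qed

lemma poly_upto_imp_is_poly: "poly_upto n P \<Longrightarrow> is_poly P"
  unfolding is_poly_def by blast

lemma gaussian_nonzero [simp]: "gaussian x0 w0 A x \<noteq> 0"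
  by (simp add: gaussian_def)

lemma continuous_on_gaussian [continuous_intros]: "continuous_on S (gaussian x0 w0 A)"
  unfolding gaussian_def[abs_def] cdot_def cvec_def matrix_vector_mult_def
  by (auto intro!: continuous_intros)

text \<open>Both representations are continuous, so they agree everywhere. On a line parallel to an
  axis they become exponential polynomials after a common factor exp (- pi t^2) is removed, and
  uniqueness of exponents gives one coordinate of u + i v at a time.\<close>

lemma poly_gauss_unique:
  fixes F :: "real ^ 'k \<Rightarrow> complex"
  assumes nz: "\<not> (AE t in lborel. F t = 0)" and pg: "poly_gauss u v n F" "poly_gauss u' v' n' F"
  shows "u = u' \<and> v = v'"
proof -
  from pg obtain P P' where P: "is_poly P" "AE t in lborel. F t = P t * gaussian (cvec u) (cvec v) (mat 1) t"
    and P': "is_poly P'" "AE t in lborel. F t = P' t * gaussian (cvec u') (cvec v') (mat 1) t"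
    unfolding poly_gauss_def using poly_upto_imp_is_poly by blast
  define \<kappa> \<kappa>' where "\<kappa> = cvec u + \<i> *s cvec v" and "\<kappa>' = cvec u' + \<i> *s cvec v'"
  define k k' where "k = complex_of_real (exp (pi * (u \<bullet> u)))" and "k' = complex_of_real (exp (pi * (u' \<bullet> u')))"
  have uv: "re_vec \<kappa> = u" "im_vec \<kappa> = v" "re_vec \<kappa>' = u'" "im_vec \<kappa>' = v'"
    by (simp_all add: \<kappa>_def \<kappa>'_def re_im_vec_simps)
  have cg: "cgauss \<kappa> t = k * gaussian (cvec u) (cvec v) (mat 1) t" "cgauss \<kappa>' t = k' * gaussian (cvec u') (cvec v') (mat 1) t" for t
    unfolding cgauss_eq_gaussian uv k_def k'_def by simp_all
  have k0: "k \<noteq> 0" "k' \<noteq> 0" by (simp_all add: k_def k'_def)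
  have eq: "P t * gaussian (cvec u) (cvec v) (mat 1) t = P' t * gaussian (cvec u') (cvec v') (mat 1) t" for t
  proof -
    let ?C = "{t. P t * gaussian (cvec u) (cvec v) (mat 1) t = P' t * gaussian (cvec u') (cvec v') (mat 1) t}"
    \<comment> \<open>A closed set of full Lebesgue measure is the whole space.\<close>
    have "closed ?C"
      using P(1) P'(1) by (intro closed_Collect_eq continuous_intros continuous_on_is_poly)
    moreover have "AE t in lborel. t \<in> ?C" using P(2) P'(2) by eventually_elim auto
    then have "AE t in lebesgue. t \<in> ?C" by (rule AE_completion)
    ultimately show ?thesis using mem_closed_if_AE_lebesgue by blast
  qed
  obtain t0 where t0: "P t0 \<noteq> 0"
  proof (rule ccontr)
    assume "\<not> thesis"
    then have "P t = 0" for t using that by blast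
    then show False using P(2) nz by simp
  qed
  have "\<kappa> $ i = \<kappa>' $ i" for i
  proof -
    obtain p p' where p: "\<And>r. P (t0 + r *\<^sub>R axis i 1) = poly p (of_real r)" and p': "\<And>r. P' (t0 + r *\<^sub>R axis i 1) = poly p' (of_real r)"
      using poly_line[OF P(1)] poly_line[OF P'(1)] by metis
    have "p \<noteq> 0" using p[of 0] t0 by auto
    have ce: "cdot (cvec (t0 + r *\<^sub>R axis i 1)) y = cdot (cvec t0) y + of_real r * y $ i" for r and y :: "complex ^ 'k"
    proof -
      have "cdot (cvec (axis i 1)) y = (\<Sum>j\<in>UNIV. if j = i then y $ j else 0)"
        unfolding cdot_def cvec_def by (intro sum.cong) (auto simp: axis_def)
      then show ?thesis by (simp add: cdot_simps)
    qed
    \<comment> \<open>The constants are crossed: multiplying the equation by k k' turns both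
      Gaussians into \<open>cgauss\<close>, which leaves k' on the left and k on the right.\<close>
    define e e' where "e = k' * exp (2 * pi * cdot (cvec t0) \<kappa>)" and "e' = k * exp (2 * pi * cdot (cvec t0) \<kappa>')"
    have "poly (smult e p) (of_real r) * exp (2 * pi * \<kappa> $ i * of_real r) = poly (smult e' p') (of_real r) * exp (2 * pi * \<kappa>' $ i * of_real r)" for r
    proof -
      define t where "t = t0 + r *\<^sub>R axis i 1"
      define E where "E = exp (- complex_of_real (pi * (t \<bullet> t)))"
      have E: "E \<noteq> 0" by (simp add: E_def)
      have c: "cgauss y t = E * exp (2 * pi * cdot (cvec t0) y) * exp (2 * pi * y $ i * of_real r)" for y
        unfolding cgauss_def E_def t_def ce by (simp add: exp_add[symmetric] algebra_simps)
      have "k' * (P t * cgauss \<kappa> t) = k * (P' t * cgauss \<kappa>' t)"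
        unfolding cg using eq[of t] by (simp add: mult_ac)
      then have "E * (poly (smult e p) (of_real r) * exp (2 * pi * \<kappa> $ i * of_real r)) = E * (poly (smult e' p') (of_real r) * exp (2 * pi * \<kappa>' $ i * of_real r))"
        unfolding c using p[of r] p'[of r] by (simp add: t_def e_def e'_def mult_ac)
      then show ?thesis using E by simp
    qed
    then have "2 * pi * \<kappa> $ i = 2 * pi * \<kappa>' $ i"
      using exp_poly_unique[of "smult e p" "2 * pi * \<kappa> $ i" "smult e' p'" "2 * pi * \<kappa>' $ i"] \<open>p \<noteq> 0\<close> k0 by (simp add: e_def)
    then show ?thesis by simp
  qed
  then have "\<kappa> = \<kappa>'" by (simp add: vec_eq_iff)
  then show ?thesis using uv by metis
qed

lemma AE_lborel_scale_shift:
  fixes t :: "'a::euclidean_space"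
  assumes "AE x in lborel. P x" "c \<noteq> 0"
  shows "AE h in lborel. P (t + c *\<^sub>R h)"
proof -
  let ?D = "distr lborel borel (\<lambda>x. t + c *\<^sub>R x)"
  have "AE x in density ?D (\<lambda>_. ennreal (\<bar>c\<bar> ^ DIM('a))). P x"
    by (subst lborel_affine[OF assms(2), symmetric]) (rule assms(1))
  then have ae: "AE x in ?D. P x" using assms(2) by (simp add: AE_density)
  have "(\<lambda>x. t + c *\<^sub>R x) \<in> lborel \<rightarrow>\<^sub>M borel" by measurable
  then show ?thesis using ae by (rule AE_distrD)
qed

text \<open>The polynomial representing a slice is recovered from the slice by a formula, so that it
  depends measurably on the slice.\<close>

definition local_average :: "(real ^ 'k \<Rightarrow> complex) \<Rightarrow> real ^ 'k \<Rightarrow> complex" where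
  "local_average F x = lim (\<lambda>n. \<integral>h. indicator (cbox 0 1) h *\<^sub>R F (x + (1 / real (Suc n)) *\<^sub>R h) \<partial>lborel)"

lemma cbox_01_vec: "emeasure lborel (cbox 0 (1 :: real ^ 'k)) = 1"
proof -
  have "b \<in> Basis \<Longrightarrow> (0 :: real ^ 'k) \<bullet> b \<le> 1 \<bullet> b" and "b \<in> Basis \<Longrightarrow> (1 - 0 :: real ^ 'k) \<bullet> b = 1" for b
    by (auto simp: Basis_vec_def inner_axis)
  then show ?thesis by (subst emeasure_lborel_cbox) auto
qed

text \<open>The integrals are averages over shrinking cubes with corner x, as the unit cube has
  measure 1. Under the integral F may be replaced by P, whose continuity yields the value at every x
  and not merely at almost every x.\<close>

lemma local_average_AE_eq:
  fixes P :: "real ^ 'k \<Rightarrow> complex"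
  assumes P: "continuous_on UNIV P" and ae: "AE t in lborel. F t = P t" and F: "F \<in> borel_measurable borel"
  shows "local_average F x = P x"
proof -
  note [measurable] = F
  have Pm [measurable]: "P \<in> borel_measurable borel" using P by (rule borel_measurable_continuous_onI)
  have I: "(\<integral>h. indicator (cbox 0 1) h *\<^sub>R F (x + (1 / real (Suc n)) *\<^sub>R h) \<partial>lborel)
      = (\<integral>h. indicator (cbox 0 1) h *\<^sub>R P (x + (1 / real (Suc n)) *\<^sub>R h) \<partial>lborel)" for n
  proof (rule integral_cong_AE)
    have "AE h in lborel. F (x + (1 / real (Suc n)) *\<^sub>R h) = P (x + (1 / real (Suc n)) *\<^sub>R h)"
      by (rule AE_lborel_scale_shift[OF ae]) simp
    then show "AE h in lborel. indicator (cbox 0 1) h *\<^sub>R F (x + (1 / real (Suc n)) *\<^sub>R h) = indicator (cbox 0 1) h *\<^sub>R P (x + (1 / real (Suc n)) *\<^sub>R h)"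
      by eventually_elim simp
  qed measurable
  let ?K = "{0..1 :: real} \<times> cbox 0 (1 :: real ^ 'k)"
  have "continuous_on ?K (\<lambda>z. P (x + fst z *\<^sub>R snd z))"
    by (rule continuous_on_compose2[OF P]) (auto intro!: continuous_intros)
  then have "bounded ((\<lambda>z. P (x + fst z *\<^sub>R snd z)) ` ?K)"
    by (intro compact_imp_bounded compact_continuous_image compact_Times compact_cbox compact_Icc)
  then obtain B where B': "\<And>z. z \<in> ?K \<Longrightarrow> norm (P (x + fst z *\<^sub>R snd z)) \<le> B"
    unfolding bounded_iff by blast
  have B: "norm (P (x + c *\<^sub>R h)) \<le> B" if "c \<in> {0..1}" "h \<in> cbox 0 1" for c h
    using B'[of "(c, h)"] that by simp
  have "(\<lambda>n. \<integral>h. indicator (cbox 0 1) h *\<^sub>R P (x + (1 / real (Suc n)) *\<^sub>R h) \<partial>lborel) \<longlonglongrightarrow> (\<integral>h. indicator (cbox 0 (1 :: real ^ 'k)) h *\<^sub>R P x \<partial>lborel)"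
  proof (rule integral_dominated_convergence[where w = "\<lambda>h. indicator (cbox 0 1) h * B"])
    show "integrable lborel (\<lambda>h :: real ^ 'k. indicator (cbox 0 1) h * B)"
      by (intro integrable_mult_left integrable_real_indicator) (auto simp: cbox_01_vec)
    show "AE h in lborel. (\<lambda>n. indicator (cbox 0 1) h *\<^sub>R P (x + (1 / real (Suc n)) *\<^sub>R h)) \<longlonglongrightarrow> indicator (cbox 0 1) h *\<^sub>R P x"
    proof (intro AE_I2 tendsto_scaleR tendsto_const)
      fix h :: "real ^ 'k"
      have "(\<lambda>n. x + (1 / real (Suc n)) *\<^sub>R h) \<longlonglongrightarrow> x + 0 *\<^sub>R h"
        using LIMSEQ_inverse_real_of_nat by (intro tendsto_intros) (simp add: inverse_eq_divide)
      moreover have "isCont P (x + 0 *\<^sub>R h)" using P by (simp add: continuous_on_eq_continuous_at)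
      ultimately show "(\<lambda>n. P (x + (1 / real (Suc n)) *\<^sub>R h)) \<longlonglongrightarrow> P x"
        using isCont_tendsto_compose by fastforce
    qed
    show "AE h in lborel. norm (indicator (cbox 0 1) h *\<^sub>R P (x + (1 / real (Suc n)) *\<^sub>R h)) \<le> indicator (cbox 0 1) h * B" for n
      using B[of "1 / real (Suc n)"] by (auto split: split_indicator)
  qed measurable
  also have "(\<integral>h. indicator (cbox 0 (1 :: real ^ 'k)) h *\<^sub>R P x \<partial>lborel) = P x"
    by (simp add: measure_def cbox_01_vec)
  finally show ?thesis unfolding local_average_def I by (rule limI)
qed

section \<open>Agreement of the two notions of polynomial\<close>

lemma is_poly_imp_polynomial_function:
  assumes "is_poly P"
  shows "polynomial_function P"
proof -
  from assms obtain n a where P: "\<And>x. P x = (\<Sum>m\<in>{m. (\<Sum>i\<in>UNIV. m i) \<le> n}. a m * monomial_fun m x)"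
    unfolding is_poly_def poly_upto_def by blast
  define R where "R m x = (\<Prod>i\<in>UNIV. (x $ i) ^ m i)" for m :: "'a \<Rightarrow> nat" and x :: "real ^ 'a"
  have m: "monomial_fun m x = of_real (R m x)" for m x
    by (simp add: monomial_fun_def R_def)
  have R: "real_polynomial_function (R m)" for m
    unfolding R_def
    by (intro real_polynomial_function_prod real_polynomial_function_power real_polynomial_function.intros(1) bounded_linear_vec_nth) auto
  have "real_polynomial_function (\<lambda>x. \<Sum>m\<in>{m. (\<Sum>i\<in>UNIV. m i) \<le> n}. c m * R m x)" for c
    by (intro real_polynomial_function_sum real_polynomial_function.intros(4) real_polynomial_function.intros(2) R finite_multiindices)
  then show ?thesis
    unfolding polynomial_function_iff_Basis_inner Basis_complex_def
    by (simp add: P m inner_complex_def)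
qed

lemma polynomial_function_imp_is_poly:
  fixes P :: "real ^ 'k \<Rightarrow> complex"
  assumes "polynomial_function P"
  shows "is_poly P"
proof -
  have real: "is_poly (\<lambda>x. complex_of_real (q x))" if "real_polynomial_function q" for q :: "real ^ 'k \<Rightarrow> real"
    using that
  proof induction
    case (linear f)
    then have fx: "f x = (\<Sum>i\<in>UNIV. x $ i * f (axis i 1))" for x
    proof -
      have "f x = f (\<Sum>i\<in>UNIV. (x $ i) *\<^sub>R axis i 1)"
        by (rule arg_cong[of _ _ f]) (simp add: vec_eq_iff axis_def if_distrib cong: if_cong)
      also have "\<dots> = (\<Sum>i\<in>UNIV. x $ i * f (axis i 1))"
        using linear by (simp add: linear_sum bounded_linear.linear linear_cmul)
      finally show ?thesis .
    qed
    have "complex_of_real (f x) = (\<Sum>i\<in>UNIV. of_real (x $ i) * of_real (f (axis i 1)))" for x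
      by (subst fx) simp
    then have "(\<lambda>x. complex_of_real (f x)) = (\<lambda>x. \<Sum>i\<in>UNIV. of_real (x $ i) * of_real (f (axis i 1)))"
      by (rule ext)
    moreover have "is_poly (\<lambda>x. \<Sum>i\<in>UNIV. of_real (x $ i) * of_real (f (axis i 1)))"
      by (intro is_poly_sum is_poly_mult is_poly_coord is_poly_const)
    ultimately show ?case by (simp only:)
  qed (auto intro: is_poly_add is_poly_mult)
  have "real_polynomial_function (\<lambda>x. Re (P x))" "real_polynomial_function (\<lambda>x. Im (P x))"
    using assms unfolding polynomial_function_iff_Basis_inner Basis_complex_def by (auto simp: inner_complex_def)
  then have "is_poly (\<lambda>x. complex_of_real (Re (P x)) + \<i> * complex_of_real (Im (P x)))"
    by (intro is_poly_add is_poly_mult is_poly_const real)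
  then show ?thesis by (simp add: complex_eq[symmetric])
qed

text \<open>Here r is the norm of the first variables and S the squared norm of the fixed slice
  variables. At \<alpha> \<ge> 1 the weight of S goes into the constant. At \<alpha> > 1 the surplus
  exp (- pi (\<alpha> - 1) n^2 / 2) absorbs (1 + n)^(N + 1), which trades the exponent N for
  -1.\<close>

lemma decay_bound_slice:
  fixes r S c N \<alpha> :: real
  assumes "r \<ge> 0" "S \<ge> 0" "c > 0" "N \<ge> 0"
  defines "n \<equiv> sqrt (r\<^sup>2 + S)"
  shows "\<alpha> \<ge> 1 \<Longrightarrow> c * (1 + n) powr N * exp (- pi * \<alpha> * n\<^sup>2 / 2) \<le> (c * (1 + sqrt S) powr N) * (1 + r) powr N * exp (- pi * r\<^sup>2 / 2)"
    and "\<alpha> > 1 \<Longrightarrow> c * (1 + n) powr N * exp (- pi * \<alpha> * n\<^sup>2 / 2)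
       \<le> (c * exp ((N + 1)\<^sup>2 / (2 * pi * (\<alpha> - 1)))) * (1 + r) powr (- 1) * exp (- pi * r\<^sup>2 / 2)"
proof -
  have n0: "n \<ge> 0" using assms by simp
  have n2: "n\<^sup>2 = r\<^sup>2 + S" using assms by simp
  have rn: "r \<le> n" unfolding n_def using assms by (intro real_le_rsqrt) auto
  have exp_le: "exp (- pi * n\<^sup>2 / 2) \<le> exp (- pi * r\<^sup>2 / 2)" using n2 assms by simp
  {
    assume \<alpha>: "\<alpha> \<ge> 1"
    have "n \<le> r + sqrt S"
      unfolding n_def using sqrt_add_le_add_sqrt[of "r\<^sup>2" S] assms by simp
    moreover have "0 \<le> r * sqrt S" using assms by simp
    ultimately have "1 + n \<le> (1 + sqrt S) * (1 + r)" by (simp add: algebra_simps)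
    then have "(1 + n) powr N \<le> ((1 + sqrt S) * (1 + r)) powr N" using assms n0 by (intro powr_mono2) auto
    then have 1: "(1 + n) powr N \<le> (1 + sqrt S) powr N * (1 + r) powr N" using assms by (simp add: powr_mult)
    have "1 * (pi * n\<^sup>2) \<le> \<alpha> * (pi * n\<^sup>2)" using \<alpha> by (intro mult_right_mono) auto
    then have "exp (- pi * \<alpha> * n\<^sup>2 / 2) \<le> exp (- pi * n\<^sup>2 / 2)" by (simp add: mult_ac)
    with exp_le have "exp (- pi * \<alpha> * n\<^sup>2 / 2) \<le> exp (- pi * r\<^sup>2 / 2)" by linarith
    with 1 have "(1 + n) powr N * exp (- pi * \<alpha> * n\<^sup>2 / 2) \<le> (1 + sqrt S) powr N * (1 + r) powr N * exp (- pi * r\<^sup>2 / 2)"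
      by (intro mult_mono) auto
    then show "c * (1 + n) powr N * exp (- pi * \<alpha> * n\<^sup>2 / 2) \<le> (c * (1 + sqrt S) powr N) * (1 + r) powr N * exp (- pi * r\<^sup>2 / 2)"
      using assms(3) by (simp add: mult.assoc)
  }
  {
    assume \<alpha>: "\<alpha> > 1"
    \<comment> \<open>The surplus rate; completing the square for (N + 1) n against b n^2 gives the
      constant (N + 1)^2 / (4 b).\<close>
    define b where "b = pi * (\<alpha> - 1) / 2"
    have b: "b > 0" using \<alpha> by (simp add: b_def)
    have "0 \<le> b * (n - (N + 1) / (2 * b))\<^sup>2" using b by simp
    also have "\<dots> = b * n\<^sup>2 - (N + 1) * n + (N + 1)\<^sup>2 / (4 * b)"
      using b by (simp add: power2_eq_square field_simps)
    finally have sq: "(N + 1) * n \<le> b * n\<^sup>2 + (N + 1)\<^sup>2 / (4 * b)" by simp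
    have "(1 + n) powr (N + 1) \<le> exp n powr (N + 1)"
      using n0 assms exp_ge_add_one_self[of n] by (intro powr_mono2) auto
    also have "\<dots> = exp ((N + 1) * n)" by (simp add: powr_def)
    also have "\<dots> \<le> exp (b * n\<^sup>2 + (N + 1)\<^sup>2 / (4 * b))" using sq by simp
    finally have 1: "(1 + n) powr (N + 1) \<le> exp (b * n\<^sup>2) * exp ((N + 1)\<^sup>2 / (4 * b))" by (simp add: exp_add)
    have 2: "(1 + n) powr (- 1) \<le> (1 + r) powr (- 1)" using rn assms by (intro powr_mono2') auto
    have "(1 + n) powr N = (1 + n) powr ((N + 1) + - 1)" by simp
    also have "\<dots> = (1 + n) powr (N + 1) * (1 + n) powr (- 1)" by (rule powr_add)
    also have "\<dots> \<le> exp (b * n\<^sup>2) * exp ((N + 1)\<^sup>2 / (4 * b)) * (1 + r) powr (- 1)"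
      using 1 2 by (intro mult_mono) auto
    finally have "(1 + n) powr N * exp (- pi * \<alpha> * n\<^sup>2 / 2) \<le> exp (b * n\<^sup>2) * exp ((N + 1)\<^sup>2 / (4 * b)) * (1 + r) powr (- 1) * exp (- pi * \<alpha> * n\<^sup>2 / 2)"
      by (intro mult_right_mono) auto
    also have "\<dots> = exp ((N + 1)\<^sup>2 / (4 * b)) * (1 + r) powr (- 1) * (exp (b * n\<^sup>2) * exp (- pi * \<alpha> * n\<^sup>2 / 2))"
      by (simp only: mult_ac)
    also have "exp (b * n\<^sup>2) * exp (- pi * \<alpha> * n\<^sup>2 / 2) = exp (- pi * n\<^sup>2 / 2)"
      by (simp add: mult_exp_exp b_def field_simps)
    also have "exp ((N + 1)\<^sup>2 / (4 * b)) * (1 + r) powr (- 1) * exp (- pi * n\<^sup>2 / 2) \<le> exp ((N + 1)\<^sup>2 / (4 * b)) * (1 + r) powr (- 1) * exp (- pi * r\<^sup>2 / 2)"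
      by (intro mult_left_mono exp_le) auto
    also have "4 * b = 2 * pi * (\<alpha> - 1)" by (simp add: b_def)
    finally have "(1 + n) powr N * exp (- pi * \<alpha> * n\<^sup>2 / 2) \<le> exp ((N + 1)\<^sup>2 / (2 * pi * (\<alpha> - 1))) * (1 + r) powr (- 1) * exp (- pi * r\<^sup>2 / 2)" .
    then have "c * ((1 + n) powr N * exp (- pi * \<alpha> * n\<^sup>2 / 2)) \<le> c * (exp ((N + 1)\<^sup>2 / (2 * pi * (\<alpha> - 1))) * (1 + r) powr (- 1) * exp (- pi * r\<^sup>2 / 2))"
      using assms(3) by (intro mult_left_mono) auto
    then show "c * (1 + n) powr N * exp (- pi * \<alpha> * n\<^sup>2 / 2)
       \<le> (c * exp ((N + 1)\<^sup>2 / (2 * pi * (\<alpha> - 1)))) * (1 + r) powr (- 1) * exp (- pi * r\<^sup>2 / 2)"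
      by (simp only: mult.assoc)
  }
qed

section \<open>Reduction to slices and joint representation\<close>

lemma pair_sigma_finite_Rn: "pair_sigma_finite (lborel :: (real ^ 'k) measure) (Rn m)"
  using sigma_finite_Rn lborel.sigma_finite_measure_axioms by (simp add: pair_sigma_finite_def)

lemma ae_zero_Rd_iff:
  fixes f :: "(real ^ 'k) \<times> (nat \<Rightarrow> real) \<Rightarrow> complex"
  assumes [measurable]: "f \<in> borel_measurable (Rd d)"
  shows "ae_zero (Rd d) f \<longleftrightarrow> (AE x2 in Rn (d - CARD('k)). AE t in lborel. f (t, x2) = 0)"
proof -
  have [measurable]: "f \<in> borel_measurable (lborel \<Otimes>\<^sub>M Rn (d - CARD('k)))" using assms unfolding Rd_def .
  show ?thesis
    unfolding ae_zero_def Rd_def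
    by (rule pair_sigma_finite.AE_pair_swapped[OF pair_sigma_finite_Rn]) measurable
qed

lemma L2_slice:
  fixes f :: "(real ^ 'k) \<times> (nat \<Rightarrow> real) \<Rightarrow> complex"
  assumes "L2 (Rd d) f"
  shows "AE x2 in Rn (d - CARD('k)). L2 lborel (\<lambda>t. f (t, x2))"
proof -
  interpret P: pair_sigma_finite "lborel :: (real ^ 'k) measure" "Rn (d - CARD('k))"
    by (rule pair_sigma_finite_Rn)
  have [measurable]: "f \<in> borel_measurable (lborel \<Otimes>\<^sub>M Rn (d - CARD('k)))"
    and i: "integrable (lborel \<Otimes>\<^sub>M Rn (d - CARD('k))) (\<lambda>(t, x2). (cmod (f (t, x2)))\<^sup>2)"
    using assms unfolding L2_def Rd_def by (auto simp: case_prod_unfold)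
  from P.AE_integrable_snd[OF i] AE_space[of "Rn (d - CARD('k))"] show ?thesis
  proof eventually_elim
    case (elim x2)
    then have [measurable]: "x2 \<in> space (Rn (d - CARD('k)))" by simp
    have "(\<lambda>t. f (t, x2)) \<in> borel_measurable lborel" by measurable
    then show ?case using elim(1) by (simp add: L2_def)
  qed
qed

text \<open>For almost every pair of slices the partial transform is the ordinary one of the two
  slices, with decay at the critical rate. The exponent N' is N in general and may be taken as -1
  when \<alpha> > 1.\<close>

lemma slice_dichotomy:
  fixes f g :: "(real ^ 'k) \<times> (nat \<Rightarrow> real) \<Rightarrow> complex"
  assumes f: "L2 (Rd d) f" and g: "L2 (Rd d) g" and c: "c > 0" and N: "N \<ge> 0"
    and decay: "AE l in Rd d \<Otimes>\<^sub>M Rd d.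
      cmod (partial_stft d g f l)
        \<le> c * (1 + norm_R2d d l) powr N * exp (- pi * \<alpha> * (norm_R2d d l)\<^sup>2 / 2)"
    and N': "\<alpha> \<ge> 1 \<and> N' = N \<or> \<alpha> > 1 \<and> N' = - 1"
  shows "AE x2 in Rn (d - CARD('k)). AE y2 in Rn (d - CARD('k)).
     (AE t in lborel. f (t, x2) = 0) \<or> (AE t in lborel. g (t, y2) = 0) \<or>
     (\<exists>u v n m. real (n + m) \<le> N' \<and> poly_gauss u v n (\<lambda>t. f (t, x2)) \<and> poly_gauss u v m (\<lambda>t. g (t, y2)))"
proof -
  let ?R = "Rn (d - CARD('k))"
  define S where "S x = (\<Sum>i<d - CARD('k). (x i)\<^sup>2)" for x :: "nat \<Rightarrow> real"
  have S0: "S x \<ge> 0" for x by (simp add: S_def sum_nonneg)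
  have norm: "norm_R2d d ((x1, x2), (w1, w2)) = sqrt ((norm (x1, w1))\<^sup>2 + (S x2 + S w2))" for x1 w1 :: "real ^ 'k" and x2 w2
    using S0[of x2] S0[of w2] by (simp add: norm_R2d_def norm_Rd_def S_def norm_prod_def add_ac)
  have "AE x2 in ?R. AE w2 in ?R. AE x1 in lborel. AE w1 in lborel.
      cmod (partial_stft d g f ((x1, x2), (w1, w2)))
        \<le> c * (1 + norm_R2d d ((x1, x2), (w1, w2))) powr N * exp (- pi * \<alpha> * (norm_R2d d ((x1, x2), (w1, w2)))\<^sup>2 / 2)"
    using decay unfolding Rd_def
    by (intro AE_rearrange lborel.sigma_finite_measure_axioms sigma_finite_Rn)
  with L2_slice[OF f] show ?thesis
  proof eventually_elim
    case (elim x2)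
    \<comment> \<open>The transform evaluates g at the reflected variable. Everything is proved for
      that slice, and invariance of the measure under reflection removes the sign at the
      end.\<close>
    have "AE w2 in ?R. L2 lborel (\<lambda>t. g (t, uminus_Rn (d - CARD('k)) w2))"
      using L2_slice[OF g] by (subst AE_uminus_Rn)
    with elim(2) have "AE w2 in ?R. (AE t in lborel. f (t, x2) = 0) \<or> (AE t in lborel. g (t, uminus_Rn (d - CARD('k)) w2) = 0) \<or>
     (\<exists>u v n m. real (n + m) \<le> N' \<and> poly_gauss u v n (\<lambda>t. f (t, x2)) \<and> poly_gauss u v m (\<lambda>t. g (t, uminus_Rn (d - CARD('k)) w2)))"
    proof eventually_elim
      case (elim w2)
      define F where "F t = f (t, x2)" for t
      define G where "G t = g (t, uminus_Rn (d - CARD('k)) w2)" for t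
      define T where "T = S x2 + S w2"
      have T: "T \<ge> 0" using S0 by (simp add: T_def)
      \<comment> \<open>Since N \<ge> 0, the first branch is never taken for N' = -1. Its constant
        depends on the pair of slices, which is harmless because they are fixed.\<close>
      define C where "C = (if N' = N \<and> \<alpha> \<ge> 1 then c * (1 + sqrt T) powr N else c * exp ((N + 1)\<^sup>2 / (2 * pi * (\<alpha> - 1))))"
      have C: "C \<ge> 0" using c T by (auto simp: C_def)
      have "AE x1 in lborel. AE w1 in lborel.
        cmod (stft G F x1 w1) \<le> C * (1 + norm (x1, w1)) powr N' * exp (- pi * (x1 \<bullet> x1 + w1 \<bullet> w1) / 2)"
        using elim(1)
      proof (rule eventually_mono)
        fix x1 :: "real ^ 'k"
        assume "AE w1 in lborel. cmod (partial_stft d g f ((x1, x2), (w1, w2)))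
          \<le> c * (1 + norm_R2d d ((x1, x2), (w1, w2))) powr N * exp (- pi * \<alpha> * (norm_R2d d ((x1, x2), (w1, w2)))\<^sup>2 / 2)"
        then show "AE w1 in lborel. cmod (stft G F x1 w1) \<le> C * (1 + norm (x1, w1)) powr N' * exp (- pi * (x1 \<bullet> x1 + w1 \<bullet> w1) / 2)"
        proof eventually_elim
          case (elim w1)
          define r where "r = norm (x1, w1)"
          have r: "r \<ge> 0" "r\<^sup>2 = x1 \<bullet> x1 + w1 \<bullet> w1" by (simp_all add: r_def norm_prod_def power2_norm_eq_inner)
          have "stft G F x1 w1 = partial_stft d g f ((x1, x2), (w1, w2))"
            by (simp add: stft_def partial_stft_def F_def G_def)
          also have "cmod \<dots> \<le> c * (1 + sqrt (r\<^sup>2 + T)) powr N * exp (- pi * \<alpha> * (sqrt (r\<^sup>2 + T))\<^sup>2 / 2)"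
            using elim unfolding norm r_def T_def .
          also have "\<dots> \<le> C * (1 + r) powr N' * exp (- pi * r\<^sup>2 / 2)"
          proof (cases "N' = N \<and> \<alpha> \<ge> 1")
            case True
            then show ?thesis using decay_bound_slice(1)[OF r(1) T c N, of \<alpha>] by (simp add: C_def)
          next
            case False
            then have "N' = - 1" "\<alpha> > 1" using N' by auto
            then show ?thesis using decay_bound_slice(2)[OF r(1) T c N, of \<alpha>] N by (simp add: C_def)
          qed
          finally show ?case by (simp only: r(2)[symmetric] r_def)
        qed
      qed
      moreover have "L2 lborel F" "L2 lborel G" using \<open>L2 lborel (\<lambda>t. f (t, x2))\<close> elim(2) by (simp_all add: F_def[abs_def] G_def[abs_def])
      ultimately show ?case using stft_hardy[OF _ _ C] unfolding F_def G_def by blast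
    qed
    then show ?case by (subst (asm) AE_uminus_Rn)
  qed
qed

text \<open>Passing from almost every slice to almost every point requires the set of equality to be
  measurable, which an arbitrary choice of one polynomial per slice does not ensure. The averaging
  formula yields a jointly measurable p that equals the right polynomial on almost every
  slice.\<close>

lemma slices_imp_joint_representation:
  fixes f :: "(real ^ 'k) \<times> (nat \<Rightarrow> real) \<Rightarrow> complex"
  assumes f: "f \<in> borel_measurable (Rd d)"
    and ae: "AE x2 in Rn (d - CARD('k)). poly_gauss u v a (\<lambda>t. f (t, x2))"
  obtains p where "AE x in Rd d. f x = p x * gaussian (cvec u) (cvec v) (mat 1) (fst x)"
    "AE x2 in Rn (d - CARD('k)). poly_upto a (\<lambda>x1. p (x1, x2))"
proof -
  let ?R = "Rn (d - CARD('k))" and ?\<gamma> = "gaussian (cvec u) (cvec v) (mat 1) :: real ^ 'k \<Rightarrow> complex"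
  have fm [measurable]: "f \<in> borel_measurable (lborel \<Otimes>\<^sub>M ?R)" using f unfolding Rd_def .
  have \<gamma>m [measurable]: "?\<gamma> \<in> borel_measurable borel"
    by (rule borel_measurable_continuous_onI[OF continuous_on_gaussian])
  define p where "p = (\<lambda>(x1, x2). local_average (\<lambda>t. f (t, x2) / ?\<gamma> t) x1)"
  have pm [measurable]: "p \<in> borel_measurable (lborel \<Otimes>\<^sub>M ?R)"
    unfolding p_def local_average_def case_prod_unfold
    by (intro borel_measurable_lim_metric lborel.borel_measurable_lebesgue_integral) measurable
  have eq: "AE x2 in ?R. \<exists>P. poly_upto a P \<and> (AE t in lborel. f (t, x2) = P t * ?\<gamma> t) \<and> (\<forall>x1. p (x1, x2) = P x1)"
    using ae AE_space[of ?R]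
  proof eventually_elim
    case (elim x2)
    then have [measurable]: "x2 \<in> space ?R" by simp
    from elim(1) obtain P where P: "poly_upto a P" and eq: "AE t in lborel. f (t, x2) = P t * ?\<gamma> t"
      unfolding poly_gauss_def by blast
    have "local_average (\<lambda>t. f (t, x2) / ?\<gamma> t) x1 = P x1" for x1
    proof (rule local_average_AE_eq)
      show "continuous_on UNIV P" using P by (intro continuous_on_is_poly poly_upto_imp_is_poly)
      show "AE t in lborel. f (t, x2) / ?\<gamma> t = P t" using eq by eventually_elim simp
      show "(\<lambda>t. f (t, x2) / ?\<gamma> t) \<in> borel_measurable borel"
      proof -
        have "(\<lambda>t. f (t, x2) / ?\<gamma> t) \<in> borel_measurable lborel" by measurable
        then show ?thesis by simp
      qed
    qed
    then show ?case using P eq by (intro exI[of _ P]) (auto simp: p_def)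
  qed
  show thesis
  proof
    have "AE x2 in ?R. AE t in lborel. f (t, x2) = p (t, x2) * ?\<gamma> (fst (t, x2))"
      using eq
    proof eventually_elim
      case (elim x2)
      then obtain P where P: "AE t in lborel. f (t, x2) = P t * ?\<gamma> t" "\<And>x1. p (x1, x2) = P x1" by blast
      from P(1) show ?case by eventually_elim (simp add: P(2))
    qed
    then show "AE x in Rd d. f x = p x * ?\<gamma> (fst x)"
      unfolding Rd_def by (subst pair_sigma_finite.AE_pair_swapped[OF pair_sigma_finite_Rn]) measurable
    show "AE x2 in ?R. poly_upto a (\<lambda>x1. p (x1, x2))"
      using eq
    proof eventually_elim
      case (elim x2)
      then obtain P where "poly_upto a P" "(\<lambda>x1. p (x1, x2)) = P" by blast
      then show ?case by simp
    qed
  qed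
qed

lemma pos_def_mat_1: "pos_def (mat 1)"
  by (simp add: pos_def_def)

lemma gaussian_form_exists:
  fixes f g :: "(real ^ 'k) \<times> (nat \<Rightarrow> real) \<Rightarrow> complex"
  assumes f: "f \<in> borel_measurable (Rd d)" "AE x2 in Rn (d - CARD('k)). poly_gauss u v a (\<lambda>t. f (t, x2))"
    and g: "g \<in> borel_measurable (Rd d)" "AE x2 in Rn (d - CARD('k)). poly_gauss u v b (\<lambda>t. g (t, x2))"
    and ab: "real (a + b) \<le> N"
  shows "\<exists>p q x0 w0 A. gaussian_form d N f g p q x0 w0 A"
proof -
  let ?R = "Rn (d - CARD('k))"
  obtain p where p: "AE x in Rd d. f x = p x * gaussian (cvec u) (cvec v) (mat 1) (fst x)"
    "AE x2 in ?R. poly_upto a (\<lambda>x1. p (x1, x2))"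
    using slices_imp_joint_representation[OF f] by blast
  obtain q where q: "AE x in Rd d. g x = q x * gaussian (cvec u) (cvec v) (mat 1) (fst x)"
    "AE x2 in ?R. poly_upto b (\<lambda>x1. q (x1, x2))"
    using slices_imp_joint_representation[OF g] by blast
  interpret pair_sigma_finite ?R ?R using sigma_finite_Rn by (simp add: pair_sigma_finite_def)
  have "AE w2 in ?R. poly_upto b (\<lambda>x1. q (x1, uminus_Rn (d - CARD('k)) w2))"
    using q(2) by (subst AE_uminus_Rn)
  from AE_pair_snd[OF this] AE_pair_fst[OF p(2)]
  have "AE z in ?R \<Otimes>\<^sub>M ?R. polynomial_function (\<lambda>x1. p (x1, fst z)) \<and> polynomial_function (\<lambda>x1. q (x1, uminus_Rn (d - CARD('k)) (snd z))) \<and>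
    real (total_deg (\<lambda>x1. p (x1, fst z)) + total_deg (\<lambda>x1. q (x1, uminus_Rn (d - CARD('k)) (snd z)))) \<le> N"
  proof eventually_elim
    case (elim z)
    from total_deg_le[OF elim(1)] total_deg_le[OF elim(2)] ab show ?case
      using is_poly_imp_polynomial_function[OF poly_upto_imp_is_poly[OF elim(1)]]
        is_poly_imp_polynomial_function[OF poly_upto_imp_is_poly[OF elim(2)]] by simp
  qed
  then have "gaussian_form d N f g p q (cvec u) (cvec v) (mat 1)"
    unfolding gaussian_form_def Let_def case_prod_unfold using pos_def_mat_1 p(1) q(1) by blast
  then show ?thesis by blast
qed

section \<open>The full-dimensional case k = d\<close>

lemma Rn_0: "Rn 0 = count_space {\<lambda>_. undefined}"
  by (simp add: Rn_def PiM_empty)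

lemma polynomial_Rd_full_dimension:
  fixes p :: "(real ^ 'k) \<times> (nat \<Rightarrow> real) \<Rightarrow> complex"
  assumes d: "CARD('k) = d" and p: "polynomial_function (\<lambda>x1. p (x1, \<lambda>_. undefined))"
  shows "polynomial_Rd d p"
proof -
  from polynomial_function_imp_is_poly[OF p] obtain n a where
    a: "\<And>x. p (x, \<lambda>_. undefined) = (\<Sum>m\<in>{m. (\<Sum>i\<in>UNIV. m i) \<le> n}. a m * monomial_fun m x)"
    unfolding is_poly_def poly_upto_def by blast
  let ?M = "{m :: 'k \<Rightarrow> nat. (\<Sum>i\<in>UNIV. m i) \<le> n} \<times> {\<lambda>_ :: nat. 0 :: nat}"
  show ?thesis
    unfolding polynomial_Rd_def
  proof (intro exI conjI ballI)
    show "finite ?M" by (simp add: finite_multiindices)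
    fix x :: "(real ^ 'k) \<times> (nat \<Rightarrow> real)" assume "x \<in> space (Rd d)"
    then have "snd x = (\<lambda>_. undefined)" by (auto simp: Rd_def d Rn_0 space_pair_measure)
    then have "p x = (\<Sum>m\<in>{m. (\<Sum>i\<in>UNIV. m i) \<le> n}. a m * monomial_fun m (fst x))"
      using a[of "fst x"] by (metis prod.collapse)
    then show "p x = (\<Sum>(m, l)\<in>?M. (\<lambda>(m, l). a m) (m, l) * monomial_fun m (fst x) * (\<Prod>j<d - CARD('k). complex_of_real (snd x j) ^ l j))"
      by (simp add: d sum.cartesian_product[symmetric])
  qed
qed

text \<open>The second factor is a single point of mass 1, so a property of almost every slice holds
  on the only slice. The argument covers every representation of f and g, not just the one
  constructed.\<close>

lemma gaussian_form_polynomial_Rd: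
  fixes f g :: "(real ^ 'k) \<times> (nat \<Rightarrow> real) \<Rightarrow> complex"
  assumes d: "CARD('k) = d" and gf: "gaussian_form d N f g p q x0 w0 A"
  shows "polynomial_Rd d p \<and> polynomial_Rd d q"
proof -
  interpret pair_sigma_finite "Rn 0" "Rn 0" using sigma_finite_Rn by (simp add: pair_sigma_finite_def)
  have "AE z in Rn 0 \<Otimes>\<^sub>M Rn 0. polynomial_function (\<lambda>x1. p (x1, fst z)) \<and> polynomial_function (\<lambda>x1. q (x1, uminus_Rn 0 (snd z)))"
    using gf unfolding gaussian_form_def Let_def case_prod_unfold d diff_self_eq_0 by (auto elim: eventually_mono)
  from AE_pair[OF this] have "polynomial_function (\<lambda>x1. p (x1, \<lambda>_. undefined)) \<and> polynomial_function (\<lambda>x1. q (x1, uminus_Rn 0 (\<lambda>_. undefined)))"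
    unfolding Rn_0 AE_count_space by simp
  moreover have "uminus_Rn 0 (\<lambda>_. undefined) = (\<lambda>_. undefined)" by (auto simp: uminus_Rn_def)
  ultimately show ?thesis using polynomial_Rd_full_dimension[OF d] by simp
qed

text \<open>Centre and frequency are real and the matrix is the identity, so the Gaussian is a
  time-frequency shift of exp (- pi s^2). It remains to expand the polynomial, recentred at u, in
  Hermite polynomials.\<close>

lemma hermite_combination_if_poly_gauss:
  fixes f :: "(real ^ 'k) \<times> (nat \<Rightarrow> real) \<Rightarrow> complex"
  assumes d: "CARD('k) = d" and f [measurable]: "f \<in> borel_measurable (Rd d)"
    and ae: "AE x2 in Rn (d - CARD('k)). poly_gauss u v a (\<lambda>t. f (t, x2))"
  shows "hermite_combination d u v f"
proof -
  define z :: "nat \<Rightarrow> real" where "z = (\<lambda>_. undefined)"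
  have "poly_gauss u v a (\<lambda>t. f (t, z))" using ae unfolding d diff_self_eq_0 Rn_0 AE_count_space by (simp add: z_def)
  then obtain P where P: "poly_upto a P" and eq: "AE t in lborel. f (t, z) = P t * gaussian (cvec u) (cvec v) (mat 1) t"
    unfolding poly_gauss_def by blast
  from P obtain c0 where c0: "\<And>x. P x = (\<Sum>m\<in>{m. (\<Sum>i\<in>UNIV. m i) \<le> a}. c0 m * monomial_fun m x)"
    unfolding poly_upto_def by blast
  have "is_poly (\<lambda>s. P (s + u))"
    unfolding c0 monomial_fun_def vector_add_component of_real_add
    by (intro is_poly_sum is_poly_mult is_poly_const is_poly_prod is_poly_power is_poly_add is_poly_coord)
  then obtain n where n: "poly_upto n (\<lambda>s. P (s + u))" unfolding is_poly_def by blast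
  \<comment> \<open>Hermite polynomials with the argument scaled by sqrt (2 pi) as in
    \<open>hermite_fun\<close>; scaling keeps the degree j, so they form a triangular basis.\<close>
  define H where "H j = pcompose (map_poly complex_of_real (hermite_poly j)) [:0, of_real (sqrt (2 * pi)):]" for j
  have H: "poly (H j) (of_real r) = of_real (poly (hermite_poly j) (sqrt (2 * pi) * r))" for j r
  proof -
    have "poly (map_poly complex_of_real p) (of_real x) = of_real (poly p x)" for p x
      by (induction p) (simp_all add: map_poly_pCons)
    from this[of "hermite_poly j" "sqrt (2 * pi) * r"] show ?thesis
      by (simp add: H_def poly_pcompose mult.commute)
  qed
  have degH: "degree (H j) = j" "H 0 \<noteq> 0" for j
    by (simp_all add: H_def degree_pcompose degree_map_poly degree_hermite_poly pcompose_1)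
  let ?M = "{m :: 'k \<Rightarrow> nat. (\<Sum>i\<in>UNIV. m i) \<le> n}"
  obtain D where D: "\<And>s. P (s + u) = (\<Sum>m\<in>?M. D m * (\<Prod>i\<in>UNIV. poly (H (m i)) (of_real (s $ i))))"
    using poly_upto_triangular_basis[OF n, of "\<lambda>_. H"] degH by blast
  have form: "P t * gaussian (cvec u) (cvec v) (mat 1) t =
     (\<Sum>m\<in>?M. D m * (exp (2 * pi * \<i> * complex_of_real (v \<bullet> t)) * complex_of_real (hermite_fun m (t - u))))" for t
  proof -
    have m: "map_matrix complex_of_real (mat 1) = (mat 1 :: complex ^ 'k ^ 'k)"
      by (simp add: map_matrix_def mat_def vec_eq_iff)
    have ga: "gaussian (cvec u) (cvec v) (mat 1) t = exp (2 * pi * \<i> * complex_of_real (v \<bullet> t)) * of_real (exp (- pi * ((t - u) \<bullet> (t - u))))"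
      unfolding gaussian_def m matrix_vector_mul_lid cdot_simps(9)[symmetric] cdot_simps(7) by (simp add: exp_of_real[symmetric])
    have he: "complex_of_real (hermite_fun m s) = (\<Prod>i\<in>UNIV. poly (H (m i)) (of_real (s $ i))) * of_real (exp (- pi * (s \<bullet> s)))" for m and s :: "real ^ 'k"
    proof -
      have "(\<Prod>i\<in>UNIV. exp (- pi * (s $ i)\<^sup>2)) = exp (- pi * (s \<bullet> s))"
        by (simp add: exp_sum[OF finite, symmetric] inner_vec_def sum_distrib_left power2_eq_square sum_negf)
      then show ?thesis by (simp add: hermite_fun_def prod.distrib H)
    qed
    have Pt: "P t = (\<Sum>m\<in>?M. D m * (\<Prod>i\<in>UNIV. poly (H (m i)) (of_real ((t - u) $ i))))"
      using D[of "t - u"] by (simp only: diff_add_cancel)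
    show ?thesis unfolding ga he Pt sum_distrib_right by (simp only: mult_ac)
  qed
  show ?thesis
    unfolding hermite_combination_def
  proof (intro exI conjI)
    show "finite ?M" by (rule finite_multiindices)
    have [measurable]: "f \<in> borel_measurable (lborel \<Otimes>\<^sub>M Rn 0)" using f unfolding Rd_def d by simp
    have [measurable]: "hermite_fun m \<in> borel_measurable borel" for m :: "'k \<Rightarrow> nat"
      unfolding hermite_fun_def poly_altdef by measurable
    show "AE x in Rd d. f x = (\<Sum>m\<in>?M. D m * (exp (2 * pi * \<i> * complex_of_real (v \<bullet> fst x)) * complex_of_real (hermite_fun m (fst x - u))))"
      unfolding Rd_def d diff_self_eq_0
    proof (subst pair_sigma_finite.AE_pair_swapped[OF pair_sigma_finite_Rn])
      show "AE y in Rn 0. AE x in lborel. f (x, y) = (\<Sum>m\<in>?M. D m * (exp (2 * pi * \<i> * complex_of_real (v \<bullet> fst (x, y))) * complex_of_real (hermite_fun m (fst (x, y) - u))))"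
        using eq unfolding form Rn_0 AE_count_space by (simp add: z_def)
    qed measurable
  qed
qed

theorem theorem6p1:
  fixes f g :: "(real ^ 'k) \<times> (nat \<Rightarrow> real) \<Rightarrow> complex"
    and d :: nat and \<alpha> c N :: real
  assumes kd: "CARD('k) \<le> d"
    and f: "L2 (Rd d) f" and g: "L2 (Rd d) g"
    and \<alpha>: "\<alpha> > 0" and c: "c > 0" and N: "N \<ge> 0"
    and decay: "AE l in Rd d \<Otimes>\<^sub>M Rd d.
      cmod (partial_stft d g f l)
        \<le> c * (1 + norm_R2d d l) powr N * exp (- pi * \<alpha> * (norm_R2d d l)\<^sup>2 / 2)"
  shows
    "(\<alpha> > 1 \<longrightarrow> ae_zero (Rd d) f \<or> ae_zero (Rd d) g) \<and>
     (\<alpha> = 1 \<longrightarrow>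
        (ae_zero (Rd d) f \<or> ae_zero (Rd d) g) \<or>
        (\<not> ae_zero (Rd d) f \<and> \<not> ae_zero (Rd d) g \<and>
         (\<exists>p q x0 w0 A. gaussian_form d N f g p q x0 w0 A))) \<and>
     (\<alpha> = 1 \<and> CARD('k) = d \<and> \<not> ae_zero (Rd d) f \<and> \<not> ae_zero (Rd d) g \<longrightarrow>
        (\<forall>p q x0 w0 A. gaussian_form d N f g p q x0 w0 A \<longrightarrow>
           polynomial_Rd d p \<and> polynomial_Rd d q) \<and>
        (\<exists>u v. hermite_combination d u v f \<and> hermite_combination d u v g))"
proof -
  let ?R = "Rn (d - CARD('k))"
  have fm: "f \<in> borel_measurable (Rd d)" and gm: "g \<in> borel_measurable (Rd d)"
    using f g by (auto simp: L2_def)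
  define ZF where "ZF x2 \<longleftrightarrow> (AE t in lborel. f (t, x2) = 0)" for x2
  define ZG where "ZG y2 \<longleftrightarrow> (AE t in lborel. g (t, y2) = 0)" for y2
  have zf: "ae_zero (Rd d) f \<longleftrightarrow> (AE x2 in ?R. ZF x2)" and zg: "ae_zero (Rd d) g \<longleftrightarrow> (AE x2 in ?R. ZG x2)"
    unfolding ZF_def ZG_def by (rule ae_zero_Rd_iff fm gm)+
  have part1: "ae_zero (Rd d) f \<or> ae_zero (Rd d) g" if "\<alpha> > 1"
  proof -
    have "AE x2 in ?R. AE y2 in ?R. ZF x2 \<or> ZG y2 \<or>
       (\<exists>u v n m. real (n + m) \<le> - 1 \<and> poly_gauss u v n (\<lambda>t. f (t, x2)) \<and> poly_gauss u v m (\<lambda>t. g (t, y2)))"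
      unfolding ZF_def ZG_def using that by (intro slice_dichotomy[OF f g c N decay]) simp
    \<comment> \<open>A sum of two degrees cannot be at most -1, so only the vanishing alternatives
      remain. If \<open>ZF x2\<close> fails, almost all slices of g vanish, a statement free of
      x2.\<close>
    then have "AE x2 in ?R. ZF x2 \<or> (AE y2 in ?R. ZG y2)"
    proof eventually_elim
      case (elim x2)
      have "\<not> real (n + m) \<le> - 1" for n m by simp
      then show ?case using elim by (cases "ZF x2") auto
    qed
    then show ?thesis unfolding zf zg by (cases "AE y2 in ?R. ZG y2") auto
  qed
  have core: "\<exists>u v a b. real (a + b) \<le> N \<and> (AE x2 in ?R. poly_gauss u v a (\<lambda>t. f (t, x2))) \<and> (AE x2 in ?R. poly_gauss u v b (\<lambda>t. g (t, x2)))"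
    if \<alpha>1: "\<alpha> = 1" and nz: "\<not> ae_zero (Rd d) f" "\<not> ae_zero (Rd d) g"
  proof -
    have rel0: "AE x2 in ?R. AE y2 in ?R. ZF x2 \<or> ZG y2 \<or>
       (\<exists>u v n m. real (n + m) \<le> N \<and> poly_gauss u v n (\<lambda>t. f (t, x2)) \<and> poly_gauss u v m (\<lambda>t. g (t, y2)))"
      unfolding ZF_def ZG_def using \<alpha>1 by (intro slice_dichotomy[OF f g c N decay]) simp
    define PF where "PF = (\<lambda>(u, v) n x2. poly_gauss u v n (\<lambda>t. f (t, x2)))"
    define PG where "PG = (\<lambda>(u, v) n x2. poly_gauss u v n (\<lambda>t. g (t, x2)))"
    \<comment> \<open>Degrees are natural numbers, so the real budget N may be replaced by its
      integer part, as natural subtraction in \<open>common_parameters\<close> requires.\<close>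
    have floor: "real k \<le> N \<longleftrightarrow> k \<le> nat \<lfloor>N\<rfloor>" for k using N by (simp add: le_nat_floor le_nat_iff le_floor_iff)
    have rel: "AE x2 in ?R. AE y2 in ?R. ZF x2 \<or> ZG y2 \<or> (\<exists>w n m. n + m \<le> nat \<lfloor>N\<rfloor> \<and> PF w n x2 \<and> PG w m y2)"
      using rel0 unfolding floor PF_def PG_def by simp
    have mono: "poly_gauss u v n' F" if "poly_gauss u v n F" "n \<le> n'" for u v n n' and F :: "real ^ 'k \<Rightarrow> complex"
      using that poly_upto_mono unfolding poly_gauss_def by blast
    \<comment> \<open>Slices that vanish fit any parameters, so the exceptional alternatives
      \<open>ZF\<close> and \<open>ZG\<close> disappear from the conclusion.\<close>
    have zero: "poly_gauss u v n F" if "AE t in lborel. F t = 0" for u v n and F :: "real ^ 'k \<Rightarrow> complex"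
      unfolding poly_gauss_def using that poly_upto_mono[OF poly_upto_const, of n 0]
      by (intro exI[of _ "\<lambda>_. 0"]) auto
    obtain w a b where ab: "a + b \<le> nat \<lfloor>N\<rfloor>" "AE x2 in ?R. ZF x2 \<or> PF w a x2" "AE x2 in ?R. ZG x2 \<or> PG w b x2"
    proof (rule common_parameters[OF rel nz[unfolded zf zg]])
      show "w = w'" if "\<not> ZF x" "PF w n x" "PF w' n' x" for x w w' n n'
        using that poly_gauss_unique[of "\<lambda>t. f (t, x)" "fst w" "snd w" n "fst w'" "snd w'" n']
        by (simp add: ZF_def PF_def case_prod_unfold prod_eq_iff)
      show "w = w'" if "\<not> ZG x" "PG w n x" "PG w' n' x" for x w w' n n'
        using that poly_gauss_unique[of "\<lambda>t. g (t, x)" "fst w" "snd w" n "fst w'" "snd w'" n']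
        by (simp add: ZG_def PG_def case_prod_unfold prod_eq_iff)
      show "PF w n' x" if "PF w n x" "n \<le> n'" for w n n' x using that mono unfolding PF_def by (auto split: prod.splits)
      show "PG w n' x" if "PG w n x" "n \<le> n'" for w n n' x using that mono unfolding PG_def by (auto split: prod.splits)
    qed (use that in blast)
    obtain u v where w: "w = (u, v)" by (cases w)
    have "AE x2 in ?R. poly_gauss u v a (\<lambda>t. f (t, x2))"
      using ab(2) by eventually_elim (auto simp: ZF_def PF_def w zero)
    moreover have "AE x2 in ?R. poly_gauss u v b (\<lambda>t. g (t, x2))"
      using ab(3) by eventually_elim (auto simp: ZG_def PG_def w zero)
    ultimately show ?thesis using ab(1) floor by blast
  qed
  have part2: "\<exists>p q x0 w0 A. gaussian_form d N f g p q x0 w0 A"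
    if "\<alpha> = 1" "\<not> ae_zero (Rd d) f" "\<not> ae_zero (Rd d) g"
    using core[OF that] gaussian_form_exists fm gm by blast
  have part3: "\<exists>u v. hermite_combination d u v f \<and> hermite_combination d u v g"
    if "\<alpha> = 1" "\<not> ae_zero (Rd d) f" "\<not> ae_zero (Rd d) g" "CARD('k) = d"
    using core[OF that(1-3)] hermite_combination_if_poly_gauss[OF that(4)] fm gm by blast
  show ?thesis
    using part1 part2 part3 gaussian_form_polynomial_Rd by blast
qed

end
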